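(* Let $\mathfrak{g}$ be a Hausdorff, locally convex, nilpotent Lie algebra over $\mathbb{K}\in\{\mathbb{R},\mathbb{C}\}$ with nilpotency index $N+1$ (that is, $\mathfrak{g}^{(N)}\neq\{0\}=\mathfrak{g}^{(N+1)}$), let $G=(\mathfrak{g},\ast)$ be the corresponding simply connected Lie group, let $\lambda$ be the left regular representation of $G$ on $\mathcal{C}(\mathfrak{g},\mathbb{K})$, and let $\mathfrak{g}^*$ be the topological dual of $\mathfrak{g}$. Define $$\mathcal{F}_G=\overline{\mathrm{span}}\,(\lambda(G)\mathfrak{g}^* )\subseteq\mathcal{C}(\mathfrak{g},\mathbb{K}).$$ Then the following assertions hold: (1) The function space $\mathcal{F}_G$ is a closed linear subspace of $\mathcal{P}_N(\mathfrak{g},\mathbb{K})$ which is invariant under the left regular representation $\lambda$ and contains the constant functions. (2) The mapping $\lambda_G\colon G\to\mathrm{End}(\mathcal{F}_G)$, $x\mapsto\lambda(x)|_{\mathcal{F}_G}$, is a faithful (i.e. injective) smooth representation of the Lie group $G$. Moreover, for every $x\in G$ we have $(\lambda_G(x)-\mathbf{1})^{2^{N-1}N+1}=0$. (3) The mapping $\mathrm{d}\lambda_G\colon\mathfrak{g}\to\mathrm{End}(\mathcal{F}_G)$, $x\mapsto\mathrm{d}\lambda(x)|_{\mathcal{F}_G}$, is a faithful (i.e. injective) representation of the Lie algebra $\mathfrak{g}$, and for every $x\in\mathfrak{g}$ we have $\mathrm{d}\lambda_G(x)^{2^{N-1}N+1}=0$.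
   Context: A locally convex Lie algebra is a locally convex space with a continuous Lie bracket. Put $\mathfrak{g}^{(1)}=\mathfrak{g}$ and $\mathfrak{g}^{(j)}=[\mathfrak{g},\mathfrak{g}^{(j-1)}]$ for $j\ge 2$; nilpotency index $N+1$, with $N\ge1$ an integer, means $\mathfrak{g}^{(N)}\ne\{0\}=\mathfrak{g}^{(N+1)}$. $G=(\mathfrak{g},\ast)$ is the simply connected locally convex Lie group with underlying manifold $\mathfrak{g}$, whose group operation $\ast$ is given by the (finite) Baker-Campbell-Hausdorff formula $x\ast y=x+y+\tfrac12[x,y]+\cdots$; its exponential map is the identity, its unit is $0$, and the inverse of $x$ is $-x$. $\mathcal{C}(\mathfrak{g},\mathbb{K})$ is the space of continuous functions $\mathfrak{g}\to\mathbb{K}$ with the topology of uniform convergence on bounded sets. The left regular representation $\lambda\colon G\to\mathrm{End}(\mathcal{C}(\mathfrak{g},\mathbb{K}))$ is $(\lambda(x)\phi)(y)=\phi((-x)\ast y)$. For $\phi\in\mathcal{C}(\mathfrak{g},\mathbb{K})$ and $x,y\in\mathfrak{g}$ put $$(\mathrm{d}\lambda(x)\phi)(y)=\lim_{t\to0}\frac{\phi((-tx)\ast y)-\phi(y)}{t}$$ whenever the limit exists. $\mathrm{End}$ denotes the algebra of linear operators, and $\mathbf 1$ is the identity operator. $\mathcal{P}_m(\mathfrak{g},\mathbb{K})$ is the linear space of continuous $\mathbb{K}$-valued polynomial functions of degree $\le m$ on $\mathfrak{g}$, with the topology of uniform convergence on bounded sets. For $S\subseteq \mathcal{C}(\mathfrak{g},\mathbb{K})$,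 $\overline{\mathrm{span}}\,(S)$ is the closure in $\mathcal{C}(\mathfrak{g},\mathbb{K})$ of the linear span of $S$, and $\lambda(G)\mathfrak{g}^*=\{\lambda(x)\xi\mid x\in G,\ \xi\in\mathfrak{g}^*\}$. A representation of $G$ is smooth if its representation space consists only of smooth vectors, i.e. for every vector $\phi$ the orbit map $x\mapsto\lambda_G(x)\phi$ is smooth (in the usual sense for maps between locally convex spaces). *)

theory Defs
  imports "HOL-Analysis.Analysis" "HOL-Library.Function_Algebras"
begin

section \<open>Locally convex spaces over the reals or the complex numbers\<close>

text \<open>
  The ground field is a type of sort \<open>{real_normed_field, euclidean_space}\<close>: a finite-dimensional
  commutative division algebra over the reals with multiplicative norm.  Both \<^typ>\<open>real\<close> and
  \<^typ>\<open>complex\<close> are instances, and by Frobenius' theorem there are no others up to isometric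
  isomorphism.  The Hausdorff property is carried by the class \<open>t2_space\<close>.
\<close>

locale locally_convex_space = vector_space scl
  for scl :: "'k::{real_normed_field, euclidean_space}
                  \<Rightarrow> 'g::{topological_ab_group_add, t2_space} \<Rightarrow> 'g" +
  assumes continuous_scale: "continuous_on UNIV (\<lambda>(c, x). scl c x)"
    and locally_convex:
      "\<lbrakk>open U; 0 \<in> U\<rbrakk> \<Longrightarrow>
        \<exists>V. open V \<and> 0 \<in> V \<and> V \<subseteq> U \<and>
          (\<forall>x\<in>V. \<forall>y\<in>V. \<forall>t::real. 0 \<le> t \<and> t \<le> 1 \<longrightarrow>
             scl (of_real (1 - t)) x + scl (of_real t) y \<in> V)"

definition vn_bounded ::
  "('k::real_normed_field \<Rightarrow> 'g::{topological_space, zero} \<Rightarrow> 'g) \<Rightarrow> 'g set \<Rightarrow> bool" where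
  "vn_bounded scl B \<longleftrightarrow>
     (\<forall>V. open V \<and> 0 \<in> V \<longrightarrow> (\<exists>r>0. \<forall>t::'k. r \<le> norm t \<longrightarrow> B \<subseteq> scl t ` V))"

definition topological_dual ::
  "('k::real_normed_field \<Rightarrow> 'g::topological_ab_group_add \<Rightarrow> 'g) \<Rightarrow> ('g \<Rightarrow> 'k) set" where
  "topological_dual scl =
     {\<xi>. Vector_Spaces.linear scl (*) \<xi> \<and> continuous_on UNIV \<xi>}"


section \<open>Nilpotent locally convex Lie algebras\<close>

locale lc_lie_algebra = locally_convex_space scl
  for scl :: "'k::{real_normed_field, euclidean_space}
                  \<Rightarrow> 'g::{topological_ab_group_add, t2_space} \<Rightarrow> 'g" +
  fixes bracket :: "'g \<Rightarrow> 'g \<Rightarrow> 'g"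
  assumes bracket_linear_left: "Vector_Spaces.linear scl scl (\<lambda>x. bracket x y)"
    and bracket_linear_right: "Vector_Spaces.linear scl scl (bracket x)"
    and bracket_self: "bracket x x = 0"
    and jacobi: "bracket x (bracket y z) + bracket y (bracket z x) + bracket z (bracket x y) = 0"
    and continuous_bracket: "continuous_on UNIV (\<lambda>(x, y). bracket x y)"

text \<open>The numbering starts at 1; the value at 0 is a dummy.\<close>

fun lower_central ::
  "('k::field \<Rightarrow> 'g::ab_group_add \<Rightarrow> 'g) \<Rightarrow> ('g \<Rightarrow> 'g \<Rightarrow> 'g) \<Rightarrow> nat \<Rightarrow> 'g set" where
  "lower_central scl bracket 0 = UNIV"
| "lower_central scl bracket (Suc 0) = UNIV"
| "lower_central scl bracket (Suc (Suc j)) =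
     module.span scl {bracket x y | x y. y \<in> lower_central scl bracket (Suc j)}"

locale nilpotent_lc_lie_algebra = lc_lie_algebra scl bracket
  for scl :: "'k::{real_normed_field, euclidean_space}
                  \<Rightarrow> 'g::{topological_ab_group_add, t2_space} \<Rightarrow> 'g"
  and bracket :: "'g \<Rightarrow> 'g \<Rightarrow> 'g" +
  fixes N :: nat
  assumes N_ge_1: "N \<ge> 1"
    and lower_central_N: "lower_central scl bracket N \<noteq> {0}"
    and lower_central_Suc_N: "lower_central scl bracket (N + 1) = {0}"


section \<open>The Baker-Campbell-Hausdorff multiplication\<close>

fun nested_bracket :: "('g \<Rightarrow> 'g \<Rightarrow> 'g::zero) \<Rightarrow> 'g list \<Rightarrow> 'g" where
  "nested_bracket bracket [] = 0"
| "nested_bracket bracket [a] = a"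
| "nested_bracket bracket (a # b # w) = bracket a (nested_bracket bracket (b # w))"

text \<open>
  Dynkin's form of the Baker-Campbell-Hausdorff series,
  \[ x * y = \sum_{k \ge 1} \frac{(-1)^{k-1}}{k}
       \sum_{r_i + s_i > 0} \frac{[x^{r_1} y^{s_1} \cdots x^{r_k} y^{s_k}]}
         {\bigl(\sum_i (r_i + s_i)\bigr) \prod_i r_i! \, s_i!}, \]
  where the bracket of a word is nested to the right.  A term is indexed by the list
  of the pairs \<open>(r\<^sub>i, s\<^sub>i)\<close>.  All terms of degree greater than \<open>N\<close> vanish when
  \<open>\<gg>\<^bsup>(N+1)\<^esup> = 0\<close>, so the series is cut off at degree \<open>N\<close>.
\<close>

definition dynkin_degree :: "(nat \<times> nat) list \<Rightarrow> nat" where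
  "dynkin_degree p = (\<Sum>(r, s)\<leftarrow>p. r + s)"

definition dynkin_index :: "nat \<Rightarrow> (nat \<times> nat) list set" where
  "dynkin_index N = {p. p \<noteq> [] \<and> (\<forall>(r, s)\<in>set p. r + s > 0) \<and> dynkin_degree p \<le> N}"

definition dynkin_coeff :: "(nat \<times> nat) list \<Rightarrow> 'k::field_char_0" where
  "dynkin_coeff p =
     (- 1) ^ (length p - 1) /
       (of_nat (length p) * of_nat (dynkin_degree p) * (\<Prod>(r, s)\<leftarrow>p. fact r * fact s))"

definition dynkin_word :: "'g \<Rightarrow> 'g \<Rightarrow> (nat \<times> nat) list \<Rightarrow> 'g list" where
  "dynkin_word x y p = concat (map (\<lambda>(r, s). replicate r x @ replicate s y) p)"

definition bch ::
  "('k::field_char_0 \<Rightarrow> 'g::ab_group_add \<Rightarrow> 'g) \<Rightarrow> ('g \<Rightarrow> 'g \<Rightarrow> 'g) \<Rightarrow> nat \<Rightarrow> 'g \<Rightarrow> 'g \<Rightarrow> 'g" where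
  "bch scl bracket N x y =
     (\<Sum>p\<in>dynkin_index N. scl (dynkin_coeff p) (nested_bracket bracket (dynkin_word x y p)))"

lemma finite_dynkin_index: "finite (dynkin_index N)"
proof (rule finite_subset)
  have len: "length p \<le> dynkin_degree p" if "\<forall>(r, s)\<in>set p. r + s > 0" for p
    using that by (induction p) (auto simp: dynkin_degree_def)
  have mem: "r + s \<le> dynkin_degree p" if "(r, s) \<in> set p" for r s p
    using that by (induction p) (auto simp: dynkin_degree_def)
  show "dynkin_index N \<subseteq> {p. set p \<subseteq> {..N} \<times> {..N} \<and> length p \<le> N}"
  proof
    fix p assume p: "p \<in> dynkin_index N"
    have "length p \<le> N"
      using p len[of p] by (simp add: dynkin_index_def)
    moreover have "set p \<subseteq> {..N} \<times> {..N}"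
      using p mem[of _ _ p] by (fastforce simp: dynkin_index_def)
    ultimately show "p \<in> {p. set p \<subseteq> {..N} \<times> {..N} \<and> length p \<le> N}" by simp
  qed
  show "finite {p. set p \<subseteq> {..N} \<times> {..N} \<and> length p \<le> N}"
    by (rule finite_lists_length_le) simp
qed


section \<open>Function spaces\<close>

definition fun_scale :: "'k::field \<Rightarrow> ('g \<Rightarrow> 'k) \<Rightarrow> 'g \<Rightarrow> 'k" where
  "fun_scale c \<phi> = (\<lambda>y. c * \<phi> y)"

lemma vector_space_fun_scale: "vector_space fun_scale"
  by unfold_locales (auto simp: fun_scale_def fun_eq_iff algebra_simps)

text \<open>
  The space \<open>\<C>(\<gg>, \<bbbK>)\<close> with the topology of uniform convergence on bounded sets.  Since
  continuous functions need not be bounded on bounded sets, the sets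
  \<open>{\<psi>. \<forall>y\<in>B. norm (\<psi> y - \<phi> y) < \<epsilon>}\<close> form a neighbourhood base at \<open>\<phi>\<close> but need not be open.
\<close>

definition ucb_open ::
  "('k::real_normed_field \<Rightarrow> 'g::{topological_space, zero} \<Rightarrow> 'g) \<Rightarrow> ('g \<Rightarrow> 'k) set \<Rightarrow> bool" where
  "ucb_open scl U \<longleftrightarrow>
     U \<subseteq> {\<phi>. continuous_on UNIV \<phi>} \<and>
     (\<forall>\<phi>\<in>U. \<exists>B \<epsilon>. vn_bounded scl B \<and> \<epsilon> > 0 \<and>
        {\<psi>. continuous_on UNIV \<psi> \<and> (\<forall>y\<in>B. norm (\<psi> y - \<phi> y) < \<epsilon>)} \<subseteq> U)"

definition ucb_topology ::
  "('k::real_normed_field \<Rightarrow> 'g::{topological_space, zero} \<Rightarrow> 'g) \<Rightarrow> ('g \<Rightarrow> 'k) topology" where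
  "ucb_topology scl = topology (ucb_open scl)"

lemma vn_bounded_Un:
  assumes "vn_bounded scl A" "vn_bounded scl B"
  shows "vn_bounded scl (A \<union> B)"
  unfolding vn_bounded_def
proof (intro allI impI)
  fix V :: "'b set"
  assume V: "open V \<and> 0 \<in> V"
  obtain r where r: "r > 0" "\<And>t. r \<le> norm t \<Longrightarrow> A \<subseteq> scl t ` V"
    using assms(1) V unfolding vn_bounded_def by blast
  obtain q where q: "q > 0" "\<And>t. q \<le> norm t \<Longrightarrow> B \<subseteq> scl t ` V"
    using assms(2) V unfolding vn_bounded_def by blast
  show "\<exists>r>0. \<forall>t. r \<le> norm t \<longrightarrow> A \<union> B \<subseteq> scl t ` V"
    using r q by (intro exI[of _ "max r q"]) simp
qed

lemma istopology_ucb_open: "istopology (ucb_open scl)"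
  unfolding istopology_def
proof (intro conjI allI impI)
  fix U V assume U: "ucb_open scl U" and V: "ucb_open scl V"
  show "ucb_open scl (U \<inter> V)"
    unfolding ucb_open_def
  proof (intro conjI ballI)
    show "U \<inter> V \<subseteq> {\<phi>. continuous_on UNIV \<phi>}"
      using U unfolding ucb_open_def by blast
    fix \<phi> assume \<phi>: "\<phi> \<in> U \<inter> V"
    obtain A d where A: "vn_bounded scl A" "d > 0"
      "{\<psi>. continuous_on UNIV \<psi> \<and> (\<forall>y\<in>A. norm (\<psi> y - \<phi> y) < d)} \<subseteq> U"
      using U \<phi> unfolding ucb_open_def by blast
    obtain B e where B: "vn_bounded scl B" "e > 0"
      "{\<psi>. continuous_on UNIV \<psi> \<and> (\<forall>y\<in>B. norm (\<psi> y - \<phi> y) < e)} \<subseteq> V"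
      using V \<phi> unfolding ucb_open_def by blast
    show "\<exists>B \<epsilon>. vn_bounded scl B \<and> \<epsilon> > 0 \<and>
        {\<psi>. continuous_on UNIV \<psi> \<and> (\<forall>y\<in>B. norm (\<psi> y - \<phi> y) < \<epsilon>)} \<subseteq> U \<inter> V"
      using A B vn_bounded_Un[OF A(1) B(1)]
      by (intro exI[of _ "A \<union> B"] exI[of _ "min d e"]) auto
  qed
next
  fix K assume K: "\<forall>U\<in>K. ucb_open scl U"
  show "ucb_open scl (\<Union>K)"
    unfolding ucb_open_def
  proof (intro conjI ballI)
    show "\<Union>K \<subseteq> {\<phi>. continuous_on UNIV \<phi>}"
      using K unfolding ucb_open_def by blast
    fix \<phi> assume "\<phi> \<in> \<Union>K"
    then obtain U where U: "U \<in> K" "\<phi> \<in> U" by blast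
    then obtain B \<epsilon> where "vn_bounded scl B" "\<epsilon> > 0"
      "{\<psi>. continuous_on UNIV \<psi> \<and> (\<forall>y\<in>B. norm (\<psi> y - \<phi> y) < \<epsilon>)} \<subseteq> U"
      using K unfolding ucb_open_def by blast
    with U show "\<exists>B \<epsilon>. vn_bounded scl B \<and> \<epsilon> > 0 \<and>
        {\<psi>. continuous_on UNIV \<psi> \<and> (\<forall>y\<in>B. norm (\<psi> y - \<phi> y) < \<epsilon>)} \<subseteq> \<Union>K"
      by blast
  qed
qed

lemma openin_ucb_topology: "openin (ucb_topology scl) = ucb_open scl"
  by (simp add: ucb_topology_def istopology_ucb_open topology_inverse')

definition multilinear_form ::
  "('k::field \<Rightarrow> 'g::ab_group_add \<Rightarrow> 'g) \<Rightarrow> nat \<Rightarrow> ('g list \<Rightarrow> 'k) \<Rightarrow> bool" where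
  "multilinear_form scl j \<psi> \<longleftrightarrow>
     (\<forall>xs. length xs = j \<longrightarrow>
        (\<forall>i<j. Vector_Spaces.linear scl (*) (\<lambda>x. \<psi> (xs[i := x]))))"

definition poly_functions ::
  "('k::real_normed_field \<Rightarrow> 'g::topological_ab_group_add \<Rightarrow> 'g) \<Rightarrow> nat \<Rightarrow> ('g \<Rightarrow> 'k) set" where
  "poly_functions scl m =
     {\<phi>. continuous_on UNIV \<phi> \<and>
        (\<exists>\<psi>. (\<forall>j\<le>m. multilinear_form scl j (\<psi> j)) \<and>
             (\<forall>x. \<phi> x = (\<Sum>j\<le>m. \<psi> j (replicate j x))))}"


section \<open>Smooth maps and representations\<close>

text \<open>
  A map \<open>f\<close> from a locally convex space to a locally convex space with topology \<open>T\<close>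
  is smooth (in the sense of Michal and Bastiani) iff all iterated directional derivatives
  \<open>D k x (v\<^sub>0, \<dots>, v\<^bsub>k-1\<^esub>)\<close> exist and are jointly continuous in \<open>(x, v\<^sub>0, \<dots>, v\<^bsub>k-1\<^esub>)\<close>.
  Difference quotients are taken over the ground field.  Tuples of length \<open>k\<close> are
  functions that are \<open>undefined\<close> outside \<open>{..<k}\<close>.  The target need only be a
  subset of the type \<open>'b\<close>, namely the underlying set of \<open>T\<close>.
\<close>

definition smooth_map ::
  "('k::real_normed_field \<Rightarrow> 'a::topological_ab_group_add \<Rightarrow> 'a) \<Rightarrow>
   ('k \<Rightarrow> 'b::ab_group_add \<Rightarrow> 'b) \<Rightarrow> 'b topology \<Rightarrow> ('a \<Rightarrow> 'b) \<Rightarrow> bool" where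
  "smooth_map scl scl' T f \<longleftrightarrow>
     (\<exists>D :: nat \<Rightarrow> 'a \<Rightarrow> (nat \<Rightarrow> 'a) \<Rightarrow> 'b.
        (\<forall>x v. D 0 x (restrict v {..<0}) = f x) \<and>
        (\<forall>k x v. limitin T
           (\<lambda>t. scl' (inverse t)
                  (D k (x + scl t (v k)) (restrict v {..<k}) - D k x (restrict v {..<k})))
           (D (Suc k) x (restrict v {..<Suc k})) (at 0)) \<and>
        (\<forall>k. continuous_map
           (prod_topology euclidean (product_topology (\<lambda>_. euclidean) {..<k})) T
           (\<lambda>(x, v). D k x v)))"

text \<open>
  Linear operators on a linear subspace \<open>V\<close> of the functions on \<open>\<gg>\<close>; they are
  \<open>undefined\<close> outside \<open>V\<close>, so that equality of operators is equality on \<open>V\<close>.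
\<close>

definition End_on :: "('g \<Rightarrow> 'k::field) set \<Rightarrow> (('g \<Rightarrow> 'k) \<Rightarrow> 'g \<Rightarrow> 'k) set" where
  "End_on V =
     {T \<in> V \<rightarrow>\<^sub>E V. (\<forall>\<phi>\<in>V. \<forall>\<psi>\<in>V. T (\<phi> + \<psi>) = T \<phi> + T \<psi>) \<and>
                (\<forall>c. \<forall>\<phi>\<in>V. T (fun_scale c \<phi>) = fun_scale c (T \<phi>))}"

definition group_representation ::
  "('x \<Rightarrow> 'x \<Rightarrow> 'x) \<Rightarrow> 'x \<Rightarrow> ('g \<Rightarrow> 'k::field) set \<Rightarrow> ('x \<Rightarrow> ('g \<Rightarrow> 'k) \<Rightarrow> 'g \<Rightarrow> 'k) \<Rightarrow> bool" where
  "group_representation prd e V \<pi> \<longleftrightarrow>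
     (\<forall>x. \<pi> x \<in> End_on V) \<and>
     (\<forall>\<phi>\<in>V. \<pi> e \<phi> = \<phi>) \<and>
     (\<forall>x y. \<forall>\<phi>\<in>V. \<pi> (prd x y) \<phi> = \<pi> x (\<pi> y \<phi>))"

definition lie_representation ::
  "('k::field \<Rightarrow> 'x::ab_group_add \<Rightarrow> 'x) \<Rightarrow> ('x \<Rightarrow> 'x \<Rightarrow> 'x) \<Rightarrow> ('g \<Rightarrow> 'k) set \<Rightarrow>
   ('x \<Rightarrow> ('g \<Rightarrow> 'k) \<Rightarrow> 'g \<Rightarrow> 'k) \<Rightarrow> bool" where
  "lie_representation scl bracket V \<rho> \<longleftrightarrow>
     (\<forall>x. \<rho> x \<in> End_on V) \<and>
     (\<forall>x y. \<forall>\<phi>\<in>V. \<rho> (x + y) \<phi> = \<rho> x \<phi> + \<rho> y \<phi>) \<and>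
     (\<forall>c x. \<forall>\<phi>\<in>V. \<rho> (scl c x) \<phi> = fun_scale c (\<rho> x \<phi>)) \<and>
     (\<forall>x y. \<forall>\<phi>\<in>V. \<rho> (bracket x y) \<phi> = \<rho> x (\<rho> y \<phi>) - \<rho> y (\<rho> x \<phi>))"


section \<open>The left regular representation\<close>

text \<open>Throughout, \<open>N\<close> is the degree at which the Baker-Campbell-Hausdorff series is cut off.\<close>

definition left_regular ::
  "('k::field_char_0 \<Rightarrow> 'g::ab_group_add \<Rightarrow> 'g) \<Rightarrow> ('g \<Rightarrow> 'g \<Rightarrow> 'g) \<Rightarrow> nat \<Rightarrow>
   'g \<Rightarrow> ('g \<Rightarrow> 'k) \<Rightarrow> 'g \<Rightarrow> 'k" where
  "left_regular scl bracket N x \<phi> = (\<lambda>y. \<phi> (bch scl bracket N (- x) y))"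

definition left_quotient ::
  "('k::real_normed_field \<Rightarrow> 'g::ab_group_add \<Rightarrow> 'g) \<Rightarrow> ('g \<Rightarrow> 'g \<Rightarrow> 'g) \<Rightarrow> nat \<Rightarrow>
   'g \<Rightarrow> ('g \<Rightarrow> 'k) \<Rightarrow> 'g \<Rightarrow> 'k \<Rightarrow> 'k" where
  "left_quotient scl bracket N x \<phi> y t =
     (\<phi> (bch scl bracket N (- scl t x) y) - \<phi> y) / t"

definition d_left_regular ::
  "('k::real_normed_field \<Rightarrow> 'g::ab_group_add \<Rightarrow> 'g) \<Rightarrow> ('g \<Rightarrow> 'g \<Rightarrow> 'g) \<Rightarrow> nat \<Rightarrow>
   'g \<Rightarrow> ('g \<Rightarrow> 'k) \<Rightarrow> 'g \<Rightarrow> 'k" where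
  "d_left_regular scl bracket N x \<phi> = (\<lambda>y. Lim (at 0) (left_quotient scl bracket N x \<phi> y))"

definition F_G ::
  "('k::real_normed_field \<Rightarrow> 'g::topological_ab_group_add \<Rightarrow> 'g) \<Rightarrow> ('g \<Rightarrow> 'g \<Rightarrow> 'g) \<Rightarrow> nat \<Rightarrow>
   ('g \<Rightarrow> 'k) set" where
  "F_G scl bracket N =
     ucb_topology scl closure_of
       module.span fun_scale
         {left_regular scl bracket N x \<xi> | x \<xi>. \<xi> \<in> topological_dual scl}"

definition lambda_G ::
  "('k::real_normed_field \<Rightarrow> 'g::topological_ab_group_add \<Rightarrow> 'g) \<Rightarrow> ('g \<Rightarrow> 'g \<Rightarrow> 'g) \<Rightarrow> nat \<Rightarrow>
   'g \<Rightarrow> ('g \<Rightarrow> 'k) \<Rightarrow> 'g \<Rightarrow> 'k" where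
  "lambda_G scl bracket N x = restrict (left_regular scl bracket N x) (F_G scl bracket N)"

definition d_lambda_G ::
  "('k::real_normed_field \<Rightarrow> 'g::topological_ab_group_add \<Rightarrow> 'g) \<Rightarrow> ('g \<Rightarrow> 'g \<Rightarrow> 'g) \<Rightarrow> nat \<Rightarrow>
   'g \<Rightarrow> ('g \<Rightarrow> 'k) \<Rightarrow> 'g \<Rightarrow> 'k" where
  "d_lambda_G scl bracket N x = restrict (d_left_regular scl bracket N x) (F_G scl bracket N)"

end

theory Submission
  imports Defs
    "HOL-Computational_Algebra.Formal_Power_Series"
    "HOL-Computational_Algebra.Polynomial"
begin

text \<open>
  Dynkin's form of the Baker-Campbell-Hausdorff formula holds in every associative algebra: if a
  derivation \<open>d\<close> satisfies \<open>[d, x] = x\<close> and \<open>[d, y] = y\<close>, then \<open>[d, log (e\<^sup>x e\<^sup>y)]\<close> can be read off from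
  \<open>ad (log (e\<^sup>x e\<^sup>y)) = log (e\<^bsup>ad x\<^esup> e\<^bsup>ad y\<^esup>)\<close>, and the general case follows by adjoining a degree derivation.
  A nilpotent Lie algebra \<open>\<gg>\<close> need not act faithfully on itself, but \<open>t \<gg>[t]\<close> acts faithfully on
  \<open>\<gg>[[t]] \<oplus> \<rat>d\<close>, where \<open>d\<close> is the degree derivation; setting \<open>t = 1\<close> transfers the group laws to \<open>\<gg>\<close>.

  By the polarization formula the forms of a polynomial are finite combinations of its values, so
  polynomials of bounded degree are closed under pointwise limits, which gives \<open>\<F>\<^sub>G \<subseteq> \<P>\<^sub>N\<close>.  For
  \<open>\<phi> \<in> \<F>\<^sub>G\<close> the functions \<open>t \<mapsto> (\<lambda>(x + t v) \<phi>)(y)\<close> are polynomials of degree at most \<open>N\<^sup>2 \<le> 2\<^bsup>N-1\<^esup> N\<close>.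
  By Lagrange interpolation all their derivatives are fixed linear combinations of translates
  \<open>\<lambda>(x + i v) \<phi>\<close>; smoothness, the unipotency of \<open>\<lambda>\<^sub>G\<close> and all properties of \<open>d\<lambda>\<^sub>G\<close> follow.
\<close>

section \<open>Additive endomorphisms and exponentials of nilpotent elements\<close>

unbundle no vec_syntax
unbundle fps_syntax

text \<open>\<open>\<lambda>\<close> can only be a representation once the group law is known to be
  associative. This, like the conjugation formula \<open>(x \<star> y) \<star> (- x)\<close> = e^(ad
  x) y, is reduced to products of exponentials in an associative ring. Endomorphisms are only
  required to be additive and only rational multiples of them occur, so one ring type serves for
  operators on an algebra, on truncated polynomials over it, and on the space on which the loops
  act. The degree N^2 arises because an element of \<open>F_G\<close> has degree at most N in its
  argument, while t \<mapsto> (-(x + t v)) * y is a curve of degree at most N. Bounded sets are not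
  compact, so uniform estimates on them come from splitting polynomials into homogeneous components
  and rescaling the argument. Hahn-Banach provides the functionals behind the constants in
  \<open>F_G\<close> and behind both injectivity statements. The bracket relation for d\<lambda>
  results from comparing the coefficients of t in \<lambda>(t x) d\<lambda>(y) \<lambda>(-t x) =
  d\<lambda>(e^(t ad x) y).\<close>

lemma rat_linear_of_additive:
  fixes s1 :: "rat \<Rightarrow> 'a::ab_group_add \<Rightarrow> 'a" and s2 :: "rat \<Rightarrow> 'b::ab_group_add \<Rightarrow> 'b"
  assumes "vector_space s1" "vector_space s2" and add: "\<And>x y. f (x + y) = f x + f y"
  shows "f (s1 q x) = s2 q (f x)"
proof -
  interpret s1: vector_space s1 by fact
  interpret s2: vector_space s2 by fact
  have f0: "f 0 = 0"
    using add[of 0 0] by simp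
  have neg: "f (- x) = - f x" for x
    using add[of x "- x"] f0 by (simp add: eq_neg_iff_add_eq_0 add.commute)
  have nat: "f (s1 (of_nat n) x) = s2 (of_nat n) (f x)" for n x
    by (induction n) (simp_all add: f0 add s1.scale_left_distrib s2.scale_left_distrib)
  have int: "f (s1 (of_int z) x) = s2 (of_int z) (f x)" for z x
  proof (cases z rule: int_cases2)
    case (nonneg n) then show ?thesis using nat[of n x] by simp
  next
    case (nonpos n) then show ?thesis using nat[of n x] by (simp add: neg)
  qed
  obtain a b where q: "q = of_int a / of_int b" and b: "b > 0"
    by (metis Fract_of_int_quotient Rat_cases)
  have "s2 (of_int b) (f (s1 q x)) = f (s1 (of_int b) (s1 q x))"
    by (rule int[symmetric])
  also have "\<dots> = s2 (of_int a) (f x)"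
    using b by (simp add: q int)
  also have "\<dots> = s2 (of_int b) (s2 q (f x))"
    using b by (simp add: q)
  \<comment> \<open>Both sides agree after multiplication by the denominator \<open>b\<close>, which
    can be cancelled.\<close>
  finally show ?thesis
    by (metis b less_irrefl of_int_0_eq_iff s2.scale_left_imp_eq)
qed

typedef (overloaded) 'a endo = "{f :: 'a::ab_group_add \<Rightarrow> 'a. \<forall>x y. f (x + y) = f x + f y}"
  morphisms app Endo
  by (rule exI[of _ id]) simp

lemma app_add: "app A (x + y) = app A x + app A y"
  using app[of A] by simp

lemma app_0 [simp]: "app A 0 = 0"
  using app_add[of A 0 0] by simp

lemma app_minus: "app A (- x) = - app A x"
  using app_add[of A x "- x"] by (simp add: eq_neg_iff_add_eq_0 add.commute)

lemma app_diff: "app A (x - y) = app A x - app A y"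
  using app_add[of A x "- y"] by (simp add: app_minus)

lemma app_sum: "app A (sum f I) = (\<Sum>i\<in>I. app A (f i))"
  by (induction I rule: infinite_finite_induct) (simp_all add: app_add)

lemma app_Endo: "(\<And>x y. f (x + y) = f x + f y) \<Longrightarrow> app (Endo f) = f"
  by (simp add: Endo_inverse)

lemma endo_eqI: "(\<And>x. app A x = app B x) \<Longrightarrow> A = B"
  by (metis app_inject ext)

text \<open>The sort stops short of \<open>ring_1\<close>, whose axiom 0 \<noteq> 1 fails for the
  endomorphisms of a trivial group.\<close>

instantiation endo :: (ab_group_add) "{ring, monoid_mult}"
begin

definition "0 = Endo (\<lambda>x. 0)"
definition "1 = Endo (\<lambda>x. x)"
definition "A + B = Endo (\<lambda>x. app A x + app B x)"
definition "A - B = Endo (\<lambda>x. app A x - app B x)"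
definition "- A = Endo (\<lambda>x. - app A x)"
definition "A * B = Endo (\<lambda>x. app A (app B x))"

lemma app_simps [simp]:
  "app 0 x = 0" "app 1 x = x" "app (A + B) x = app A x + app B x"
  "app (A - B) x = app A x - app B x" "app (- A) x = - app A x"
  "app (A * B) x = app A (app B x)"
  by (simp_all add: zero_endo_def one_endo_def plus_endo_def minus_endo_def uminus_endo_def
      times_endo_def app_Endo app_add algebra_simps)

instance
  by standard (auto intro!: endo_eqI simp: app_add app_diff algebra_simps)

end

lemma app_sum_left: "app (sum f I) x = (\<Sum>i\<in>I. app (f i) x)"
  by (induction I rule: infinite_finite_induct) simp_all

definition endo_scale :: "(rat \<Rightarrow> 'a \<Rightarrow> 'a) \<Rightarrow> rat \<Rightarrow> 'a::ab_group_add endo \<Rightarrow> 'a endo" where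
  "endo_scale s q A = Endo (\<lambda>x. s q (app A x))"

lemma app_endo_scale:
  assumes "vector_space s" shows "app (endo_scale s q A) x = s q (app A x)"
proof -
  interpret vector_space s by fact
  show ?thesis
    unfolding endo_scale_def by (subst app_Endo) (simp_all add: app_add scale_right_distrib)
qed

lemma vector_space_endo_scale:
  assumes "vector_space s" shows "vector_space (endo_scale s)"
proof -
  interpret vector_space s by fact
  show ?thesis
    by unfold_locales
      (auto intro!: endo_eqI simp: app_endo_scale[OF assms] scale_right_distrib scale_left_distrib)
qed

section \<open>Power series, exponential and logarithm at nilpotent elements\<close>

locale rat_algebra = vector_space scale
  for scale :: "rat \<Rightarrow> 'r::{ring, monoid_mult} \<Rightarrow> 'r"  (infixr \<open>*q\<close> 71)
begin

lemma scale_mult_left [simp]: "(q *q a) * b = q *q (a * b)"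
  by (rule rat_linear_of_additive[OF vector_space_axioms vector_space_axioms, where f = "\<lambda>x. x * b"])
    (simp add: distrib_right)

lemma scale_mult_right [simp]: "a * (q *q b) = q *q (a * b)"
  by (rule rat_linear_of_additive[OF vector_space_axioms vector_space_axioms])
    (simp add: distrib_left)

text \<open>Evaluation of a power series at \<open>a\<close>; the truncation loses nothing when \<open>a ^ M = 0\<close>.\<close>

definition ev :: "nat \<Rightarrow> rat fps \<Rightarrow> 'r \<Rightarrow> 'r" where
  "ev M f a = (\<Sum>k<M. f $ k *q a ^ k)"

lemma power_zero_mono: "a ^ M = 0 \<Longrightarrow> M \<le> k \<Longrightarrow> a ^ k = (0::'r)"
  by (metis le_add_diff_inverse mult_zero_left power_add)

text \<open>The product of the truncated sums runs over a square of index pairs; those with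
  \<open>i + j \<ge> M\<close> carry a vanishing power of \<open>a\<close>, and the remaining
  triangle is the Cauchy product.\<close>

lemma ev_mult:
  assumes "a ^ M = 0"
  shows "ev M (f * g) a = ev M f a * ev M g a"
proof -
  have "ev M f a * ev M g a = (\<Sum>(i, j)\<in>{..<M} \<times> {..<M}. (f $ i * g $ j) *q a ^ (i + j))"
    by (simp add: ev_def sum_product sum.cartesian_product power_add mult.commute[of "g $ _"])
  also have "\<dots> = (\<Sum>(i, j)\<in>{(i, j). i + j < M}. (f $ i * g $ j) *q a ^ (i + j))"
  proof (rule sum.mono_neutral_right)
    show "\<forall>i\<in>{..<M} \<times> {..<M} - {(i, j). i + j < M}.
        (case i of (i, j) \<Rightarrow> (f $ i * g $ j) *q a ^ (i + j)) = 0"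
      using power_zero_mono[OF assms] by (auto simp: not_less) (metis not_less)
  qed auto
  also have "\<dots> = (\<Sum>k<M. \<Sum>i\<le>k. (f $ i * g $ (k - i)) *q a ^ (i + (k - i)))"
    by (rule sum.triangle_reindex)
  also have "\<dots> = (\<Sum>k<M. \<Sum>i\<le>k. (f $ i * g $ (k - i)) *q a ^ k)"
    by (intro sum.cong) auto
  also have "\<dots> = ev M (f * g) a"
    by (simp add: ev_def fps_mult_nth scale_sum_left atMost_atLeast0)
  finally show ?thesis ..
qed

lemma ev_1 [simp]: "M > 0 \<Longrightarrow> ev M 1 a = 1"
  unfolding ev_def by (cases M) (simp_all add: sum.lessThan_Suc_shift del: sum.lessThan_Suc)

lemma ev_X: "M > 1 \<Longrightarrow> ev M fps_X a = a"
  by (auto simp: ev_def fps_X_nth if_distrib[of "\<lambda>q. q *q _"] if_distribR sum.delta cong: if_cong)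

lemma ev_diff: "ev M (f - g) a = ev M f a - ev M g a"
  by (simp add: ev_def scale_left_diff_distrib sum_subtractf)

lemma ev_power:
  assumes "a ^ M = 0" "M > 0"
  shows "ev M (f ^ k) a = ev M f a ^ k"
  by (induction k) (simp_all add: assms ev_mult)

text \<open>Since \<open>g\<close> has no constant term, \<open>g ^ i\<close> has no coefficients
  below degree \<open>i\<close>. Hence the inner index may run over all \<open>i < M\<close>, and
  the two sums can be exchanged.\<close>

lemma ev_compose:
  assumes "a ^ M = 0" "M > 0" "g $ 0 = 0"
  shows "ev M (f oo g) a = ev M f (ev M g a)"
proof -
  have "ev M (f oo g) a = (\<Sum>k<M. \<Sum>i\<in>{0..k}. (f $ i * (g ^ i) $ k) *q a ^ k)"
    by (simp add: ev_def fps_compose_nth scale_sum_left)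
  also have "\<dots> = (\<Sum>k<M. \<Sum>i<M. (f $ i * (g ^ i) $ k) *q a ^ k)"
  proof (rule sum.cong[OF refl], rule sum.mono_neutral_left, simp, force, intro ballI)
    fix k i assume "i \<in> {..<M} - {0..k}"
    then have "g ^ i $ k = 0"
      using assms(3) by (intro startsby_zero_power_prefix[rule_format]) auto
    then show "(f $ i * (g ^ i) $ k) *q a ^ k = 0" by simp
  qed
  also have "\<dots> = (\<Sum>i<M. \<Sum>k<M. f $ i *q (g ^ i) $ k *q a ^ k)"
    by (subst sum.swap) simp
  also have "\<dots> = (\<Sum>i<M. f $ i *q ev M (g ^ i) a)"
    by (simp add: ev_def scale_sum_right)
  also have "\<dots> = ev M f (ev M g a)"
    by (simp add: ev_def[of _ f] ev_power[OF assms(1,2)])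
  finally show ?thesis .
qed

definition xp :: "nat \<Rightarrow> 'r \<Rightarrow> 'r" where
  "xp M a = ev M (fps_exp 1) a"

text \<open>\<open>fps_ln 1\<close> is the series of log (1 + X), hence the argument
  \<open>a - 1\<close>.\<close>

definition lg :: "nat \<Rightarrow> 'r \<Rightarrow> 'r" where
  "lg M a = ev M (fps_ln 1) (a - 1)"

lemma xp_minus_1: "M > 0 \<Longrightarrow> ev M (fps_exp 1 - 1) a = xp M a - 1"
  by (simp add: ev_diff xp_def)

lemma lg_xp:
  assumes "a ^ M = 0" "M > 1"
  shows "lg M (xp M a) = a"
proof -
  have "fps_ln 1 oo (fps_exp 1 - 1) = (fps_X :: rat fps)"
    by (subst fps_ln_fps_exp_inv) (auto intro!: fps_inv)
  then show ?thesis
    using ev_compose[of a M "fps_exp 1 - 1" "fps_ln 1"] assms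
    by (simp add: lg_def xp_minus_1 ev_X)
qed

lemma xp_lg:
  assumes "(a - 1) ^ M = 0" "M > 1"
  shows "xp M (lg M a) = a"
proof -
  have "(fps_exp 1 - 1) oo fps_ln 1 = (fps_X :: rat fps)"
    by (subst fps_ln_fps_exp_inv) (auto intro!: fps_inv_right)
  then have "xp M (lg M a) - 1 = a - 1"
    using ev_compose[of "a - 1" M "fps_ln 1" "fps_exp 1 - 1"] assms
    by (simp add: lg_def xp_minus_1 ev_X)
  then show ?thesis by simp
qed

text \<open>Divided powers turn the binomial theorem into a plain convolution.\<close>

definition dp :: "'r \<Rightarrow> nat \<Rightarrow> 'r" where
  "dp a k = (1 / fact k) *q a ^ k"

lemma xp_dp: "xp M a = (\<Sum>k<M. dp a k)"
  by (simp add: xp_def ev_def dp_def)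

lemma dp_Suc: "a * dp a n = of_nat (Suc n) *q dp a (Suc n)"
  by (simp add: dp_def divide_simps)

text \<open>Induction on \<open>n\<close>: multiplying the sum for \<open>n\<close> by
  \<open>a + b\<close> raises one of the two indices, with factor \<open>i\<close> or
  \<open>Suc n - i\<close>, and these factors add up to \<open>Suc n\<close>.\<close>

lemma dp_add:
  assumes comm: "a * b = b * a"
  shows "dp (a + b) n = (\<Sum>i\<le>n. dp a i * dp b (n - i))"
proof (induction n)
  case 0
  show ?case by (simp add: dp_def)
next
  case (Suc n)
  have cb: "b * (dp a i * c) = dp a i * (b * c)" for i c
    using power_commuting_commutes[OF comm, of i] by (simp add: dp_def mult.assoc[symmetric])
  have "of_nat (Suc n) *q dp (a + b) (Suc n) = (a + b) * (\<Sum>i\<le>n. dp a i * dp b (n - i))"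
    by (metis Suc.IH dp_Suc)
  also have "\<dots> = (\<Sum>i\<le>n. (a * dp a i) * dp b (n - i)) + (\<Sum>i\<le>n. dp a i * (b * dp b (n - i)))"
    by (simp add: distrib_right sum_distrib_left cb mult.assoc sum.distrib)
  also have "(\<Sum>i\<le>n. (a * dp a i) * dp b (n - i)) = (\<Sum>i\<le>n. of_nat (Suc i) *q (dp a (Suc i) * dp b (Suc n - Suc i)))"
    by (simp only: dp_Suc scale_mult_left diff_Suc_Suc)
  also have "\<dots> = (\<Sum>i\<le>Suc n. of_nat i *q (dp a i * dp b (Suc n - i)))"
    by (subst sum.atMost_Suc_shift) simp
  also have "(\<Sum>i\<le>n. dp a i * (b * dp b (n - i))) = (\<Sum>i\<le>n. of_nat (Suc n - i) *q (dp a i * dp b (Suc n - i)))"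
    by (intro sum.cong refl) (simp only: dp_Suc scale_mult_right Suc_diff_le atMost_iff)
  also have "\<dots> = (\<Sum>i\<le>Suc n. of_nat (Suc n - i) *q (dp a i * dp b (Suc n - i)))"
    by simp
  also have "(\<Sum>i\<le>Suc n. of_nat i *q (dp a i * dp b (Suc n - i))) + \<dots> =
      (\<Sum>i\<le>Suc n. of_nat (Suc n) *q (dp a i * dp b (Suc n - i)))"
    unfolding sum.distrib[symmetric] scale_left_distrib[symmetric] of_nat_add[symmetric]
    by (intro sum.cong) auto
  finally show ?case
    by (simp add: scale_sum_right[symmetric] del: of_nat_Suc sum.atMost_Suc)
qed

lemma dp_zero: "a ^ M = 0 \<Longrightarrow> M \<le> k \<Longrightarrow> dp a k = 0"
  by (simp add: dp_def power_zero_mono)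

text \<open>The truncation order doubles: if \<open>i + j \<ge> 2 * M\<close>, then one of the two
  exponents is at least \<open>M\<close>, so the term vanishes.\<close>

lemma xp_add:
  assumes comm: "a * b = b * a" and "a ^ M = 0" "b ^ M = 0"
  shows "xp (2 * M) (a + b) = xp M a * xp M b" and "(a + b) ^ (2 * M) = 0"
proof -
  have z: "dp a i * dp b j = 0" if "i + j \<ge> 2 * M" for i j
  proof (cases "M \<le> i")
    case False
    then have "M \<le> j" using that by simp
    then show ?thesis by (simp add: dp_zero[OF assms(3)])
  qed (simp add: dp_zero[OF assms(2)])
  have "xp (2 * M) (a + b) = (\<Sum>k<2 * M. \<Sum>i\<le>k. dp a i * dp b (k - i))"
    unfolding xp_dp dp_add[OF comm] ..
  also have "\<dots> = (\<Sum>(i, j)\<in>{(i, j). i + j < 2 * M}. dp a i * dp b j)"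
    by (simp only: sum.triangle_reindex)
  also have "\<dots> = (\<Sum>(i, j)\<in>{..<M} \<times> {..<M}. dp a i * dp b j)"
  proof (rule sum.mono_neutral_right)
    show "finite {(i, j). i + j < 2 * M}"
      by (rule finite_subset[of _ "{..<2*M} \<times> {..<2*M}"]) (simp_all, fastforce)
    have zz: "dp a i * dp b j = 0" if "M \<le> i \<or> M \<le> j" for i j
      using that by (elim disjE) (simp_all add: dp_zero[OF assms(2)] dp_zero[OF assms(3)])
    show "\<forall>i\<in>{(i, j). i + j < 2 * M} - {..<M} \<times> {..<M}. (case i of (i, j) \<Rightarrow> dp a i * dp b j) = 0"
      by (auto intro!: zz simp: not_less)
  qed (auto simp: mult_2)
  also have "\<dots> = xp M a * xp M b"
    unfolding xp_dp sum_product sum.cartesian_product ..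
  finally show "xp (2 * M) (a + b) = xp M a * xp M b" .
  have "dp (a + b) (2 * M) = 0"
    unfolding dp_add[OF comm] by (intro sum.neutral ballI z) simp
  then show "(a + b) ^ (2 * M) = 0"
    unfolding dp_def scale_eq_0_iff by simp
qed

lemma xp_0: "M > 0 \<Longrightarrow> xp M 0 = 1"
  by (cases M) (simp_all add: xp_dp dp_def sum.lessThan_Suc_shift del: sum.lessThan_Suc)

lemma power_minus_zero:
  assumes "a ^ M = 0" shows "(- a) ^ M = (0::'r)"
proof -
  have "(- a) ^ M = a ^ M \<or> (- a) ^ M = - (a ^ M)" for M
    by (induction M) auto
  from this[of M] assms show ?thesis by auto
qed

lemma xp_inverse:
  assumes "a ^ M = 0" "M > 0"
  shows "xp M a * xp M (- a) = 1"
proof -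
  have "xp (2 * M) (a + - a) = xp M a * xp M (- a)"
    by (rule xp_add(1)) (simp_all add: assms power_minus_zero)
  also have "a + - a = 0" by simp
  finally show ?thesis
    using assms(2) xp_0[of "2 * M"] by simp
qed

end

section \<open>Dynkin's formula in associative algebras\<close>

text \<open>The coefficient of a word in the associative expansion of log (e^x e^y); Dynkin's
  coefficient has the additional denominator \<open>dynkin_degree p\<close>.\<close>

definition dynkin_weight :: "(nat \<times> nat) list \<Rightarrow> rat" where
  "dynkin_weight p = (- 1) ^ (length p - 1) / (of_nat (length p) * (\<Prod>(r, s)\<leftarrow>p. fact r * fact s))"

lemma dynkin_coeff_weight: "(dynkin_coeff p :: rat) = dynkin_weight p / of_nat (dynkin_degree p)"
  by (simp add: dynkin_coeff_def dynkin_weight_def field_simps)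

lemma length_dynkin_word: "length (dynkin_word x y p) = dynkin_degree p"
  by (induction p) (auto simp: dynkin_word_def dynkin_degree_def)

lemma set_dynkin_word: "set (dynkin_word x y p) \<subseteq> {x, y}"
proof (induction p)
  case (Cons rs p)
  obtain r s where rs: "rs = (r, s)" by (cases rs)
  have "dynkin_word x y (rs # p) = replicate r x @ replicate s y @ dynkin_word x y p"
    by (simp add: dynkin_word_def rs)
  moreover have "set (replicate r x) \<subseteq> {x, y}" "set (replicate s y) \<subseteq> {x, y}"
    unfolding subset_iff in_set_replicate by blast+
  ultimately show ?case
    using Cons.IH by simp
qed (simp add: dynkin_word_def)

lemma map_dynkin_word: "map f (dynkin_word x y p) = dynkin_word (f x) (f y) p"
  by (induction p) (auto simp: dynkin_word_def)

lemma dynkin_index_bounds: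
  assumes "p \<in> dynkin_index n"
  shows "p \<noteq> []" "length p \<le> n" "set p \<subseteq> {..n} \<times> {..n} - {(0, 0)}"
    "0 < dynkin_degree p" "dynkin_degree p \<le> n"
proof -
  have len: "length p \<le> dynkin_degree p" if "\<forall>(r, s)\<in>set p. r + s > 0" for p
    using that by (induction p) (auto simp: dynkin_degree_def)
  have mem: "r + s \<le> dynkin_degree p" if "(r, s) \<in> set p" for r s p
    using that by (induction p) (auto simp: dynkin_degree_def)
  show "p \<noteq> []" "dynkin_degree p \<le> n" "length p \<le> n"
    using assms len[of p] by (auto simp: dynkin_index_def)
  show "0 < dynkin_degree p"
    using assms len[of p] by (cases p) (auto simp: dynkin_index_def)
  show "set p \<subseteq> {..n} \<times> {..n} - {(0, 0)}"
    using assms mem[of _ _ p] by (fastforce simp: dynkin_index_def)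
qed

definition commutator :: "'r::ring \<Rightarrow> 'r \<Rightarrow> 'r" where
  "commutator a b = a * b - b * a"

section \<open>Filtration by word length and the associative expansion of log (e^a e^b)\<close>

context rat_algebra
begin

text \<open>The \<open>k\<close>-th power of the augmentation ideal of the subalgebra generated by
  \<open>S\<close>. It allows nilpotency to be proved by counting letters.\<close>

definition fil :: "'r set \<Rightarrow> nat \<Rightarrow> 'r set" where
  "fil S k = span {prod_list xs | xs. set xs \<subseteq> S \<and> k \<le> length xs}"

lemma fil_closed:
  "0 \<in> fil S k" "a \<in> fil S k \<Longrightarrow> b \<in> fil S k \<Longrightarrow> a + b \<in> fil S k"
  "a \<in> fil S k \<Longrightarrow> b \<in> fil S k \<Longrightarrow> a - b \<in> fil S k"
  "a \<in> fil S k \<Longrightarrow> q *q a \<in> fil S k" "(\<And>i. i \<in> I \<Longrightarrow> f i \<in> fil S k) \<Longrightarrow> sum f I \<in> fil S k"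
  "a \<in> fil S k \<Longrightarrow> - a \<in> fil S k"
  by (simp_all add: fil_def span_zero span_add span_diff span_scale span_sum span_neg)

lemma fil_prod: "set xs \<subseteq> S \<Longrightarrow> k \<le> length xs \<Longrightarrow> prod_list xs \<in> fil S k"
  unfolding fil_def by (rule span_base) blast

lemma fil_base: "x \<in> S \<Longrightarrow> x \<in> fil S 1"
  using fil_prod[of "[x]" S 1] by simp

lemma fil_one: "1 \<in> fil S 0"
  using fil_prod[of "[]" S 0] by simp

lemma fil_antimono: "j \<le> k \<Longrightarrow> fil S k \<subseteq> fil S j"
  unfolding fil_def by (rule span_mono) force

lemma fil_mult:
  assumes "a \<in> fil S i" "b \<in> fil S j"
  shows "a * b \<in> fil S (i + j)"
  using assms(1) unfolding fil_def[of S i]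
proof (induction rule: span_induct_alt)
  case base then show ?case by (simp add: fil_closed)
next
  case (step c x y)
  from step(1) obtain xs where xs: "x = prod_list xs" "set xs \<subseteq> S" "i \<le> length xs" by blast
  have "x * b \<in> fil S (i + j)"
    using assms(2) unfolding fil_def[of S j]
  proof (induction rule: span_induct_alt)
    case base then show ?case by (simp add: fil_closed)
  next
    case (step c x' y)
    from step(1) obtain ys where ys: "x' = prod_list ys" "set ys \<subseteq> S" "j \<le> length ys" by blast
    have "x * x' \<in> fil S (i + j)"
      using fil_prod[of "xs @ ys" S "i + j"] xs ys by simp
    with step show ?case by (simp add: distrib_left fil_closed)
  qed
  with step show ?case by (simp add: distrib_right fil_closed)
qed

lemma fil_power: "a \<in> fil S 1 \<Longrightarrow> a ^ k \<in> fil S k"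
  using fil_one fil_mult[of a S 1] by (induction k) auto

text \<open>A word with at least \<open>n\<close> letters has an initial segment of exactly
  \<open>n\<close> letters, which already vanishes.\<close>

lemma fil_zero:
  assumes "\<And>xs. set xs \<subseteq> S \<Longrightarrow> length xs = n \<Longrightarrow> prod_list xs = 0" "a \<in> fil S n"
  shows "a = 0"
proof -
  have "x = 0" if "x \<in> {prod_list xs | xs. set xs \<subseteq> S \<and> n \<le> length xs}" for x
  proof -
    from that obtain xs where xs: "x = prod_list xs" "set xs \<subseteq> S" "n \<le> length xs" by blast
    then have "prod_list (take n xs) = 0"
      using set_take_subset[of n xs] by (intro assms(1)) auto
    then show ?thesis
      using xs(1) by (metis append_take_drop_id mult_zero_left prod_list.append)
  qed
  then have "{prod_list xs | xs. set xs \<subseteq> S \<and> n \<le> length xs} \<subseteq> {0}" by blast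
  then have "fil S n \<subseteq> span {0}" unfolding fil_def by (rule span_mono)
  with assms(2) show ?thesis by auto
qed

lemma fil_0_power: "a \<in> fil S 0 \<Longrightarrow> a ^ k \<in> fil S 0"
  using fil_one fil_mult[of a S 0 _ 0] by (induction k) auto

lemma fil_1_0: "a \<in> fil S 1 \<Longrightarrow> a \<in> fil S 0"
  using fil_antimono[of 0 1 S] by auto

lemma ev_fil_0: "a \<in> fil S 0 \<Longrightarrow> ev M f a \<in> fil S 0"
  unfolding ev_def by (intro fil_closed fil_0_power)

lemma ev_fil_1:
  assumes "f $ 0 = 0" "a \<in> fil S 1" shows "ev M f a \<in> fil S 1"
  unfolding ev_def
proof (rule fil_closed(5))
  fix k
  show "(f $ k) *q a ^ k \<in> fil S 1"
  proof (cases k)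
    case (Suc j)
    then have "a ^ k \<in> fil S 1"
      using fil_power[OF assms(2), of k] fil_antimono[of 1 k S] by auto
    then show ?thesis by (rule fil_closed)
  qed (simp add: assms fil_closed)
qed

lemma xp_fil_0: "a \<in> fil S 1 \<Longrightarrow> xp M a \<in> fil S 0"
  unfolding xp_def by (intro ev_fil_0 fil_1_0)

lemma xp_fil_1: "a \<in> fil S 1 \<Longrightarrow> M > 0 \<Longrightarrow> xp M a - 1 \<in> fil S 1"
  unfolding xp_minus_1[symmetric] by (rule ev_fil_1) auto

lemma xp_mult_fil_1:
  assumes "a \<in> fil S 1" "b \<in> fil S 1" "M > 0"
  shows "xp M a * xp M b - 1 \<in> fil S 1"
proof -
  have "xp M a * xp M b - 1 = (xp M a - 1) * xp M b + (xp M b - 1)"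
    by (simp add: algebra_simps)
  also have "\<dots> \<in> fil S 1"
    using fil_mult[OF xp_fil_1[OF assms(1,3)] xp_fil_0[OF assms(2)], of M] xp_fil_1[OF assms(2,3)]
    by (intro fil_closed(2)) auto
  finally show ?thesis .
qed

lemma lg_fil_1: "a - 1 \<in> fil S 1 \<Longrightarrow> lg M a \<in> fil S 1"
  unfolding lg_def by (rule ev_fil_1) auto

definition word :: "'r \<Rightarrow> 'r \<Rightarrow> (nat \<times> nat) list \<Rightarrow> 'r" where
  "word a b p = prod_list (dynkin_word a b p)"

lemma word_simps [simp]: "word a b [] = 1" "word a b ((r, s) # p) = a ^ r * b ^ s * word a b p"
  by (simp_all add: word_def dynkin_word_def mult.assoc)

text \<open>Nothing commutes here, so the \<open>k\<close>-th power is indexed by lists of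
  \<open>k\<close> pairs in their order.\<close>

lemma power_sum_expand:
  assumes "finite J"
  shows "(\<Sum>(r, s)\<in>J. (1 / (fact r * fact s)) *q (a ^ r * b ^ s)) ^ k =
    (\<Sum>p\<in>{p. set p \<subseteq> J \<and> length p = k}. (1 / (\<Prod>(r, s)\<leftarrow>p. fact r * fact s)) *q word a b p)"
proof (induction k)
  case 0
  have "{p. set p \<subseteq> J \<and> length p = 0} = {[]}" by auto
  then show ?case by simp
next
  case (Suc k)
  let ?L = "\<lambda>k. {p. set p \<subseteq> J \<and> length p = k}"
  have bij: "bij_betw (\<lambda>(x, p). x # p) (J \<times> ?L k) (?L (Suc k))"
    by (rule bij_betwI[where g = "\<lambda>p. (hd p, tl p)"]) (auto simp: length_Suc_conv)
  show ?case
    by (simp add: Suc.IH sum_product sum.cartesian_product sum.reindex_bij_betw[OF bij, symmetric])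
      (rule sum.cong, auto simp: mult.assoc mult.commute)
qed

text \<open>The powers of e^a e^b - 1 are expanded into words. Long words only have to vanish after
  application of the additive map \<open>G\<close>; this matters when \<open>a\<close> and
  \<open>b\<close> are adjoint operators and \<open>G\<close> is evaluation at one vector.\<close>

lemma log_expand:
  fixes G :: "'r \<Rightarrow> 'v::ab_group_add"
  assumes s: "vector_space s" and G: "\<And>x y. G (x + y) = G x + G y"
    and M: "n < M" and zero: "\<And>p. n < dynkin_degree p \<Longrightarrow> G (word a b p) = 0"
  shows "G (lg M (xp M a * xp M b)) = (\<Sum>p\<in>dynkin_index n. s (dynkin_weight p) (G (word a b p)))"
proof -
  interpret s: vector_space s by fact
  define J where "J = {..<M} \<times> {..<M} - {(0::nat, 0::nat)}"
  define c where "c p = (\<Prod>(r, s)\<leftarrow>p. fact r * fact s :: rat)" for p :: "(nat \<times> nat) list"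
  define L where "L k = {p. set p \<subseteq> J \<and> length p = k}" for k
  have J: "finite J" by (simp add: J_def)
  have L: "finite (L k)" for k
    using finite_lists_length_eq[OF J, of k] by (simp add: L_def)
  have G0: "G 0 = 0" using G[of 0 0] by simp
  have Gs: "G (sum f I) = (\<Sum>i\<in>I. G (f i))" for f and I :: "'z set"
    by (induction I rule: infinite_finite_induct) (simp_all add: G G0)
  have Gq: "G (q *q x) = s q (G x)" for q x
    by (rule rat_linear_of_additive[OF vector_space_axioms s G])
  have "xp M a * xp M b = (\<Sum>(r, s)\<in>{..<M} \<times> {..<M}. (1 / (fact r * fact s)) *q (a ^ r * b ^ s))"
    by (simp add: xp_dp sum_product sum.cartesian_product dp_def mult.commute)
  also have "\<dots> = 1 + (\<Sum>(r, s)\<in>J. (1 / (fact r * fact s)) *q (a ^ r * b ^ s))"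
    \<comment> \<open>The pair \<open>(0, 0)\<close> contributes the constant term 1; all pairs in
      \<open>J\<close> have positive degree, as in \<open>dynkin_index\<close>.\<close>
    using M unfolding J_def by (subst sum.remove[of _ "(0, 0)"]) auto
  finally have "xp M a * xp M b - 1 = (\<Sum>(r, s)\<in>J. (1 / (fact r * fact s)) *q (a ^ r * b ^ s))"
    by simp
  then have "(xp M a * xp M b - 1) ^ k = (\<Sum>p\<in>L k. (1 / c p) *q word a b p)" for k
    by (simp add: power_sum_expand[OF J] L_def c_def)
  then have "lg M (xp M a * xp M b) = (\<Sum>k<M. \<Sum>p\<in>L k. (fps_ln 1 $ k / c p) *q word a b p)"
    by (simp add: lg_def ev_def scale_sum_right)
  also have "\<dots> = (\<Sum>k<M. \<Sum>p\<in>L k. (fps_ln 1 $ length p / c p) *q word a b p)"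
    by (intro sum.cong) (auto simp: L_def)
  also have "\<dots> = (\<Sum>p\<in>(\<Union>k<M. L k). (fps_ln 1 $ length p / c p) *q word a b p)"
    using L by (subst sum.UNION_disjoint) (auto simp: L_def)
  finally have "G (lg M (xp M a * xp M b)) =
      (\<Sum>p\<in>(\<Union>k<M. L k). s (fps_ln 1 $ length p / c p) (G (word a b p)))"
    by (simp add: Gs Gq)
  also have "\<dots> = (\<Sum>p\<in>dynkin_index n. s (fps_ln 1 $ length p / c p) (G (word a b p)))"
  proof (rule sum.mono_neutral_right)
    show "finite (\<Union>k<M. L k)" using L by auto
    show "dynkin_index n \<subseteq> (\<Union>k<M. L k)"
    proof
      fix p assume p: "p \<in> dynkin_index n"
      have "set p \<subseteq> J"
        using dynkin_index_bounds(3)[OF p] M by (force simp: J_def)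
      with dynkin_index_bounds(2)[OF p] M show "p \<in> (\<Union>k<M. L k)" by (auto simp: L_def)
    qed
    show "\<forall>p\<in>(\<Union>k<M. L k) - dynkin_index n. s (fps_ln 1 $ length p / c p) (G (word a b p)) = 0"
    proof
      fix p assume p: "p \<in> (\<Union>k<M. L k) - dynkin_index n"
      \<comment> \<open>The empty list drops out because \<open>fps_ln 1 $ 0 = 0\<close>, the long
        words because of the assumption on \<open>G\<close>.\<close>
      then have "p = [] \<or> n < dynkin_degree p"
        by (fastforce simp: L_def J_def dynkin_index_def)
      then show "s (fps_ln 1 $ length p / c p) (G (word a b p)) = 0"
        using zero[of p] by auto
    qed
  qed
  also have "\<dots> = (\<Sum>p\<in>dynkin_index n. s (dynkin_weight p) (G (word a b p)))"
    using dynkin_index_bounds(1)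
    by (intro sum.cong refl) (auto simp: fps_ln_nth dynkin_weight_def c_def)
  finally show ?thesis .
qed

definition lmul :: "'r \<Rightarrow> 'r endo" where "lmul c = Endo (\<lambda>x. c * x)"
definition rmul :: "'r \<Rightarrow> 'r endo" where "rmul c = Endo (\<lambda>x. x * c)"

lemma app_lmul [simp]: "app (lmul c) x = c * x"
  unfolding lmul_def by (subst app_Endo) (simp_all add: distrib_left)

lemma app_rmul [simp]: "app (rmul c) x = x * c"
  unfolding rmul_def by (subst app_Endo) (simp_all add: distrib_right)

definition ad :: "'r \<Rightarrow> 'r endo" where "ad c = lmul c - rmul c"

lemma app_ad: "app (ad c) x = commutator c x"
  by (simp add: ad_def commutator_def)

lemma lmul_power: "lmul c ^ k = lmul (c ^ k)" and rmul_power: "rmul c ^ k = rmul (c ^ k)"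
  by (induction k) (auto intro!: endo_eqI simp: mult.assoc power_commutes)

end

lemma (in rat_algebra) rat_algebra_endo: "rat_algebra (endo_scale scale)"
  by (simp add: rat_algebra_def vector_space_endo_scale vector_space_axioms)

context rat_algebra
begin

interpretation E: rat_algebra "endo_scale scale"
  by (rule rat_algebra_endo)

lemma E_ev_lmul: "E.ev M f (lmul c) = lmul (ev M f c)"
  by (rule endo_eqI)
    (simp add: E.ev_def ev_def lmul_power app_sum_left app_endo_scale vector_space_axioms sum_distrib_right)

lemma E_ev_rmul: "E.ev M f (rmul c) = rmul (ev M f c)"
  by (rule endo_eqI)
    (simp add: E.ev_def ev_def rmul_power app_sum_left app_endo_scale vector_space_axioms sum_distrib_left)

text \<open>\<open>ad c\<close> is the sum of the commuting operators \<open>lmul c\<close> and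
  \<open>rmul (- c)\<close>, so \<open>xp_add\<close> applies to it, with its doubled truncation
  order.\<close>

lemma xp_ad:
  assumes "c ^ M = 0"
  shows "E.xp (2 * M) (ad c) = lmul (xp M c) * rmul (xp M (- c))" "ad c ^ (2 * M) = 0"
proof -
  have ad: "ad c = lmul c + rmul (- c)"
    by (rule endo_eqI) (simp add: ad_def)
  have comm: "lmul c * rmul (- c) = rmul (- c) * lmul c"
    by (rule endo_eqI) (simp add: mult.assoc)
  have l: "lmul c ^ M = 0"
    by (rule endo_eqI) (simp add: lmul_power assms)
  have r: "rmul (- c) ^ M = 0"
    by (rule endo_eqI) (simp add: rmul_power power_minus_zero[OF assms])
  show "E.xp (2 * M) (ad c) = lmul (xp M c) * rmul (xp M (- c))"
    unfolding ad E.xp_add(1)[OF comm l r] by (simp add: E.xp_def xp_def E_ev_lmul E_ev_rmul)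
  show "ad c ^ (2 * M) = 0"
    unfolding ad by (rule E.xp_add(2)[OF comm l r])
qed

lemma xp_conj:
  assumes "c ^ M = 0"
  shows "xp M c * b * xp M (- c) = (\<Sum>k<2 * M. (1 / fact k) *q (commutator c ^^ k) b)"
proof -
  have pow: "app (ad c ^ k) b = (commutator c ^^ k) b" for k
    by (induction k) (simp_all add: app_ad)
  have "xp M c * b * xp M (- c) = app (E.xp (2 * M) (ad c)) b"
    by (simp add: xp_ad[OF assms] mult.assoc)
  also have "\<dots> = (\<Sum>k<2 * M. (1 / fact k) *q (commutator c ^^ k) b)"
    by (simp add: E.xp_dp E.dp_def app_sum_left app_endo_scale vector_space_axioms pow)
  finally show ?thesis .
qed

end

text \<open>Expanding the commutators of a word only permutes its letters, so the number of letters
  is kept.\<close>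

lemma (in rat_algebra) nested_commutator_fil:
  assumes "set w \<subseteq> S" shows "nested_bracket commutator w \<in> fil S (length w)"
  using assms
proof (induction w rule: induct_list012)
  case (2 x) then show ?case using fil_base by simp
next
  case (3 x y w)
  then have x: "x \<in> fil S 1" and n: "nested_bracket commutator (y # w) \<in> fil S (length (y # w))"
    using fil_base by auto
  show ?case
    using fil_closed(3)[OF fil_mult[OF x n]] fil_mult[OF n x] by (simp add: commutator_def[of x])
qed (simp add: fil_closed)

context rat_algebra
begin

interpretation E: rat_algebra "endo_scale scale"
  by (rule rat_algebra_endo)

lemma E_word: "E.word (ad x) (ad y) p = prod_list (map ad (dynkin_word x y p))"
  by (simp add: E.word_def map_dynkin_word)

text \<open>Leibniz rule: each letter is an eigenvector of [d, -] with eigenvalue 1, so a product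
  has its number of letters as eigenvalue.\<close>

lemma derivation_prod_list:
  assumes "\<And>x. x \<in> set w \<Longrightarrow> d * x - x * d = x"
  shows "d * prod_list w - prod_list w * d = of_nat (length w) *q prod_list w"
  using assms
proof (induction w)
  case (Cons x w)
  have "d * (x * prod_list w) - x * prod_list w * d =
      (d * x - x * d) * prod_list w + x * (d * prod_list w - prod_list w * d)"
    by (simp add: algebra_simps)
  with Cons show ?case by (simp add: scale_left_distrib)
qed simp

text \<open>The innermost bracket is [x, d] = -x for the last letter x; the other letters then build
  the right-nested commutator around it.\<close>

lemma ad_prod_list_derivation:
  assumes "\<And>x. x \<in> set w \<Longrightarrow> d * x - x * d = x" "w \<noteq> []"
  shows "app (prod_list (map ad w)) d = - nested_bracket commutator w"
  using assms
proof (induction w rule: induct_list012)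
  case (2 x)
  then have "d * x - x * d = x" by simp
  then show ?case by (simp add: app_ad commutator_def algebra_simps)
next
  case (3 x y w)
  then have "app (prod_list (map ad (y # w))) d = - nested_bracket commutator (y # w)" by auto
  then show ?case by (simp add: app_ad commutator_def[of x] commutator_def[of y])
qed simp

text \<open>Both sides compute \<open>[d, log (e\<^sup>x e\<^sup>y)]\<close>, the right-hand side by means of
  \<open>ad (log (e\<^sup>x e\<^sup>y)) = log (e\<^bsup>ad x\<^esup> e\<^bsup>ad y\<^esup>)\<close>.\<close>

lemma dynkin_of_derivation:
  assumes dx: "d * x - x * d = x" and dy: "d * y - y * d = y"
    and nil: "\<And>w. set w \<subseteq> {x, y} \<Longrightarrow> length w = Suc n \<Longrightarrow> prod_list w = 0"
  shows "(\<Sum>p\<in>dynkin_index n. (dynkin_weight p * of_nat (dynkin_degree p)) *q word x y p) =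
    (\<Sum>p\<in>dynkin_index n. dynkin_weight p *q nested_bracket commutator (dynkin_word x y p))"
proof -
  define S where "S = {x, y}"
  define M where "M = n + 2"
  have M: "M > 0" "M > 1" "n < M" "n < 2 * M" "Suc n \<le> M" by (auto simp: M_def)
  have fil0: "a = 0" if "a \<in> fil S (Suc n)" for a
    by (rule fil_zero[OF _ that]) (use nil in \<open>auto simp: S_def\<close>)
  have filM: "a ^ M = 0" if "a \<in> fil S 1" for a
    using fil0 fil_power[OF that, of M] fil_antimono[OF M(5), of S] by blast
  have xS: "x \<in> fil S 1" and yS: "y \<in> fil S 1"
    using fil_base[of _ S] by (auto simp: S_def)
  define z where "z = lg M (xp M x * xp M y)"
  have u: "xp M x * xp M y - 1 \<in> fil S 1"
    by (rule xp_mult_fil_1[OF xS yS M(1)])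
  have zS: "z \<in> fil S 1"
    unfolding z_def by (rule lg_fil_1[OF u])
  have xpz: "xp M z = xp M x * xp M y"
    unfolding z_def by (rule xp_lg[OF filM[OF u] M(2)])
  have inv: "xp M c * xp M (- c) = 1" "xp M (- c) * xp M c = 1" if "c \<in> fil S 1" for c
    using xp_inverse[OF filM[OF that] M(1)] xp_inverse[OF filM[OF fil_closed(6)[OF that]] M(1)] by auto
  \<comment> \<open>The inserted factor is 1; afterwards e^x e^y = e^z cancels against
    e^(-z).\<close>
  have "xp M (- z) = (xp M (- y) * xp M (- x)) * (xp M x * xp M y) * xp M (- z)"
    using inv[OF xS] inv[OF yS] by (simp add: mult.assoc) (metis mult.assoc mult_1_left)
  also have "\<dots> = xp M (- y) * xp M (- x)"
    using inv(1)[OF zS] xpz by (simp add: mult.assoc)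
  finally have xpmz: "xp M (- z) = xp M (- y) * xp M (- x)" .
  have w0: "nested_bracket commutator w = 0" if "set w \<subseteq> {x, y}" "n < length w" for w
    using nested_commutator_fil[of w S] that fil_antimono[of "Suc n" "length w" S] fil0
    by (auto simp: S_def)
  have word0: "word x y p = 0" if "n < dynkin_degree p" for p
    using fil_prod[of "dynkin_word x y p" S "Suc n"] that set_dynkin_word[of x y p] fil0
    by (auto simp: S_def word_def length_dynkin_word)
  \<comment> \<open>Left multiplications compose in the given order and right multiplications in the
    opposite one, which matches the reversed product for e^(-z).\<close>
  have "E.xp (2 * M) (ad x) * E.xp (2 * M) (ad y) = E.xp (2 * M) (ad z)"
    unfolding xp_ad(1)[OF filM[OF xS]] xp_ad(1)[OF filM[OF yS]] xp_ad(1)[OF filM[OF zS]] xpz xpmz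
    by (rule endo_eqI) (simp add: mult.assoc)
  then have "ad z = E.lg (2 * M) (E.xp (2 * M) (ad x) * E.xp (2 * M) (ad y))"
    using E.lg_xp[OF xp_ad(2)[OF filM[OF zS]]] M by simp
  then have "app (ad z) d = app (E.lg (2 * M) (E.xp (2 * M) (ad x) * E.xp (2 * M) (ad y))) d"
    by simp
  also have "\<dots> = (\<Sum>p\<in>dynkin_index n. dynkin_weight p *q app (E.word (ad x) (ad y) p) d)"
  \<comment> \<open>A word of degree above \<open>n\<close> in \<open>ad x\<close>,
    \<open>ad y\<close> need not vanish as an operator, but it vanishes at \<open>d\<close>, where
    it yields a nested commutator with too many letters.\<close>
  proof (rule E.log_expand[OF vector_space_axioms _ M(4)])
    fix p assume p: "n < dynkin_degree p"
    then have ne: "dynkin_word x y p \<noteq> []" using length_dynkin_word[of x y p] by auto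
    show "app (E.word (ad x) (ad y) p) d = 0"
      unfolding E_word using set_dynkin_word[of x y p] dx dy w0[of "dynkin_word x y p"] p
      by (subst ad_prod_list_derivation[OF _ ne]) (auto simp: length_dynkin_word)
  qed simp
  also have "\<dots> = (\<Sum>p\<in>dynkin_index n. dynkin_weight p *q - nested_bracket commutator (dynkin_word x y p))"
  proof (intro sum.cong refl)
    fix p assume p: "p \<in> dynkin_index n"
    then have ne: "dynkin_word x y p \<noteq> []"
      using dynkin_index_bounds(4)[OF p] length_dynkin_word[of x y p] by auto
    show "dynkin_weight p *q app (E.word (ad x) (ad y) p) d =
        dynkin_weight p *q - nested_bracket commutator (dynkin_word x y p)"
      unfolding E_word using set_dynkin_word[of x y p] dx dy
      by (subst ad_prod_list_derivation[OF _ ne]) auto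
  qed
  finally have 1: "commutator z d = - (\<Sum>p\<in>dynkin_index n. dynkin_weight p *q nested_bracket commutator (dynkin_word x y p))"
    by (simp add: app_ad sum_negf)
  have z: "z = (\<Sum>p\<in>dynkin_index n. dynkin_weight p *q word x y p)"
    unfolding z_def using log_expand[OF vector_space_axioms, of "\<lambda>x. x" n M x y] word0 M by simp
  \<comment> \<open>Now [d, z] is computed from the expansion of z itself, on which [d, -]
    multiplies each word by its degree.\<close>
  have "- commutator z d = d * z - z * d"
    by (simp add: commutator_def)
  also have "\<dots> = (\<Sum>p\<in>dynkin_index n. dynkin_weight p *q (d * word x y p - word x y p * d))"
    unfolding z by (simp add: sum_distrib_left sum_distrib_right sum_subtractf scale_right_diff_distrib)
  also have "\<dots> = (\<Sum>p\<in>dynkin_index n. (dynkin_weight p * of_nat (dynkin_degree p)) *q word x y p)"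
  proof (intro sum.cong refl)
    fix p assume p: "p \<in> dynkin_index n"
    have "d * word x y p - word x y p * d = of_nat (dynkin_degree p) *q word x y p"
      unfolding word_def length_dynkin_word[of x y p, symmetric]
      using set_dynkin_word[of x y p] dx dy by (intro derivation_prod_list) auto
    then show "dynkin_weight p *q (d * word x y p - word x y p * d) =
        (dynkin_weight p * of_nat (dynkin_degree p)) *q word x y p" by simp
  qed
  finally show ?thesis using 1 by simp
qed

end

lemma sum_fun_apply: "sum f I x = (\<Sum>i\<in>I. f i x)"
  for f :: "'i \<Rightarrow> 'a \<Rightarrow> 'b::comm_monoid_add"
  by (induction I rule: infinite_finite_induct) simp_all

definition pointwise_scale :: "(rat \<Rightarrow> 'a \<Rightarrow> 'a) \<Rightarrow> rat \<Rightarrow> (nat \<Rightarrow> 'a) \<Rightarrow> nat \<Rightarrow> 'a" where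
  "pointwise_scale s q f = (\<lambda>i. s q (f i))"

lemma vector_space_pointwise_scale:
  assumes "vector_space s" shows "vector_space (pointwise_scale s)"
proof -
  interpret vector_space s by fact
  show ?thesis
    by unfold_locales
      (auto simp: pointwise_scale_def fun_eq_iff scale_right_distrib scale_left_distrib)
qed

text \<open>Multiplication by a t^m with all powers above t^n discarded. Products of more than
  \<open>n\<close> operators of degree 1 vanish even if \<open>a\<close> is not nilpotent.\<close>

definition shift_mult :: "nat \<Rightarrow> nat \<Rightarrow> 'r::ring \<Rightarrow> (nat \<Rightarrow> 'r) endo" where
  "shift_mult n m a = Endo (\<lambda>f i. if m \<le> i \<and> i \<le> n then a * f (i - m) else 0)"

lemma app_shift_mult:
  "app (shift_mult n m a) f i = (if m \<le> i \<and> i \<le> n then a * f (i - m) else 0)"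
  unfolding shift_mult_def by (subst app_Endo) (auto simp: fun_eq_iff distrib_left)

lemma shift_mult_simps:
  "shift_mult n l a * shift_mult n m b = shift_mult n (l + m) (a * b)"
  "shift_mult n m a - shift_mult n m b = shift_mult n m (a - b)"
  "n < m \<Longrightarrow> shift_mult n m a = 0"
  "shift_mult n m 0 = 0"
  by (auto intro!: endo_eqI ext simp: app_shift_mult mult.assoc algebra_simps)

lemma shift_mult_commutator:
  "commutator (shift_mult n l a) (shift_mult n m b) = shift_mult n (l + m) (commutator a b)"
  by (simp add: commutator_def shift_mult_simps add.commute)

context rat_algebra
begin

text \<open>The derivation needed in the previous lemma is the degree derivation of polynomials of
  degree at most \<open>n\<close> with coefficients in the algebra; \<open>shift_mult n 1 a\<close> is the multiplication
  by the polynomial \<open>a t\<close>.\<close>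

lemma dynkin_homogeneous:
  assumes n: "n > 0"
  shows "(\<Sum>p\<in>{p\<in>dynkin_index n. dynkin_degree p = n}. (dynkin_weight p * of_nat n) *q word a b p) =
    (\<Sum>p\<in>{p\<in>dynkin_index n. dynkin_degree p = n}.
      dynkin_weight p *q nested_bracket commutator (dynkin_word a b p))"
proof -
  let ?s = "endo_scale (pointwise_scale scale)"
  have vs: "vector_space (pointwise_scale scale)"
    by (rule vector_space_pointwise_scale[OF vector_space_axioms])
  interpret T: rat_algebra ?s
    unfolding rat_algebra_def by (rule vector_space_endo_scale[OF vs])
  define x where "x = shift_mult n 1 a"
  define y where "y = shift_mult n 1 b"
  define d where "d = Endo (\<lambda>(f :: nat \<Rightarrow> 'r) i. of_nat i *q f i)"
  have app_d: "app d f i = of_nat i *q f i" for f i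
    unfolding d_def by (subst app_Endo) (auto simp: fun_eq_iff scale_right_distrib)
  have d: "d * shift_mult n 1 c - shift_mult n 1 c * d = shift_mult n 1 c" for c
    by (auto intro!: endo_eqI ext simp: app_d app_shift_mult scale_left_diff_distrib[symmetric] of_nat_diff)
  have prod: "prod_list (map (shift_mult n 1) (c # w)) = shift_mult n (length (c # w)) (prod_list (c # w))" for w c
    by (induction w arbitrary: c) (simp_all add: shift_mult_simps)
  have nest: "nested_bracket commutator (map (shift_mult n 1) w) =
      shift_mult n (length w) (nested_bracket commutator w)" for w
    by (induction w rule: induct_list012) (simp_all add: shift_mult_simps shift_mult_commutator)
  have nil: "prod_list w = 0" if w: "set w \<subseteq> {x, y}" "length w = Suc n" for w
  proof -
    have "set w \<subseteq> shift_mult n 1 ` {a, b}" using w by (auto simp: x_def y_def)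
    then obtain v where v: "w = map (shift_mult n 1) v"
      by (metis ex_map_conv imageE subset_code(1))
    with w(2) obtain c v' where "v = c # v'" by (cases v) auto
    with v w(2) show ?thesis by (simp only: prod) (simp add: shift_mult_simps)
  qed
  have xd: "d * x - x * d = x" and yd: "d * y - y * d = y"
    unfolding x_def y_def by (rule d)+
  have eq: "(\<Sum>p\<in>dynkin_index n. ?s (dynkin_weight p * of_nat (dynkin_degree p)) (T.word x y p)) =
    (\<Sum>p\<in>dynkin_index n. ?s (dynkin_weight p) (nested_bracket commutator (dynkin_word x y p)))"
    using T.dynkin_of_derivation[of d x y n] xd yd nil by simp
  \<comment> \<open>Applying the operators to the constant polynomial 1 and reading off the
    coefficient of t^n selects the words of degree exactly \<open>n\<close>.\<close>
  define e :: "nat \<Rightarrow> 'r" where "e = (\<lambda>i. if i = 0 then 1 else 0)"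
  have w: "app (T.word x y p) e n = (if dynkin_degree p = n then word a b p else 0)"
    if p: "p \<in> dynkin_index n" for p
  proof -
    have ne: "dynkin_word a b p \<noteq> []"
      using dynkin_index_bounds(4)[OF p] length_dynkin_word[of a b p] by auto
    have "T.word x y p = shift_mult n (length (dynkin_word a b p)) (prod_list (dynkin_word a b p))"
      unfolding T.word_def x_def y_def map_dynkin_word[symmetric]
      using ne prod by (cases "dynkin_word a b p") auto
    then show ?thesis
      using dynkin_index_bounds(5)[OF p]
      by (auto simp: app_shift_mult e_def word_def length_dynkin_word)
  qed
  have v: "app (nested_bracket commutator (dynkin_word x y p)) e n =
      (if dynkin_degree p = n then nested_bracket commutator (dynkin_word a b p) else 0)"
    if p: "p \<in> dynkin_index n" for p
    unfolding x_def y_def map_dynkin_word[symmetric] nest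
    using dynkin_index_bounds(5)[OF p] by (auto simp: app_shift_mult e_def length_dynkin_word)
  have sum_app: "app (\<Sum>p\<in>dynkin_index n. ?s (f p) (g p)) e n =
      (\<Sum>p\<in>dynkin_index n. f p *q (app (g p) e n))" for f and g :: "_ \<Rightarrow> (nat \<Rightarrow> 'r) endo"
    by (simp add: app_sum_left app_endo_scale[OF vs] sum_fun_apply pointwise_scale_def)
  have "(\<Sum>p\<in>dynkin_index n. (dynkin_weight p * of_nat (dynkin_degree p)) *q
        (if dynkin_degree p = n then word a b p else 0)) =
      (\<Sum>p\<in>dynkin_index n. dynkin_weight p *q
        (if dynkin_degree p = n then nested_bracket commutator (dynkin_word a b p) else 0))"
    using arg_cong[OF eq, of "\<lambda>A. app A e n"] unfolding sum_app by (simp add: w v)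
  then show ?thesis
    by (simp add: sum.If_cases finite_dynkin_index if_distrib[of "\<lambda>z. _ *q z"] sum.inter_filter cong: if_cong conj_cong)
qed

text \<open>Sort the words by degree and divide the homogeneous identity of degree \<open>m\<close>
  by \<open>m\<close>; this turns weights into Dynkin's coefficients.\<close>

lemma bch_commutator:
  "bch scale commutator n a b = (\<Sum>p\<in>dynkin_index n. dynkin_weight p *q word a b p)"
proof -
  have group: "sum f (dynkin_index n) = (\<Sum>m\<in>{1..n}. sum f {p \<in> dynkin_index m. dynkin_degree p = m})"
    for f :: "_ \<Rightarrow> 'r"
  proof -
    have "sum f (dynkin_index n) = (\<Sum>m\<in>{1..n}. sum f {p \<in> dynkin_index n. dynkin_degree p = m})"
      using dynkin_index_bounds(4,5)[of _ n]
      by (intro sum.group[symmetric]) (auto simp: finite_dynkin_index Suc_le_eq)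
    also have "\<dots> = (\<Sum>m\<in>{1..n}. sum f {p \<in> dynkin_index m. dynkin_degree p = m})"
      by (intro sum.cong arg_cong[of _ _ "sum f"]) (auto simp: dynkin_index_def)
    finally show ?thesis .
  qed
  have "(\<Sum>p\<in>{p \<in> dynkin_index m. dynkin_degree p = m}. dynkin_weight p *q word a b p) =
      (\<Sum>p\<in>{p \<in> dynkin_index m. dynkin_degree p = m}.
        dynkin_coeff p *q nested_bracket commutator (dynkin_word a b p))" if m: "m \<in> {1..n}" for m
  proof -
    have "(\<Sum>p\<in>{p \<in> dynkin_index m. dynkin_degree p = m}. dynkin_weight p *q word a b p) =
      (1 / of_nat m) *q (\<Sum>p\<in>{p\<in>dynkin_index m. dynkin_degree p = m}. (dynkin_weight p * of_nat m) *q word a b p)"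
      using m by (simp add: scale_sum_right)
    also have "\<dots> = (\<Sum>p\<in>{p \<in> dynkin_index m. dynkin_degree p = m}.
        dynkin_coeff p *q nested_bracket commutator (dynkin_word a b p))"
      using m by (subst dynkin_homogeneous) (simp_all add: scale_sum_right dynkin_coeff_weight mult.commute)
    finally show ?thesis .
  qed
  then show ?thesis
    unfolding bch_def by (simp add: group)
qed

text \<open>By the previous lemma the Lie series equals the associative series of log (e^a e^b), and
  \<open>xp\<close> inverts \<open>lg\<close> on unipotent elements.\<close>

lemma xp_bch:
  assumes nil: "\<And>w. set w \<subseteq> {a, b} \<Longrightarrow> length w = Suc n \<Longrightarrow> prod_list w = 0"
    and M: "n < M" "1 < M"
  shows "xp M (bch scale commutator n a b) = xp M a * xp M b"
proof -
  let ?S = "{a, b}"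
  have fil0: "c = 0" if "c \<in> fil ?S (Suc n)" for c
    by (rule fil_zero[OF _ that]) (use nil in auto)
  have aS: "a \<in> fil ?S 1" and bS: "b \<in> fil ?S 1"
    using fil_base[of _ ?S] by auto
  have word0: "word a b p = 0" if "n < dynkin_degree p" for p
    using fil_prod[of "dynkin_word a b p" ?S "Suc n"] that set_dynkin_word[of a b p] fil0
    by (auto simp: word_def length_dynkin_word)
  have u: "xp M a * xp M b - 1 \<in> fil ?S 1"
    using M by (intro xp_mult_fil_1[OF aS bS]) simp
  have "(xp M a * xp M b - 1) ^ M \<in> fil ?S (Suc n)"
    using fil_power[OF u, of M] fil_antimono[of "Suc n" M ?S] M by auto
  then have u0: "(xp M a * xp M b - 1) ^ M = 0" by (rule fil0)
  have "lg M (xp M a * xp M b) = bch scale commutator n a b"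
    unfolding bch_commutator
    using log_expand[OF vector_space_axioms, of "\<lambda>x. x" n M a b] word0 M by simp
  with xp_lg[OF u0 M(2)] show ?thesis by simp
qed

end

section \<open>The Baker-Campbell-Hausdorff group of a nilpotent Lie algebra\<close>

lemma of_rat_fact: "of_rat (fact n) = fact n"
  by (metis of_nat_fact of_rat_of_nat_eq)

lemma dynkin_coeff_of_rat: "(dynkin_coeff p :: 'k::field_char_0) = of_rat (dynkin_coeff p)"
proof -
  have "of_rat (\<Prod>(r, s)\<leftarrow>p. fact r * fact s) = (\<Prod>(r, s)\<leftarrow>p. fact r * fact s :: 'k)"
    by (induction p) (auto simp: of_rat_mult of_rat_fact)
  then show ?thesis
    by (simp add: dynkin_coeff_def of_rat_mult of_rat_divide of_rat_power of_rat_minus)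
qed

context nilpotent_lc_lie_algebra
begin

lemma bracket_simps [simp]:
  "bracket (x + y) z = bracket x z + bracket y z" "bracket x (y + z) = bracket x y + bracket x z"
  "bracket (x - y) z = bracket x z - bracket y z" "bracket x (y - z) = bracket x y - bracket x z"
  "bracket (- x) z = - bracket x z" "bracket x (- z) = - bracket x z"
  "bracket 0 z = 0" "bracket x 0 = 0"
  "bracket (scl c x) z = scl c (bracket x z)" "bracket x (scl c z) = scl c (bracket x z)"
proof -
  interpret l: Vector_Spaces.linear scl scl "\<lambda>x. bracket x z" by (rule bracket_linear_left)
  interpret r: Vector_Spaces.linear scl scl "bracket x" by (rule bracket_linear_right)
  show "bracket (x + y) z = bracket x z + bracket y z" by (rule l.add)
  show "bracket (x - y) z = bracket x z - bracket y z" by (rule l.diff)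
  show "bracket (- x) z = - bracket x z" by (rule l.neg)
  show "bracket 0 z = 0" by (rule l.zero)
  show "bracket (scl c x) z = scl c (bracket x z)" by (rule l.scale)
  show "bracket x (y + z) = bracket x y + bracket x z" by (rule r.add)
  show "bracket x (y - z) = bracket x y - bracket x z" by (rule r.diff)
  show "bracket x (- z) = - bracket x z" by (rule r.neg)
  show "bracket x 0 = 0" by (rule r.zero)
  show "bracket x (scl c z) = scl c (bracket x z)" by (rule r.scale)
qed

lemma bracket_anticomm: "bracket x y = - bracket y x"
proof -
  have "bracket x x + bracket x y + (bracket y x + bracket y y) = bracket (x + y) (x + y)"
    by (simp only: bracket_simps ac_simps)
  then have "bracket x y + bracket y x = 0" by (simp only: bracket_self add_0_left add_0_right)
  then show ?thesis by (simp add: eq_neg_iff_add_eq_0)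
qed

text \<open>The Jacobi identity in the form ad [u, v] = [ad u, ad v], as needed for representing
  \<open_bracket> elements by operators.\<close>

lemma bracket_bracket: "bracket (bracket u v) w = bracket u (bracket v w) - bracket v (bracket u w)"
proof -
  have "bracket w (bracket u v) = - bracket (bracket u v) w"
    by (rule bracket_anticomm)
  moreover have "bracket v (bracket w u) = - bracket v (bracket u w)"
    by (subst bracket_anticomm[of w u]) simp
  ultimately have "bracket u (bracket v w) + - bracket v (bracket u w) + - bracket (bracket u v) w = 0"
    using jacobi[of u v w] by simp
  then show ?thesis by (simp add: algebra_simps)
qed

lemma subspace_lower_central: "0 < k \<Longrightarrow> subspace (lower_central scl bracket k)"
  by (cases "(scl, bracket, k)" rule: lower_central.cases) auto

lemma bracket_lower_central:
  "v \<in> lower_central scl bracket (Suc k) \<Longrightarrow> bracket u v \<in> lower_central scl bracket (Suc (Suc k))"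
  by (auto intro: span_base)

section \<open>A faithful action of Lie-algebra-valued polynomials without constant term\<close>

definition mscale :: "rat \<Rightarrow> (nat \<Rightarrow> 'g) \<times> rat \<Rightarrow> (nat \<Rightarrow> 'g) \<times> rat" where
  "mscale q v = (\<lambda>i. scl (of_rat q) (fst v i), q * snd v)"

lemma vector_space_mscale: "vector_space mscale"
  by unfold_locales
    (auto simp: mscale_def fun_eq_iff of_rat_add of_rat_mult scale_right_distrib scale_left_distrib algebra_simps)

text \<open>The polynomial \<open>u t\<^sup>m\<close> acting on \<open>\<gg>[[t]] \<oplus> \<rat>d\<close>, where \<open>d\<close> is the degree derivation.\<close>

definition loop :: "nat \<Rightarrow> 'g \<Rightarrow> ((nat \<Rightarrow> 'g) \<times> rat) endo" where
  "loop m u = Endo (\<lambda>v. (\<lambda>i. (if m \<le> i then bracket u (fst v (i - m)) else 0) -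
     (if i = m then scl (of_rat (snd v * of_nat m)) u else 0), 0))"

lemma app_loop:
  "app (loop m u) v = (\<lambda>i. (if m \<le> i then bracket u (fst v (i - m)) else 0) -
     (if i = m then scl (of_rat (snd v * of_nat m)) u else 0), 0)"
  unfolding loop_def
  by (subst app_Endo) (auto simp: fun_eq_iff of_rat_add scale_left_distrib distrib_right algebra_simps)

text \<open>On the series part this is the Jacobi identity. On the degree derivation it expresses
  that degrees add, which supplies the factor \<open>l + m\<close>.\<close>

lemma loop_commutator: "commutator (loop l u) (loop m v) = loop (l + m) (bracket u v)"
proof (rule endo_eqI)
  fix w
  have "fst (app (commutator (loop l u) (loop m v)) w) i = fst (app (loop (l + m) (bracket u v)) w) i" for i
  proof (cases "l + m \<le> i")
    case True
    then have "i - l - m = i - (l + m)" "i - m - l = i - (l + m)" "m \<le> i - l" "l \<le> i - m" "l \<le> i" "m \<le> i" by auto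
    moreover have "scl (of_rat (snd w * of_nat (l + m))) z =
        scl (of_rat (snd w * of_nat l)) z + scl (of_rat (snd w * of_nat m)) z" for z
      by (simp add: distrib_left of_rat_add scale_left_distrib)
    ultimately show ?thesis
      using bracket_anticomm[of v u] True
      by (cases "i = l + m") (auto simp: commutator_def app_loop bracket_bracket algebra_simps)
  next
    case False
    then show ?thesis
      by (auto simp: commutator_def app_loop)
  qed
  then show "app (commutator (loop l u) (loop m v)) w = app (loop (l + m) (bracket u v)) w"
    by (auto intro!: prod_eqI ext simp: commutator_def) (simp_all add: app_loop)
qed

interpretation R: rat_algebra "endo_scale mscale"
  unfolding rat_algebra_def by (rule vector_space_endo_scale[OF vector_space_mscale])

text \<open>The operator \<open>A\<close> comes from a polynomial without constant term whose value
  at t = 1 is \<open>a\<close>. A relation avoids choosing the polynomial; that \<open>A\<close>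
  determines \<open>a\<close> is shown in \<open>rep_unique\<close>.\<close>

inductive rep :: "((nat \<Rightarrow> 'g) \<times> rat) endo \<Rightarrow> 'g \<Rightarrow> bool" where
  rep_loop: "0 < m \<Longrightarrow> rep (loop m u) u"
| rep_zero: "rep 0 0"
| rep_add: "rep A a \<Longrightarrow> rep B b \<Longrightarrow> rep (A + B) (a + b)"

lemma rep_scale: "rep A a \<Longrightarrow> rep (endo_scale mscale q A) (scl (of_rat q) a)"
proof (induction rule: rep.induct)
  case (rep_loop m u)
  have "endo_scale mscale q (loop m u) = loop m (scl (of_rat q) u)"
    by (rule endo_eqI, unfold app_endo_scale[OF vector_space_mscale])
      (auto simp: mscale_def app_loop fun_eq_iff scale_right_diff_distrib of_rat_mult mult_ac)
  then show ?case using rep_loop rep.rep_loop by simp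
next
  case rep_zero
  have "endo_scale mscale q 0 = 0"
    by (rule endo_eqI, unfold app_endo_scale[OF vector_space_mscale])
      (simp add: mscale_def fun_eq_iff zero_prod_def)
  then show ?case using rep.rep_zero by simp
next
  case (rep_add A a B b)
  have "endo_scale mscale q (A + B) = endo_scale mscale q A + endo_scale mscale q B"
    by (rule R.scale_right_distrib)
  with rep_add rep.rep_add show ?case by (simp add: scale_right_distrib)
qed

lemma commutator_add:
  "commutator (a + b) c = commutator a c + commutator b c"
  "commutator c (a + b) = commutator c a + commutator c b"
  by (simp_all add: commutator_def algebra_simps)

lemma rep_commutator:
  assumes "rep A a" "rep B b" shows "rep (commutator A B) (bracket a b)"
  using assms(1)
proof (induction rule: rep.induct)
  case (rep_loop m u)
  show ?case
    using assms(2)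
  proof (induction rule: rep.induct)
    case (rep_loop l v)
    with \<open>0 < m\<close> show ?case by (simp add: loop_commutator rep.rep_loop)
  qed (simp_all add: commutator_add rep.rep_add rep.rep_zero, simp_all add: commutator_def rep.rep_zero)
qed (simp_all add: commutator_add rep.rep_add, simp_all add: commutator_def rep.rep_zero)

lemma rep_sum: "(\<And>i. i \<in> I \<Longrightarrow> rep (f i) (g i)) \<Longrightarrow> rep (sum f I) (sum g I)"
  by (induction I rule: infinite_finite_induct) (auto intro: rep_add rep_zero)

lemma rep_nested:
  "list_all2 rep v w \<Longrightarrow> rep (nested_bracket commutator v) (nested_bracket bracket w)"
proof (induction v arbitrary: w rule: induct_list012)
  case (3 x y v)
  then show ?case by (fastforce simp: list_all2_Cons1 intro: rep_commutator)
qed (auto simp: list_all2_Cons1 rep_zero)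

text \<open>Represented pairs are closed under sums, rational multiples and commutators, hence under
  every Lie polynomial with rational coefficients.\<close>

lemma rep_bch:
  assumes "rep A a" "rep B b"
  shows "rep (bch (endo_scale mscale) commutator n A B) (bch scl bracket n a b)"
proof -
  have "list_all2 rep (replicate r A) (replicate r a)" "list_all2 rep (replicate r B) (replicate r b)" for r
    by (induction r) (auto simp: assms)
  then have "list_all2 rep (dynkin_word A B p) (dynkin_word a b p)" for p
    by (induction p) (auto simp: dynkin_word_def intro!: list_all2_appendI)
  then show ?thesis
    unfolding bch_def by (intro rep_sum, subst dynkin_coeff_of_rat[where 'k='k]) (intro rep_scale rep_nested)
qed

text \<open>Applied to the degree derivation \<open>e\<close>, the polynomial with coefficients u_i
  yields the series with coefficients -i u_i. Dividing by i, summing and negating recovers the value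
  at t = 1. The degree is not recorded, hence the formulation for all large
  \<open>n'\<close>.\<close>

lemma rep_unique:
  assumes "rep A a" "rep A b" shows "a = b"
proof -
  define e :: "(nat \<Rightarrow> 'g) \<times> rat" where "e = (0, 1)"
  have e: "fst e i = 0" "snd e = 1" for i by (simp_all add: e_def)
  have "\<exists>n. \<forall>n'\<ge>n. a = - (\<Sum>i\<in>{1..n'}. scl (1 / of_nat i) (fst (app A e) i))" if "rep A a" for A a
    using that
  proof (induction rule: rep.induct)
    case (rep_loop m u)
    have "(\<Sum>i\<in>{1..n}. scl (1 / of_nat i) (fst (app (loop m u) e) i)) = - u" if "m \<le> n" for n
    proof -
      have "(\<Sum>i\<in>{1..n}. scl (1 / of_nat i) (fst (app (loop m u) e) i)) =
          (\<Sum>i\<in>{1..n}. if i = m then - u else 0)"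
        using rep_loop by (intro sum.cong) (auto simp: app_loop e)
      also have "\<dots> = - u" using that rep_loop by simp
      finally show ?thesis .
    qed
    then show ?case by (intro exI[of _ m]) simp
  next
    case rep_zero
    then show ?case by simp
  next
    case (rep_add A a B b)
    then obtain n1 n2 where
      1: "\<And>n'. n1 \<le> n' \<Longrightarrow> a = - (\<Sum>i\<in>{1..n'}. scl (1 / of_nat i) (fst (app A e) i))" and
      2: "\<And>n'. n2 \<le> n' \<Longrightarrow> b = - (\<Sum>i\<in>{1..n'}. scl (1 / of_nat i) (fst (app B e) i))" by blast
    have "a + b = - (\<Sum>i\<in>{1..n'}. scl (1 / of_nat i) (fst (app (A + B) e) i))" if "max n1 n2 \<le> n'" for n'
      unfolding 1[OF order_trans[OF max.cobounded1 that]] 2[OF order_trans[OF max.cobounded2 that]]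
      by (simp add: scale_right_distrib sum.distrib)
    then show ?case by blast
  qed
  from this[OF assms(1)] this[OF assms(2)] obtain n1 n2 where
    "a = - (\<Sum>i\<in>{1..max n1 n2}. scl (1 / of_nat i) (fst (app A e) i))"
    "b = - (\<Sum>i\<in>{1..max n1 n2}. scl (1 / of_nat i) (fst (app A e) i))"
    using max.cobounded1 max.cobounded2 by blast
  then show ?thesis by (rule trans[OF _ sym])
qed

lemma rep_snd: "rep A a \<Longrightarrow> snd (app A v) = 0"
  by (induction rule: rep.induct) (simp_all add: app_loop)

text \<open>The condition \<open>snd v = 0\<close> excludes a multiple of the degree derivation,
  whose image would only lie in the whole Lie algebra.\<close>

lemma rep_lower_central:
  assumes "rep A a" and v: "\<And>i. fst v i \<in> lower_central scl bracket (Suc k)" "snd v = 0"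
  shows "fst (app A v) i \<in> lower_central scl bracket (Suc (Suc k))"
  using assms(1)
proof (induction rule: rep.induct)
  case (rep_loop m u)
  have "bracket u (fst v j) \<in> lower_central scl bracket (Suc (Suc k))" for j
    by (rule bracket_lower_central[OF v(1)])
  with rep_loop show ?case
    using v subspace_0[OF subspace_lower_central[of "Suc (Suc k)"]]
    by (simp add: app_loop del: lower_central.simps)
next
  case rep_zero
  then show ?case
    using subspace_0[OF subspace_lower_central[of "Suc (Suc k)"]] by (simp del: lower_central.simps)
next
  case (rep_add A a B b)
  then show ?case
    using subspace_add[OF subspace_lower_central[of "Suc (Suc k)"]] by (simp del: lower_central.simps)
qed

text \<open>The first operator removes the derivation component and may land anywhere, that is, in
  term 1 of the lower central series. Each of the other N operators advances one term, so
  \<open>Suc N\<close> factors reach term N + 1.\<close>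

lemma rep_nilpotent:
  assumes "\<forall>A\<in>set w. \<exists>a. rep A a" "length w = Suc N"
  shows "prod_list w = 0"
proof (rule endo_eqI)
  fix v
  have "snd (app (prod_list w) v) = 0 \<and> fst (app (prod_list w) v) i \<in> lower_central scl bracket (length w)"
    if "w \<noteq> []" "\<forall>A\<in>set w. \<exists>a. rep A a" for w i
    using that
  proof (induction w arbitrary: i rule: induct_list012)
    case (2 A)
    then obtain a where "rep A a" by auto
    then show ?case using rep_snd[of A a v] by simp
  next
    case (3 A B w)
    then obtain a where a: "rep A a" by auto
    from 3 have IH: "snd (app (prod_list (B # w)) v) = 0"
      "\<And>i. fst (app (prod_list (B # w)) v) i \<in> lower_central scl bracket (Suc (length w))" by auto
    have e: "app (prod_list (A # B # w)) v = app A (app (prod_list (B # w)) v)" by simp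
    show ?case
      unfolding e using rep_snd[OF a] rep_lower_central[OF a IH(2,1)] by simp
  qed simp
  from this[of w] assms have "snd (app (prod_list w) v) = 0" "fst (app (prod_list w) v) i = 0" for i
    using lower_central_Suc_N by force+
  then show "app (prod_list w) v = app 0 v"
    by (intro prod_eqI) (auto simp: fun_eq_iff)
qed

text \<open>\<open>N + 2\<close> is the common truncation order below; it satisfies both bounds
  \<open>N < M\<close> and \<open>1 < M\<close> of \<open>xp_bch\<close>.\<close>

lemma rep_power: "rep A a \<Longrightarrow> A ^ (N + 2) = 0"
proof -
  assume "rep A a"
  then have "prod_list (replicate (Suc N) A) = 0"
    by (intro rep_nilpotent) auto
  then show ?thesis by (simp add: prod_list_replicate)
qed

lemma rep_xp_bch:
  assumes "rep A a" "rep B b"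
  shows "R.xp (N + 2) (bch (endo_scale mscale) commutator N A B) = R.xp (N + 2) A * R.xp (N + 2) B"
  using assms by (intro R.xp_bch rep_nilpotent) auto

text \<open>The logarithm recovers the operator from its exponential, and the operator determines
  the element.\<close>

lemma rep_xp_inj:
  assumes "rep A a" "rep B b" "R.xp (N + 2) A = R.xp (N + 2) B"
  shows "a = b"
proof -
  have "A = B"
  proof -
    have lg: "R.lg (N + 2) (R.xp (N + 2) C) = C" if "rep C c" for C c
      by (rule R.lg_xp[OF rep_power[OF that]]) simp
    show ?thesis
      using lg[OF assms(1)] lg[OF assms(2)] unfolding assms(3) by (rule trans[OF sym])
  qed
  with assms rep_unique show ?thesis by blast
qed

text \<open>Represent x, y, z by x t, y t, z t. Both sides have the exponential e^(x t) e^(y t) e^(z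
  t), and \<open>rep_xp_inj\<close> returns to the Lie algebra.\<close>

lemma bch_assoc: "bch scl bracket N (bch scl bracket N x y) z = bch scl bracket N x (bch scl bracket N y z)"
proof -
  let ?b = "bch (endo_scale mscale) commutator N"
  have r: "rep (loop 1 x) x" "rep (loop 1 y) y" "rep (loop 1 z) z"
    by (simp_all add: rep_loop)
  show ?thesis
    by (rule rep_xp_inj[OF rep_bch[OF rep_bch[OF r(1,2)] r(3)] rep_bch[OF r(1) rep_bch[OF r(2,3)]]])
      (simp only: rep_xp_bch[OF rep_bch[OF r(1,2)] r(3)] rep_xp_bch[OF r(1) rep_bch[OF r(2,3)]]
        rep_xp_bch[OF r(1,2)] rep_xp_bch[OF r(2,3)] mult.assoc)
qed

text \<open>In a word with at least two letters the innermost bracket already vanishes, so only the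
  two one-letter words remain.\<close>

lemma bch_commuting:
  assumes "bracket x y = 0" shows "bch scl bracket N x y = x + y"
proof -
  have yx: "bracket y x = 0" using bracket_anticomm[of y x] assms by simp
  have nest: "nested_bracket bracket (a # b # w) = 0" if "set (a # b # w) \<subseteq> {x, y}" for a b w
    using that assms yx bracket_self
    by (induction w arbitrary: a b) auto
  have "bch scl bracket N x y = (\<Sum>p\<in>{[(1, 0)], [(0, 1)]}. scl (dynkin_coeff p) (nested_bracket bracket (dynkin_word x y p)))"
    unfolding bch_def
  proof (rule sum.mono_neutral_right)
    show "{[(1, 0)], [(0, 1)]} \<subseteq> dynkin_index N"
      using N_ge_1 by (auto simp: dynkin_index_def dynkin_degree_def)
    show "\<forall>p\<in>dynkin_index N - {[(1, 0)], [(0, 1)]}.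
        scl (dynkin_coeff p) (nested_bracket bracket (dynkin_word x y p)) = 0"
    proof
      fix p assume p: "p \<in> dynkin_index N - {[(1, 0)], [(0, 1)]}"
      have "2 \<le> dynkin_degree p"
      proof (rule ccontr)
        assume "\<not> 2 \<le> dynkin_degree p"
        then have deg: "dynkin_degree p = 1"
          using dynkin_index_bounds(4)[of p N] p by simp
        then have "p \<in> dynkin_index 1" using p by (simp add: dynkin_index_def)
        then have "p \<noteq> []" "length p \<le> 1"
          by (rule dynkin_index_bounds)+
        then obtain r s where "p = [(r, s)]"
          by (cases p) auto
        with deg have "p = [(r, s)]" "r + s = 1" by (simp_all add: dynkin_degree_def)
        then have "p \<in> {[(1, 0)], [(0, 1)]}" by (cases r) auto
        with p show False by blast
      qed
      then have len: "2 \<le> length (dynkin_word x y p)" by (simp add: length_dynkin_word)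
      then obtain a v where v: "dynkin_word x y p = a # v" by (cases "dynkin_word x y p") auto
      with len obtain b w where w: "dynkin_word x y p = a # b # w" by (cases v) auto
      with nest[of a b w] set_dynkin_word[of x y p]
      show "scl (dynkin_coeff p) (nested_bracket bracket (dynkin_word x y p)) = 0" by simp
    qed
  qed (rule finite_dynkin_index)
  also have "\<dots> = x + y"
    by (simp add: dynkin_coeff_def dynkin_degree_def dynkin_word_def)
  finally show ?thesis .
qed

text \<open>With \<open>C\<close> = e^A B e^(-A), conjugation commutes with powers, so e^C = e^A e^B
  e^(-A); and \<open>xp_conj\<close> expands \<open>C\<close> as e^(ad A) B, which is where the
  bound \<open>2 * (N + 2)\<close> comes from.\<close>

lemma bch_conj:
  "bch scl bracket N (bch scl bracket N x y) (- x) =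
    (\<Sum>k<2 * (N + 2). scl (1 / fact k) ((bracket x ^^ k) y))"
proof -
  let ?M = "N + 2"
  define A where "A = loop 1 x"
  define B where "B = loop 1 y"
  have A: "rep A x" and B: "rep B y" by (simp_all add: A_def B_def rep_loop)
  have mA: "rep (- A) (- x)"
    using rep_scale[OF A, of "- 1"]
    by (simp only: of_rat_minus of_rat_1 scale_minus_left R.scale_minus_left scale_one R.scale_one)
  define C where "C = R.xp ?M A * B * R.xp ?M (- A)"
  have pow: "rep ((commutator A ^^ k) B) ((bracket x ^^ k) y)" for k
    by (induction k) (simp_all add: B rep_commutator[OF A])
  have "rep (endo_scale mscale (1 / fact k) ((commutator A ^^ k) B)) (scl (1 / fact k) ((bracket x ^^ k) y))" for k
    using rep_scale[OF pow[of k], of "1 / fact k"] by (simp add: of_rat_divide of_rat_fact)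
  then have C: "rep C (\<Sum>k<2 * ?M. scl (1 / fact k) ((bracket x ^^ k) y))"
    unfolding C_def R.xp_conj[OF rep_power[OF A]] by (rule rep_sum)
  have inv: "R.xp ?M (- A) * R.xp ?M A = 1" "R.xp ?M A * R.xp ?M (- A) = 1"
    using R.xp_inverse[OF rep_power[OF mA]] R.xp_inverse[OF rep_power[OF A]] by auto
  have Ck: "C ^ k = R.xp ?M A * B ^ k * R.xp ?M (- A)" for k
  proof (induction k)
    case (Suc k)
    have "C ^ Suc k = R.xp ?M A * B * (R.xp ?M (- A) * R.xp ?M A) * B ^ k * R.xp ?M (- A)"
      unfolding power_Suc Suc.IH by (simp only: C_def mult.assoc)
    then show ?case unfolding inv mult_1_right by (simp only: mult.assoc power_Suc)
  qed (simp only: inv power_0 mult_1_right)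
  have "R.xp ?M C = R.xp ?M A * R.xp ?M B * R.xp ?M (- A)"
    unfolding R.xp_dp[of _ C] R.xp_dp[of _ B] R.dp_def Ck sum_distrib_left sum_distrib_right
    by (simp only: R.scale_mult_left R.scale_mult_right)
  then have "R.xp ?M (bch (endo_scale mscale) commutator N (bch (endo_scale mscale) commutator N A B) (- A)) = R.xp ?M C"
    by (simp only: rep_xp_bch[OF rep_bch[OF A B] mA] rep_xp_bch[OF A B])
  from rep_xp_inj[OF rep_bch[OF rep_bch[OF A B] mA] C this] show ?thesis .
qed

end

section \<open>Continuous functionals separate points\<close>

definition sublinear :: "(real \<Rightarrow> 'a \<Rightarrow> 'a) \<Rightarrow> ('a::ab_group_add \<Rightarrow> real) \<Rightarrow> bool" where
  "sublinear s p \<longleftrightarrow> (\<forall>x y. p (x + y) \<le> p x + p y) \<and> (\<forall>r>0. \<forall>x. p (s r x) \<le> r * p x)"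

lemma sublinear_scale:
  assumes "vector_space s" "sublinear s p" "0 \<le> r"
  shows "p (s r x) = r * p x"
proof -
  interpret s: vector_space s by fact
  have le: "p (s r x) \<le> r * p x" if "r > 0" for r x
    using assms(2) that by (auto simp: sublinear_def)
  show ?thesis
  proof (cases "r = 0")
    case True
    have "p 0 \<le> 2 * p 0" "p 0 \<le> (1 / 2) * p 0"
      using le[of 2 0] le[of "1 / 2" 0] by auto
    then show ?thesis using True by simp
  next
    case False
    with assms(3) have r: "r > 0" by simp
    have "p x \<le> (1 / r) * p (s r x)"
      using le[of "1 / r" "s r x"] r by simp
    then show ?thesis using le[OF r, of x] r by (simp add: field_simps)
  qed
qed

lemma sublinear_lower_bound:
  assumes "vector_space s" "sublinear s p"
  shows "- p (- x) \<le> p x" "p 0 = 0"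
proof -
  interpret s: vector_space s by fact
  show p0: "p 0 = 0"
    using sublinear_scale[OF assms, of 0 0] by simp
  have "p (x + - x) \<le> p x + p (- x)"
    using assms(2) unfolding sublinear_def by blast
  then show "- p (- x) \<le> p x" using p0 by simp
qed

text \<open>The classical Hahn-Banach device: it lowers \<open>p\<close> as far as prescribing the
  value \<open>p y\<close> along the ray through \<open>y\<close> permits.\<close>

definition sublinear_shift :: "(real \<Rightarrow> 'a \<Rightarrow> 'a) \<Rightarrow> ('a::ab_group_add \<Rightarrow> real) \<Rightarrow> 'a \<Rightarrow> 'a \<Rightarrow> real" where
  "sublinear_shift s p y x = (INF t\<in>{0..}. p (x + s t y) - t * p y)"

text \<open>Subadditivity bounds the infimum below by \<open>- p (- x)\<close>. The choice
  \<open>t = 0\<close> gives the bound by \<open>p\<close>, and \<open>t = 1\<close> the bound at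
  \<open>- y\<close>.\<close>

lemma sublinear_shift:
  assumes s: "vector_space s" and p: "sublinear s p"
  shows "sublinear s (sublinear_shift s p y)" "sublinear_shift s p y x \<le> p x"
    "sublinear_shift s p y (- y) \<le> - p y"
proof -
  interpret s: vector_space s by fact
  note hom = sublinear_scale[OF s p]
  have add: "p (a + b) \<le> p a + p b" for a b
    using p by (simp add: sublinear_def)
  let ?g = "\<lambda>x t. p (x + s t y) - t * p y"
  have lb: "- p (- x) \<le> ?g x t" if "t \<ge> 0" for x t
    using add[of "x + s t y" "- x"] hom[OF that, of y] by simp
  have bdd: "bdd_below (?g x ` {0..})" for x
    using lb by (intro bdd_belowI2[of _ "- p (- x)"]) auto
  have le: "sublinear_shift s p y x \<le> ?g x t" if "t \<ge> 0" for x t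
    unfolding sublinear_shift_def using that bdd by (intro cINF_lower) auto
  have ge: "c \<le> sublinear_shift s p y x" if "\<And>t. t \<ge> 0 \<Longrightarrow> c \<le> ?g x t" for x c
    unfolding sublinear_shift_def using that by (intro cINF_greatest) auto
  show "sublinear_shift s p y x \<le> p x"
    using le[of 0 x] by simp
  show "sublinear_shift s p y (- y) \<le> - p y"
    using le[of 1 "- y"] sublinear_lower_bound(2)[OF s p] by simp
  have sub: "sublinear_shift s p y (a + b) \<le> sublinear_shift s p y a + sublinear_shift s p y b" for a b
  proof -
    have *: "sublinear_shift s p y (a + b) \<le> ?g a t + ?g b u" if "t \<ge> 0" "u \<ge> 0" for t u
    proof -
      have "sublinear_shift s p y (a + b) \<le> ?g (a + b) (t + u)"
        using that by (intro le) simp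
      also have "\<dots> \<le> ?g a t + ?g b u"
        using add[of "a + s t y" "b + s u y"] by (simp add: s.scale_left_distrib algebra_simps)
      finally show ?thesis .
    qed
    have "sublinear_shift s p y (a + b) - ?g b u \<le> sublinear_shift s p y a" if "u \<ge> 0" for u
      using *[OF _ that] by (intro ge) (simp add: algebra_simps)
    then have "sublinear_shift s p y (a + b) - sublinear_shift s p y a \<le> sublinear_shift s p y b"
      by (intro ge) (simp add: algebra_simps)
    then show ?thesis by simp
  qed
  have "sublinear_shift s p y (s r a) \<le> r * sublinear_shift s p y a" if r: "r > 0" for r a
  proof -
    have "(1 / r) * sublinear_shift s p y (s r a) \<le> sublinear_shift s p y a"
    proof (rule ge)
      fix t :: real assume t: "t \<ge> 0"
      have "sublinear_shift s p y (s r a) \<le> ?g (s r a) (r * t)"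
        using t r by (intro le) simp
      also have "s r a + s (r * t) y = s r (a + s t y)"
        by (simp add: s.scale_right_distrib)
      finally show "(1 / r) * sublinear_shift s p y (s r a) \<le> ?g a t"
        using r hom[of r "a + s t y"] by (simp add: field_simps)
    qed
    then show ?thesis using r by (simp add: field_simps)
  qed
  with sub show "sublinear s (sublinear_shift s p y)"
    unfolding sublinear_def by blast
qed

text \<open>Zorn's lemma with the pointwise infimum of a chain as lower bound. The infimum is finite
  because every member is at least \<open>- p (- x)\<close>, and subadditive because any two members
  have a common minorant in the chain.\<close>

lemma minimal_sublinear:
  assumes s: "vector_space s" and p: "sublinear s p"
  obtains q where "sublinear s q" "q \<le> p" "\<And>q'. sublinear s q' \<Longrightarrow> q' \<le> q \<Longrightarrow> q' = q"
proof -
  define A where "A = {q. sublinear s q \<and> q \<le> p}"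
  have "\<exists>m\<in>A. \<forall>a\<in>A. a \<le> m \<longrightarrow> a = m"
  proof (rule predicate_Zorn)
    show "partial_order_on A (relation_of (\<lambda>a b. b \<le> a) A)"
      by (rule partial_order_on_relation_ofI) auto
    fix C assume "C \<in> Chains (relation_of (\<lambda>a b. b \<le> a) A)"
    then have CA: "C \<subseteq> A" and chain: "\<And>c d. c \<in> C \<Longrightarrow> d \<in> C \<Longrightarrow> c \<le> d \<or> d \<le> c"
      by (auto simp: Chains_def relation_of_def)
    show "\<exists>u\<in>A. \<forall>a\<in>C. u \<le> a"
    proof (cases "C = {}")
      case True
      then show ?thesis using p by (auto simp: A_def)
    next
      case False
      define u where "u x = (INF c\<in>C. c x)" for x
      have bdd: "bdd_below ((\<lambda>c. c x) ` C)" for x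
      proof (rule bdd_belowI2)
        fix c assume "c \<in> C"
        then have c: "sublinear s c" "c \<le> p" using CA by (auto simp: A_def)
        show "- p (- x) \<le> c x"
          using sublinear_lower_bound(1)[OF s c(1), of x] le_funD[OF c(2), of "- x"] by linarith
      qed
      have le: "u x \<le> c x" if "c \<in> C" for c x
        unfolding u_def using that bdd by (intro cINF_lower) auto
      have ge: "b \<le> u x" if "\<And>c. c \<in> C \<Longrightarrow> b \<le> c x" for b x
        unfolding u_def using that False by (intro cINF_greatest) auto
      have sub: "sublinear s c" if "c \<in> C" for c
        using that CA by (auto simp: A_def)
      have add: "u (x + y) \<le> u x + u y" for x y
      proof -
        have *: "u (x + y) \<le> c x + d y" if "c \<in> C" "d \<in> C" for c d
        proof -
          from chain[OF that] that obtain e where e: "e \<in> C" "e \<le> c" "e \<le> d" by auto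
          have "u (x + y) \<le> e (x + y)" by (rule le[OF e(1)])
          also have "\<dots> \<le> e x + e y" using sub[OF e(1)] by (simp add: sublinear_def)
          also have "\<dots> \<le> c x + d y" using e by (intro add_mono) (auto dest: le_funD)
          finally show ?thesis .
        qed
        have "u (x + y) - d y \<le> u x" if "d \<in> C" for d
          using *[OF _ that] by (intro ge) (simp add: algebra_simps)
        then have "u (x + y) - u x \<le> u y"
          by (intro ge) (simp add: algebra_simps)
        then show ?thesis by simp
      qed
      have "u (s r x) \<le> r * u x" if r: "r > 0" for r x
      proof -
        have "(1 / r) * u (s r x) \<le> u x"
        proof (rule ge)
          fix c assume c: "c \<in> C"
          have "u (s r x) \<le> r * c x"
            using le[OF c, of "s r x"] sub[OF c] r by (auto simp: sublinear_def intro: order_trans)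
          then show "(1 / r) * u (s r x) \<le> c x" using r by (simp add: field_simps)
        qed
        then show ?thesis using r by (simp add: field_simps)
      qed
      with add have "sublinear s u" by (simp add: sublinear_def)
      moreover have "u \<le> p"
      proof (rule le_funI)
        fix x
        obtain c where c: "c \<in> C" using False by blast
        then have "c x \<le> p x" using CA by (auto simp: A_def dest: le_funD)
        with le[OF c, of x] show "u x \<le> p x" by linarith
      qed
      ultimately show ?thesis using le by (auto simp: A_def le_fun_def)
    qed
  qed
  then obtain q where q: "q \<in> A" "\<And>a. a \<in> A \<Longrightarrow> a \<le> q \<Longrightarrow> a = q" by blast
  show thesis
  proof (rule that[of q])
    show "sublinear s q" "q \<le> p" using q(1) by (auto simp: A_def)
    fix q' assume "sublinear s q'" "q' \<le> q"
    then show "q' = q" using q by (intro q(2)) (auto simp: A_def)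
  qed
qed

text \<open>A minimal sublinear \<open>q\<close> is linear, because \<open>sublinear_shift s q y\<close> is sublinear, at most \<open>q\<close>, and
  at most \<open>- q y\<close> at \<open>- y\<close>.\<close>

lemma hahn_banach_sublinear:
  assumes s: "vector_space s" and p: "sublinear s p"
  obtains f where "Vector_Spaces.linear s (*) f" "\<And>x. f x \<le> p x" "f z = p z"
proof -
  interpret s: vector_space s by fact
  \<comment> \<open>Starting below the shift by \<open>z\<close> rather than below \<open>p\<close>
    forces \<open>q (- z) \<le> - p z\<close>, hence the value \<open>p z\<close> at
    \<open>z\<close>.\<close>
  obtain q where q: "sublinear s q" "q \<le> sublinear_shift s p z"
    "\<And>q'. sublinear s q' \<Longrightarrow> q' \<le> q \<Longrightarrow> q' = q"
    using minimal_sublinear[OF s sublinear_shift(1)[OF s p]] by metis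
  have qle: "q x \<le> p x" for x
    using le_funD[OF q(2), of x] sublinear_shift(2)[OF s p, of z x] by linarith
  have neg: "q (- y) = - q y" for y
  proof -
    have "sublinear_shift s q y = q"
      using sublinear_shift(2)[OF s q(1)] by (intro q(3) sublinear_shift(1)[OF s q(1)] le_funI)
    then have "q (- y) \<le> - q y"
      using sublinear_shift(3)[OF s q(1), of y] by simp
    with sublinear_lower_bound(1)[OF s q(1), of y] show ?thesis by linarith
  qed
  have sub: "q (x + y) \<le> q x + q y" for x y
    using q(1) by (simp add: sublinear_def)
  have add: "q (x + y) = q x + q y" for x y
    using sub[of x y] sub[of "x + y" "- y"] neg[of y] by simp
  have scale: "q (s r x) = r * q x" for r x
  proof (cases "r \<ge> 0")
    case True
    then show ?thesis by (rule sublinear_scale[OF s q(1)])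
  next
    case False
    then show ?thesis
      using sublinear_scale[OF s q(1), of "- r" x] neg[of "s r x"] by simp
  qed
  have "vector_space ((*) :: real \<Rightarrow> real \<Rightarrow> real)"
    by unfold_locales (auto simp: algebra_simps)
  then have "Vector_Spaces.linear s (*) q"
    using s add scale
    by (simp add: Vector_Spaces.linear_def module_hom_def module_hom_axioms_def module_iff_vector_space)
  moreover have "q z = p z"
    using le_funD[OF q(2), of "- z"] sublinear_shift(3)[OF s p, of z] neg[of z] qle[of z] by linarith
  ultimately show thesis using that qle by blast
qed

context locally_convex_space
begin

lemma continuous_scale_right: "continuous_on UNIV (scl c)"
proof -
  have "continuous_on UNIV ((\<lambda>(c, x). scl c x) \<circ> (\<lambda>x. (c, x)))"
    by (intro continuous_on_compose continuous_intros continuous_on_subset[OF continuous_scale]) auto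
  then show ?thesis by (simp add: o_def)
qed

lemma continuous_scale_left: "continuous_on UNIV (\<lambda>c. scl c x)"
proof -
  have "continuous_on UNIV ((\<lambda>(c, x). scl c x) \<circ> (\<lambda>c. (c, x)))"
    by (intro continuous_on_compose continuous_intros continuous_on_subset[OF continuous_scale]) auto
  then show ?thesis by (simp add: o_def)
qed

lemma vector_space_real: "vector_space (\<lambda>r. scl (of_real r))"
  by unfold_locales (simp_all add: scale_right_distrib scale_left_distrib)

text \<open>Hahn-Banach for the Minkowski functional \<open>p\<close> of a convex neighbourhood of 0
  that misses \<open>z\<close>: then \<open>p z \<ge> 1\<close>, while \<open>p \<le> 1\<close> on
  the neighbourhood makes the functional continuous.\<close>

lemma real_functional:
  assumes "z \<noteq> 0"
  obtains f where "Vector_Spaces.linear (\<lambda>r. scl (of_real r)) (*) f" "continuous_on UNIV f" "f z \<noteq> (0::real)"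
proof -
  let ?s = "\<lambda>r::real. scl (of_real r)"
  obtain U where U: "open U" "0 \<in> U" "z \<notin> U"
    using t1_space[of 0 z] assms by auto
  obtain V where V: "open V" "0 \<in> V" "V \<subseteq> U"
    and conv: "\<And>x y t::real. x \<in> V \<Longrightarrow> y \<in> V \<Longrightarrow> 0 \<le> t \<Longrightarrow> t \<le> 1 \<Longrightarrow> ?s (1 - t) x + ?s t y \<in> V"
    using locally_convex[OF U(1,2)] by blast
  define G where "G x = {t::real. t > 0 \<and> ?s (1 / t) x \<in> V}" for x
  define p where "p x = Inf (G x)" for x
  have ne: "G x \<noteq> {}" for x
  proof -
    have "continuous_on UNIV (\<lambda>r::real. ?s r x)"
      using continuous_on_compose[OF continuous_on_of_real_id[of UNIV, where 'a='k] continuous_on_subset[OF continuous_scale_left]]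
      by (simp add: o_def)
    then have "open ((\<lambda>r. ?s r x) -` V)" using V(1) by (simp add: continuous_on_open_vimage)
    moreover have "0 \<in> (\<lambda>r. ?s r x) -` V" using V(2) by simp
    ultimately obtain e where e: "e > 0" "ball 0 e \<subseteq> (\<lambda>r. ?s r x) -` V"
      using open_contains_ball by blast
    then have "e / 2 \<in> (\<lambda>r. ?s r x) -` V" by (intro subsetD[OF e(2)]) auto
    then have "2 / e \<in> G x" using e(1) by (simp add: G_def)
    then show ?thesis by blast
  qed
  have bdd: "bdd_below (G x)" for x
    by (rule bdd_belowI[of _ 0]) (simp add: G_def)
  have le: "p x \<le> t" if "t \<in> G x" for x t
    unfolding p_def by (rule cInf_lower[OF that bdd])
  have ge: "c \<le> p x" if "\<And>t. t \<in> G x \<Longrightarrow> c \<le> t" for c x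
    unfolding p_def by (rule cInf_greatest[OF ne that])
  have sub: "p (x + y) \<le> p x + p y" for x y
  proof -
    have *: "p (x + y) \<le> t + u" if t: "t \<in> G x" and u: "u \<in> G y" for t u
    proof (rule le)
      have tu: "t > 0" "u > 0" "?s (1 / t) x \<in> V" "?s (1 / u) y \<in> V"
        using t u by (auto simp: G_def)
      have "?s (1 - u / (t + u)) (?s (1 / t) x) + ?s (u / (t + u)) (?s (1 / u) y) \<in> V"
        using tu by (intro conv) auto
      moreover have "(1 - u / (t + u)) * (1 / t) = 1 / (t + u)" "(u / (t + u)) * (1 / u) = 1 / (t + u)"
        using tu by (auto simp: field_simps)
      ultimately have "?s (1 / (t + u)) (x + y) \<in> V"
        by (simp only: scale_scale of_real_mult[symmetric] scale_right_distrib)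
      with tu show "t + u \<in> G (x + y)" by (simp add: G_def)
    qed
    have "p (x + y) - u \<le> p x" if "u \<in> G y" for u
      using *[OF _ that] by (intro ge) (simp add: algebra_simps)
    then have "p (x + y) - p x \<le> p y"
      by (intro ge) (simp add: algebra_simps)
    then show ?thesis by simp
  qed
  have "p (?s r x) \<le> r * p x" if r: "r > 0" for r x
  proof -
    have "(1 / r) * p (?s r x) \<le> p x"
    proof (rule ge)
      fix t assume "t \<in> G x"
      then have t: "t > 0" "?s (1 / t) x \<in> V" by (auto simp: G_def)
      have "1 / (r * t) * r = 1 / t" using r t by simp
      then have "?s (1 / (r * t)) (?s r x) = ?s (1 / t) x"
        by (simp only: scale_scale of_real_mult[symmetric])
      then have "p (?s r x) \<le> r * t"
        using r t by (intro le) (simp add: G_def)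
      then show "(1 / r) * p (?s r x) \<le> t" using r by (simp add: field_simps)
    qed
    then show ?thesis using r by (simp add: field_simps)
  qed
  with sub have "sublinear ?s p" by (simp add: sublinear_def)
  then obtain f where f: "Vector_Spaces.linear ?s (*) f" "\<And>x. f x \<le> p x" "f z = p z"
    using hahn_banach_sublinear[OF vector_space_real] by metis
  interpret f: Vector_Spaces.linear ?s "(*)" f by (rule f(1))
  have pz: "1 \<le> p z"
  proof (rule ge, rule ccontr)
    fix t assume "t \<in> G z" "\<not> 1 \<le> t"
    then have t: "0 < t" "t < 1" "?s (1 / t) z \<in> V" by (auto simp: G_def)
    \<comment> \<open>For t < 1 the point \<open>z\<close> would be a convex combination of 0 and z
      / t, both in \<open>V\<close>.\<close>
    have "?s (1 - t) 0 + ?s t (?s (1 / t) z) \<in> V"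
      using t V(2) by (intro conv) auto
    with t have "z \<in> V" by simp
    with V(3) U(3) show False by blast
  qed
  have p1: "p x \<le> 1" if "x \<in> V" for x
    using that by (intro le) (simp add: G_def)
  define W where "W = V \<inter> uminus -` V"
  have "continuous_on UNIV (uminus :: 'g \<Rightarrow> 'g)" by (intro continuous_intros)
  then have W: "open W" "0 \<in> W"
    using V by (auto simp: W_def continuous_on_open_vimage intro!: open_Int)
  have fW: "\<bar>f x\<bar> \<le> 1" if "x \<in> W" for x
    using f(2)[of x] f(2)[of "- x"] p1[of x] p1[of "- x"] that by (simp add: W_def f.neg)
  have "continuous_on UNIV f"
  proof (rule continuous_at_imp_continuous_on, intro ballI)
    fix x
    show "isCont f x"
      unfolding isCont_def tendsto_iff
    proof (intro allI impI)
      fix e :: real assume e: "e > 0"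
      define h where "h y = ?s (2 / e) (y - x)" for y
      have "continuous_on UNIV h"
        unfolding h_def
        by (rule continuous_on_compose2[OF continuous_scale_right]) (auto intro!: continuous_intros)
      then have "open (h -` W)" using W(1) by (simp add: continuous_on_open_vimage)
      moreover have "x \<in> h -` W" using W(2) by (simp add: h_def)
      moreover have "dist (f y) (f x) < e" if "y \<in> h -` W" for y
      proof -
        have "\<bar>f (h y)\<bar> \<le> 1" using that by (intro fW) simp
        moreover have "f (h y) = (2 / e) * (f y - f x)"
          unfolding h_def f.scale f.diff ..
        ultimately have "\<bar>2 / e\<bar> * \<bar>f y - f x\<bar> \<le> 1" by (simp only: abs_mult)
        then have "\<bar>f y - f x\<bar> \<le> e / 2" using e by (simp add: field_simps)
        with e show ?thesis by (simp add: dist_real_def)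
      qed
      ultimately show "\<forall>\<^sub>F y in at x. dist (f y) (f x) < e"
        unfolding eventually_at_topological by blast
    qed
  qed
  moreover have "f z \<noteq> 0" using pz f(3) by simp
  ultimately show thesis using that f(1) by blast
qed

text \<open>A real functional \<open>f\<close> is turned into the \<open>\<bbbK>\<close>-linear \<open>\<xi>\<close> with \<open>(a \<xi> x) \<bullet> 1 = f (a x)\<close> for all
  scalars \<open>a\<close>; it exists because \<open>c \<mapsto> (a \<mapsto> (a c) \<bullet> 1)\<close> is an injective, hence bijective, linear map
  from \<open>\<bbbK>\<close> to its real dual.\<close>

lemma dual_nonzero:
  assumes "z \<noteq> 0"
  obtains \<xi> where "\<xi> \<in> topological_dual scl" "\<xi> z \<noteq> 0"
proof -
  obtain f where f: "Vector_Spaces.linear (\<lambda>r. scl (of_real r)) (*) f" "continuous_on UNIV f" "f z \<noteq> (0::real)"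
    using real_functional[OF assms] by blast
  interpret f: Vector_Spaces.linear "\<lambda>r. scl (of_real r)" "(*)" f by (rule f(1))
  define F where "F x = (\<Sum>b\<in>Basis. f (scl b x) *\<^sub>R b)" for x
  have F: "a \<bullet> F x = f (scl a x)" for a x
  proof -
    have "f (scl a x) = f (scl (\<Sum>b\<in>Basis. (a \<bullet> b) *\<^sub>R b) x)"
      by (simp add: euclidean_representation)
    also have "\<dots> = (\<Sum>b\<in>Basis. f (scl (of_real (a \<bullet> b)) (scl b x)))"
      by (simp add: scale_sum_left f.sum scaleR_conv_of_real)
    also have "\<dots> = (\<Sum>b\<in>Basis. (a \<bullet> b) * f (scl b x))"
      unfolding f.scale ..
    finally show ?thesis by (simp add: F_def inner_sum_right mult.commute)
  qed
  define T :: "'k \<Rightarrow> 'k" where "T c = (\<Sum>b\<in>Basis. ((b * c) \<bullet> 1) *\<^sub>R b)" for c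
  have T: "a \<bullet> T c = (a * c) \<bullet> 1" for a c
  proof -
    have "(a * c) \<bullet> 1 = ((\<Sum>b\<in>Basis. (a \<bullet> b) *\<^sub>R b) * c) \<bullet> 1"
      by (simp add: euclidean_representation)
    also have "\<dots> = (\<Sum>b\<in>Basis. (a \<bullet> b) * ((b * c) \<bullet> 1))"
      by (simp add: sum_distrib_right inner_sum_left)
    finally show ?thesis by (simp add: T_def inner_sum_right mult.commute)
  qed
  have linT: "linear T"
    by (rule linearI; rule vector_eq_ldot[THEN iffD1])
      (simp_all add: T inner_add_right inner_add_left distrib_left)
  have "inj T"
    unfolding linear_injective_0[OF linT]
  proof (intro allI impI, rule ccontr)
    fix c assume "T c = 0" "c \<noteq> 0"
    \<comment> \<open>The left side is \<open>inverse c \<bullet> 0 = 0\<close>, the right side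
      \<open>1 \<bullet> 1\<close>, which is positive.\<close>
    then show False using T[of "inverse c" c] by simp
  qed
  then have surjT: "surj T" using \<open>inj T\<close> linear_injective_imp_surjective[OF linT] by simp
  from linear_injective_left_inverse[OF linT \<open>inj T\<close>] obtain S where S: "linear S" "S \<circ> T = id" by blast
  have TS: "T (S y) = y" for y
    using S(2) surjT by (metis comp_apply id_apply surjD)
  define \<xi> where "\<xi> x = S (F x)" for x
  have key: "(a * \<xi> x) \<bullet> 1 = f (scl a x)" for a x
    using T[of a "\<xi> x"] F[of a x] by (simp add: \<xi>_def TS)
  have uniq: "c = d" if "\<And>a. (a * c) \<bullet> 1 = (a * d) \<bullet> (1::'k)" for c d
  proof -
    have "T c = T d" by (rule vector_eq_ldot[THEN iffD1]) (simp add: T that)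
    with \<open>inj T\<close> show ?thesis by (simp add: inj_eq)
  qed
  have add: "\<xi> (x + y) = \<xi> x + \<xi> y" for x y
    by (rule uniq) (simp add: key scale_right_distrib f.add distrib_left inner_add_left)
  have scale: "\<xi> (scl c x) = c * \<xi> x" for c x
  proof (rule uniq)
    fix a
    show "(a * \<xi> (scl c x)) \<bullet> 1 = (a * (c * \<xi> x)) \<bullet> 1"
      using key[of "a * c" x] key[of a "scl c x"] by (simp add: mult.assoc)
  qed
  have "vector_space ((*) :: 'k \<Rightarrow> 'k \<Rightarrow> 'k)"
    by unfold_locales (auto simp: algebra_simps)
  then have "Vector_Spaces.linear scl (*) \<xi>"
    using vector_space_axioms add scale
    by (simp add: Vector_Spaces.linear_def module_hom_def module_hom_axioms_def module_iff_vector_space)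
  moreover have "continuous_on UNIV \<xi>"
    unfolding \<xi>_def F_def
    by (rule continuous_on_compose2[OF linear_continuous_on[OF linear_linear[THEN iffD2, OF S(1)], of UNIV]])
      (auto intro!: continuous_intros continuous_on_compose2[OF f(2) continuous_scale_right])
  moreover have "\<xi> z \<noteq> 0"
    using key[of 1 z] f(3) by auto
  ultimately show thesis using that by (auto simp: topological_dual_def)
qed

end

section \<open>Lagrange interpolation and polynomials on vector spaces\<close>

definition lagrange_basis :: "nat \<Rightarrow> nat \<Rightarrow> 'k::field_char_0 poly" where
  "lagrange_basis d i = (\<Prod>k\<in>{..d} - {i}. smult (1 / (of_nat i - of_nat k)) [:- of_nat k, 1:])"

lemma poly_lagrange_basis:
  assumes "i \<le> d" "m \<le> d"
  shows "poly (lagrange_basis d i) (of_nat m) = (if m = i then 1 else 0)"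
proof -
  have eq: "poly (lagrange_basis d i) (of_nat m) =
      (\<Prod>k\<in>{..d} - {i}. 1 / (of_nat i - of_nat k) * (of_nat m - of_nat k :: 'a))"
  proof -
    have "poly [:- b, 1:] x = x - b" for b x :: 'a by simp
    then show ?thesis unfolding lagrange_basis_def poly_prod poly_smult by simp
  qed
  show ?thesis
  proof (cases "m = i")
    case True
    have "1 / (of_nat i - of_nat k) * (of_nat i - of_nat k) = (1 :: 'a)" if "k \<in> {..d} - {i}" for k
      using that by simp
    then have "(\<Prod>k\<in>{..d} - {i}. 1 / (of_nat i - of_nat k) * (of_nat i - of_nat k :: 'a)) = 1"
      by (rule prod.neutral[OF ballI])
    then have "poly (lagrange_basis d i) (of_nat m) = (1 :: 'a)" using eq unfolding True by (rule trans[rotated])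
    then show ?thesis using True by simp
  next
    case False
    then have "m \<in> {..d} - {i}" using assms by auto
    then have "(\<Prod>k\<in>{..d} - {i}. 1 / (of_nat i - of_nat k) * (of_nat m - of_nat k :: 'a)) = 0"
      by (intro prod_zero bexI[of _ m]) auto
    then show ?thesis unfolding eq using False by simp
  qed
qed

lemma degree_lagrange_basis: "i \<le> d \<Longrightarrow> degree (lagrange_basis d i) \<le> d"
proof -
  assume i: "i \<le> d"
  have "degree (lagrange_basis d i :: 'a poly) \<le>
      (\<Sum>k\<in>{..d} - {i}. degree (smult (1 / (of_nat i - of_nat k :: 'a)) [:- of_nat k, 1:]))"
    unfolding lagrange_basis_def by (rule degree_prod_sum_le[unfolded o_def]) simp
  also have "\<dots> \<le> (\<Sum>k\<in>{..d} - {i}. 1)"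
    by (rule sum_mono) (auto intro: order_trans[OF degree_smult_le])
  also have "\<dots> = d" using i by simp
  finally show ?thesis .
qed

text \<open>Universal weights: the coefficient of t^j of any polynomial of degree at most
  \<open>d\<close> is the combination of its values at 0, ..., d with these weights. Being
  independent of the polynomial, they can be applied to function-valued polynomials.\<close>

definition lagrange_coeff :: "nat \<Rightarrow> nat \<Rightarrow> nat \<Rightarrow> 'k::field_char_0" where
  "lagrange_coeff d j i = coeff (lagrange_basis d i) j"

lemma coeff_lagrange:
  assumes "degree p \<le> d"
  shows "coeff p j = (\<Sum>i\<le>d. lagrange_coeff d j i * poly p (of_nat i))"
proof -
  have "p = (\<Sum>i\<le>d. smult (poly p (of_nat i)) (lagrange_basis d i))"
  proof (rule poly_eqI_degree[where A = "of_nat ` {..d}"])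
    show "poly p x = poly (\<Sum>i\<le>d. smult (poly p (of_nat i)) (lagrange_basis d i)) x" if "x \<in> of_nat ` {..d}" for x
    proof -
      from that obtain m where m: "m \<le> d" "x = of_nat m" by auto
      have "poly (\<Sum>i\<le>d. smult (poly p (of_nat i)) (lagrange_basis d i)) x =
          (\<Sum>i\<le>d. if i = m then poly p (of_nat m) else 0)"
        unfolding poly_sum m(2) using m(1) by (intro sum.cong) (auto simp: poly_lagrange_basis)
      also have "\<dots> = poly p x"
        using m(1) by (simp add: m(2))
      finally show ?thesis ..
    qed
    have card: "card ((of_nat :: nat \<Rightarrow> 'a) ` {..d}) = Suc d"
      by (subst card_image) (auto simp: inj_on_def)
    show "degree p < card ((of_nat :: nat \<Rightarrow> 'a) ` {..d})"
      unfolding card using assms by (rule le_imp_less_Suc)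
    have "degree (\<Sum>i\<le>d. smult (poly p (of_nat i)) (lagrange_basis d i)) \<le> d"
      by (intro degree_sum_le finite_atMost order_trans[OF degree_smult_le] degree_lagrange_basis) simp
    then show "degree (\<Sum>i\<le>d. smult (poly p (of_nat i)) (lagrange_basis d i)) < card ((of_nat :: nat \<Rightarrow> 'a) ` {..d})"
      unfolding card by (rule le_imp_less_Suc)
  qed
  then have "coeff p j = coeff (\<Sum>i\<le>d. smult (poly p (of_nat i)) (lagrange_basis d i)) j"
    by (rule arg_cong[where f = "\<lambda>q. coeff q j"])
  also have "\<dots> = (\<Sum>i\<le>d. lagrange_coeff d j i * poly p (of_nat i))"
    by (simp add: coeff_sum lagrange_coeff_def mult.commute)
  finally show ?thesis .
qed

definition poly_fun :: "nat \<Rightarrow> ('k::field \<Rightarrow> 'k) \<Rightarrow> bool" where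
  "poly_fun d f \<longleftrightarrow> (\<exists>p. degree p \<le> d \<and> f = poly p)"

lemma poly_fun_expand:
  fixes f :: "'k::field_char_0 \<Rightarrow> 'k"
  assumes "poly_fun d f"
  shows "f t = (\<Sum>j\<le>d. (\<Sum>i\<le>d. lagrange_coeff d j i * f (of_nat i)) * t ^ j)"
proof -
  obtain p where p: "degree p \<le> d" "f = poly p" using assms by (auto simp: poly_fun_def)
  have "f t = (\<Sum>j\<le>d. coeff p j * t ^ j)"
    unfolding p(2) poly_altdef using p(1) by (intro sum.mono_neutral_left) (auto simp: coeff_eq_0)
  then show ?thesis
    using coeff_lagrange[OF p(1)] p(2) by simp
qed

lemma poly_fun_unique:
  fixes f :: "'k::field_char_0 \<Rightarrow> 'k"
  assumes "\<And>t. f t = (\<Sum>j\<le>d. c j * t ^ j)" "j \<le> d"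
  shows "(\<Sum>i\<le>d. lagrange_coeff d j i * f (of_nat i)) = c j"
proof -
  define p where "p = (\<Sum>j\<le>d. monom (c j) j)"
  have "degree p \<le> d"
    unfolding p_def by (intro degree_sum_le) (auto intro: order_trans[OF degree_monom_le])
  moreover have "poly p t = f t" for t
    by (simp add: p_def poly_sum poly_monom assms(1))
  moreover have "coeff p j = c j"
    using assms(2) by (simp add: p_def coeff_sum if_distrib cong: if_cong)
  ultimately show ?thesis
    using coeff_lagrange[of p d j] by simp
qed

lemma poly_fun_const: "poly_fun d (\<lambda>_. c)"
  unfolding poly_fun_def by (rule exI[of _ "[:c:]"]) auto

lemma poly_fun_add:
  assumes "poly_fun d f" "poly_fun d g" shows "poly_fun d (\<lambda>t. f t + g t)"
proof -
  obtain p q where "degree p \<le> d" "f = poly p" "degree q \<le> d" "g = poly q"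
    using assms by (auto simp: poly_fun_def)
  then show ?thesis
    unfolding poly_fun_def by (intro exI[of _ "p + q"]) (auto simp: degree_add_le)
qed

lemma poly_fun_cmult:
  assumes "poly_fun d f" shows "poly_fun d (\<lambda>t. c * f t)"
proof -
  obtain p where "degree p \<le> d" "f = poly p"
    using assms by (auto simp: poly_fun_def)
  then show ?thesis
    unfolding poly_fun_def by (intro exI[of _ "smult c p"]) (auto intro: order_trans[OF degree_smult_le])
qed

lemma poly_fun_sum: "(\<And>i. i \<in> I \<Longrightarrow> poly_fun d (f i)) \<Longrightarrow> poly_fun d (\<lambda>t. \<Sum>i\<in>I. f i t)"
  by (induction I rule: infinite_finite_induct) (auto intro: poly_fun_add poly_fun_const)

lemma poly_fun_power: "poly_fun e f \<Longrightarrow> e + j \<le> d \<Longrightarrow> poly_fun d (\<lambda>t. t ^ j * f t)"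
proof -
  assume "poly_fun e f" "e + j \<le> d"
  then obtain p where "degree p \<le> e" "f = poly p" by (auto simp: poly_fun_def)
  moreover have "degree (monom 1 j * p) \<le> j + degree p"
    using degree_mult_le[of "monom 1 j" p] degree_monom_le[of "1 :: 'a" j] by linarith
  ultimately show ?thesis
    unfolding poly_fun_def using \<open>e + j \<le> d\<close>
    by (intro exI[of _ "monom 1 j * p"]) (auto simp: poly_monom)
qed

lemma poly_fun_mono: "poly_fun d f \<Longrightarrow> d \<le> e \<Longrightarrow> poly_fun e f"
  unfolding poly_fun_def by (blast intro: order_trans)

text \<open>The shift keeps the leading coefficient, so the difference loses a degree. This drives
  the unipotency of the group representation.\<close>

lemma poly_fun_shift_diff:
  assumes "poly_fun (Suc d) f"
  shows "poly_fun d (\<lambda>t. f (t + 1) - f t)"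
proof -
  obtain p where p: "degree p \<le> Suc d" "f = poly p" using assms by (auto simp: poly_fun_def)
  define q where "q = p \<circ>\<^sub>p [:1, 1:] - p"
  have "degree q \<le> Suc d"
    unfolding q_def using p(1) by (intro degree_diff_le order_trans[OF degree_pcompose_le]) auto
  moreover have "coeff q (Suc d) = 0"
  proof (cases "degree p = Suc d")
    case True
    have "coeff (p \<circ>\<^sub>p [:1, 1:]) (degree (p \<circ>\<^sub>p [:1, 1:])) = lead_coeff p"
      by (subst lead_coeff_comp) auto
    with True show ?thesis by (simp add: q_def degree_pcompose)
  next
    case False
    then show ?thesis using p(1) by (simp add: q_def coeff_eq_0 degree_pcompose)
  qed
  ultimately have "degree q \<le> d"
    by (intro degree_le) (metis Suc_lessI coeff_eq_0 le_less_trans)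
  then show ?thesis
    unfolding poly_fun_def using p(2)
    by (intro exI[of _ q]) (auto simp: q_def poly_pcompose fun_eq_iff add.commute)
qed

text \<open>The combination extracts the coefficient of s in p(t + s), which is p'(t). This drives
  the nilpotency of the derived representation.\<close>

lemma poly_fun_lagrange_shift:
  fixes f :: "'k::field_char_0 \<Rightarrow> 'k"
  assumes "poly_fun (Suc e) f" "Suc e \<le> d"
  shows "poly_fun e (\<lambda>t. \<Sum>i\<le>d. lagrange_coeff d 1 i * f (t + of_nat i))"
proof -
  obtain p where p: "degree p \<le> Suc e" "f = poly p" using assms by (auto simp: poly_fun_def)
  have coeff_1: "coeff (p \<circ>\<^sub>p [:t, 1:]) 1 = poly (pderiv p) t" for t
    by (induction p) (simp_all add: pcompose_pCons pderiv_pCons coeff_pCons poly_pcompose poly_0_coeff_0[symmetric])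
  have "degree (pderiv p) \<le> e"
    using p(1) by (simp add: degree_pderiv)
  moreover have "(\<Sum>i\<le>d. lagrange_coeff d 1 i * f (t + of_nat i)) = poly (pderiv p) t" for t
  proof -
    have "degree (p \<circ>\<^sub>p [:t, 1:]) \<le> d"
      using p(1) assms(2) by (simp add: degree_pcompose)
    from coeff_lagrange[OF this, of 1] show ?thesis
      unfolding coeff_1 by (simp add: poly_pcompose p(2))
  qed
  ultimately show ?thesis
    unfolding poly_fun_def by (intro exI[of _ "pderiv p"]) auto
qed

lemma sum_lagrange_coeff: "j \<noteq> 0 \<Longrightarrow> (\<Sum>i\<le>d. lagrange_coeff d j i) = (0 :: 'k::field_char_0)"
  using coeff_lagrange[of "1 :: 'k poly" d j] by simp

lemma linear_scalar_iff:
  fixes s :: "'k::field \<Rightarrow> 'g::ab_group_add \<Rightarrow> 'g"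
  assumes "vector_space s"
  shows "Vector_Spaces.linear s (*) f \<longleftrightarrow> (\<forall>x y. f (x + y) = f x + f y) \<and> (\<forall>c x. f (s c x) = c * f x)"
proof -
  have "vector_space ((*) :: 'k \<Rightarrow> 'k \<Rightarrow> 'k)"
    by unfold_locales (auto simp: algebra_simps)
  with assms show ?thesis
    by (auto simp: Vector_Spaces.linear_def module_hom_def module_hom_axioms_def module_iff_vector_space)
qed

section \<open>Polynomial functions and their restriction to polynomial curves\<close>

locale scalar_space = vector_space scale
  for scale :: "'a::field_char_0 \<Rightarrow> 'b::ab_group_add \<Rightarrow> 'b"
begin

text \<open>The degree bound is strict, so that \<open>n = 0\<close> leaves only the zero function
  and an induction can split off the top form. Continuity is kept apart because it does not survive
  pointwise limits.\<close>

definition alg_poly :: "nat \<Rightarrow> ('b \<Rightarrow> 'a) \<Rightarrow> bool" where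
  "alg_poly n \<phi> \<longleftrightarrow> (\<exists>\<psi>. (\<forall>j<n. multilinear_form scale j (\<psi> j)) \<and>
     (\<forall>x. \<phi> x = (\<Sum>j<n. \<psi> j (replicate j x))))"

lemma multilinear_form_slot:
  assumes "multilinear_form scale j \<psi>" "length xs + Suc (length ys) = j"
  shows "\<psi> (xs @ (x + y) # ys) = \<psi> (xs @ x # ys) + \<psi> (xs @ y # ys)"
    "\<psi> (xs @ scale c x # ys) = c * \<psi> (xs @ x # ys)"
    "\<psi> (xs @ (\<Sum>i\<in>I. f i) # ys) = (\<Sum>i\<in>I. \<psi> (xs @ f i # ys))"
proof -
  have "length (xs @ 0 # ys) = j" "length xs < j" using assms(2) by auto
  then have "Vector_Spaces.linear scale (*) (\<lambda>x. \<psi> ((xs @ 0 # ys)[length xs := x]))"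
    using assms(1) unfolding multilinear_form_def by blast
  then have lin: "Vector_Spaces.linear scale (*) (\<lambda>x. \<psi> (xs @ x # ys))"
    by simp
  interpret l: Vector_Spaces.linear scale "(*)" "\<lambda>x. \<psi> (xs @ x # ys)" by (rule lin)
  show "\<psi> (xs @ (x + y) # ys) = \<psi> (xs @ x # ys) + \<psi> (xs @ y # ys)"
    "\<psi> (xs @ scale c x # ys) = c * \<psi> (xs @ x # ys)"
    "\<psi> (xs @ (\<Sum>i\<in>I. f i) # ys) = (\<Sum>i\<in>I. \<psi> (xs @ f i # ys))"
    by (rule l.add l.scale l.sum)+
qed

lemma multilinear_formI:
  assumes "\<And>xs i x y. length xs = j \<Longrightarrow> i < j \<Longrightarrow> \<psi> (xs[i := x + y]) = \<psi> (xs[i := x]) + \<psi> (xs[i := y])"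
    "\<And>xs i x c. length xs = j \<Longrightarrow> i < j \<Longrightarrow> \<psi> (xs[i := scale c x]) = c * \<psi> (xs[i := x])"
  shows "multilinear_form scale j \<psi>"
  unfolding multilinear_form_def using assms by (simp add: linear_scalar_iff vector_space_axioms)

lemma multilinear_formD:
  assumes "multilinear_form scale j \<psi>" "length xs = j" "i < j"
  shows "\<psi> (xs[i := x + y]) = \<psi> (xs[i := x]) + \<psi> (xs[i := y])" "\<psi> (xs[i := scale c x]) = c * \<psi> (xs[i := x])"
  using assms unfolding multilinear_form_def by (simp_all add: linear_scalar_iff vector_space_axioms)

lemma multilinear_form_zero: "multilinear_form scale j (\<lambda>_. 0)"
  by (rule multilinear_formI) simp_all

lemma multilinear_form_add:
  "multilinear_form scale j \<psi> \<Longrightarrow> multilinear_form scale j \<eta> \<Longrightarrow> multilinear_form scale j (\<lambda>xs. \<psi> xs + \<eta> xs)"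
  by (rule multilinear_formI) (simp_all add: multilinear_formD algebra_simps)

lemma multilinear_form_cmult:
  "multilinear_form scale j \<psi> \<Longrightarrow> multilinear_form scale j (\<lambda>xs. c * \<psi> xs)"
  by (rule multilinear_formI) (simp_all add: multilinear_formD algebra_simps)

lemma multilinear_form_sum:
  "(\<And>l. l \<in> L \<Longrightarrow> multilinear_form scale j (\<psi> l)) \<Longrightarrow> multilinear_form scale j (\<lambda>xs. \<Sum>l\<in>L. \<psi> l xs)"
  by (induction L rule: infinite_finite_induct) (simp_all add: multilinear_form_zero multilinear_form_add)

lemma alg_poly_zero: "alg_poly n (\<lambda>_. 0)"
  unfolding alg_poly_def by (rule exI[of _ "\<lambda>_ _. 0"]) (simp add: multilinear_form_zero)

lemma alg_poly_add: "alg_poly n \<phi> \<Longrightarrow> alg_poly n \<eta> \<Longrightarrow> alg_poly n (\<lambda>x. \<phi> x + \<eta> x)"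
  unfolding alg_poly_def
proof (elim exE conjE)
  fix \<psi> \<omega>
  assume *: "\<forall>j<n. multilinear_form scale j (\<psi> j)" "\<forall>j<n. multilinear_form scale j (\<omega> j)"
    "\<forall>x. \<phi> x = (\<Sum>j<n. \<psi> j (replicate j x))" "\<forall>x. \<eta> x = (\<Sum>j<n. \<omega> j (replicate j x))"
  show "\<exists>\<psi>. (\<forall>j<n. multilinear_form scale j (\<psi> j)) \<and> (\<forall>x. \<phi> x + \<eta> x = (\<Sum>j<n. \<psi> j (replicate j x)))"
    using * by (intro exI[of _ "\<lambda>j xs. \<psi> j xs + \<omega> j xs"]) (simp add: multilinear_form_add sum.distrib)
qed

lemma alg_poly_cmult: "alg_poly n \<phi> \<Longrightarrow> alg_poly n (\<lambda>x. c * \<phi> x)"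
  unfolding alg_poly_def
proof (elim exE conjE)
  fix \<psi>
  assume *: "\<forall>j<n. multilinear_form scale j (\<psi> j)" "\<forall>x. \<phi> x = (\<Sum>j<n. \<psi> j (replicate j x))"
  show "\<exists>\<psi>. (\<forall>j<n. multilinear_form scale j (\<psi> j)) \<and> (\<forall>x. c * \<phi> x = (\<Sum>j<n. \<psi> j (replicate j x)))"
    using * by (intro exI[of _ "\<lambda>j xs. c * \<psi> j xs"]) (simp add: multilinear_form_cmult sum_distrib_left)
qed

lemma alg_poly_sum: "(\<And>l. l \<in> L \<Longrightarrow> alg_poly n (\<phi> l)) \<Longrightarrow> alg_poly n (\<lambda>x. \<Sum>l\<in>L. \<phi> l x)"
  by (induction L rule: infinite_finite_induct) (simp_all add: alg_poly_zero alg_poly_add)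

lemma alg_poly_form:
  assumes "multilinear_form scale j \<psi>" "j < n" shows "alg_poly n (\<lambda>x. \<psi> (replicate j x))"
  unfolding alg_poly_def
proof (intro exI conjI allI impI)
  fix k show "multilinear_form scale k ((\<lambda>k xs. if k = j then \<psi> xs else 0) k)"
    using assms by (cases "k = j") (auto simp: multilinear_form_zero)
  fix x show "\<psi> (replicate j x) = (\<Sum>k<n. (\<lambda>k xs. if k = j then \<psi> xs else 0) k (replicate k x))"
    using assms(2) by (simp add: sum.delta)
qed

definition poly_curve :: "nat \<Rightarrow> ('a \<Rightarrow> 'b) \<Rightarrow> bool" where
  "poly_curve m u \<longleftrightarrow> (\<exists>c. \<forall>t. u t = (\<Sum>i\<le>m. scale (t ^ i) (c i)))"

lemma poly_curve_const: "poly_curve m (\<lambda>_. x)"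
  unfolding poly_curve_def
proof (intro exI allI)
  fix t :: 'a
  have "(\<Sum>i\<le>m. scale (t ^ i) (if i = 0 then x else 0)) = (\<Sum>i\<le>m. if i = 0 then x else 0)"
    by (intro sum.cong) auto
  then show "x = (\<Sum>i\<le>m. scale (t ^ i) ((\<lambda>i. if i = 0 then x else 0) i))" by simp
qed

lemma poly_curve_affine: "poly_curve 1 (\<lambda>t. x + scale t y)"
  unfolding poly_curve_def
  by (rule exI[of _ "\<lambda>i. if i = 0 then x else y"]) simp

lemma poly_curve_mono:
  assumes "poly_curve m u" "m \<le> n" shows "poly_curve n u"
proof -
  obtain c where c: "\<And>t. u t = (\<Sum>i\<le>m. scale (t ^ i) (c i))"
    using assms(1) by (auto simp: poly_curve_def)
  have "(\<Sum>i\<le>n. scale (t ^ i) (if i \<le> m then c i else 0)) = (\<Sum>i\<le>m. scale (t ^ i) (c i))" for t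
    using assms(2) by (intro sum.mono_neutral_cong_right) auto
  with c show ?thesis
    unfolding poly_curve_def by (intro exI[of _ "\<lambda>i. if i \<le> m then c i else 0"]) simp
qed

lemma poly_curve_add: "poly_curve m u \<Longrightarrow> poly_curve m v \<Longrightarrow> poly_curve m (\<lambda>t. u t + v t)"
  unfolding poly_curve_def
proof (elim exE)
  fix c d assume "\<forall>t. u t = (\<Sum>i\<le>m. scale (t ^ i) (c i))" "\<forall>t. v t = (\<Sum>i\<le>m. scale (t ^ i) (d i))"
  then show "\<exists>c. \<forall>t. u t + v t = (\<Sum>i\<le>m. scale (t ^ i) (c i))"
    by (intro exI[of _ "\<lambda>i. c i + d i"]) (simp add: scale_right_distrib sum.distrib)
qed

lemma poly_curve_scale: "poly_curve m u \<Longrightarrow> poly_curve m (\<lambda>t. scale a (u t))"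
  unfolding poly_curve_def
proof (elim exE)
  fix c assume "\<forall>t. u t = (\<Sum>i\<le>m. scale (t ^ i) (c i))"
  then show "\<exists>c. \<forall>t. scale a (u t) = (\<Sum>i\<le>m. scale (t ^ i) (c i))"
    by (intro exI[of _ "\<lambda>i. scale a (c i)"]) (simp add: scale_sum_right mult.commute)
qed

lemma poly_curve_sum: "(\<And>l. l \<in> L \<Longrightarrow> poly_curve m (u l)) \<Longrightarrow> poly_curve m (\<lambda>t. \<Sum>l\<in>L. u l t)"
  by (induction L rule: infinite_finite_induct) (simp_all add: poly_curve_const poly_curve_add)

lemma poly_curve_bilinear:
  assumes add: "\<And>x y z. B (x + y) z = B x z + B y z" "\<And>x y z. B x (y + z) = B x y + B x z"
    and sc: "\<And>a x z. B (scale a x) z = scale a (B x z)" "\<And>a x z. B x (scale a z) = scale a (B x z)"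
    and u: "poly_curve m u" and v: "poly_curve n v"
  shows "poly_curve (m + n) (\<lambda>t. B (u t) (v t))"
proof -
  obtain c d where c: "\<And>t. u t = (\<Sum>i\<le>m. scale (t ^ i) (c i))" and d: "\<And>t. v t = (\<Sum>i\<le>n. scale (t ^ i) (d i))"
    using u v by (auto simp: poly_curve_def)
  have B0: "B 0 z = 0" "B x 0 = 0" for x z
    using add(1)[of 0 0 z] add(2)[of x 0 0] by simp_all
  have Bs: "B (sum f I) z = (\<Sum>i\<in>I. B (f i) z)" "B x (sum f I) = (\<Sum>i\<in>I. B x (f i))" for f and I :: "nat set" and x z
    by (induction I rule: infinite_finite_induct) (simp_all add: B0 add)
  have "poly_curve (m + n) (\<lambda>t. scale (t ^ (i + j)) (B (c i) (d j)))" if "i \<le> m" "j \<le> n" for i j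
    unfolding poly_curve_def
  proof (intro exI allI)
    fix t
    have "(\<Sum>k\<le>m + n. scale (t ^ k) (if k = i + j then B (c i) (d j) else 0)) =
        (\<Sum>k\<le>m + n. if k = i + j then scale (t ^ (i + j)) (B (c i) (d j)) else 0)"
      by (intro sum.cong) auto
    then show "scale (t ^ (i + j)) (B (c i) (d j)) =
        (\<Sum>k\<le>m + n. scale (t ^ k) ((\<lambda>k. if k = i + j then B (c i) (d j) else 0) k))"
      using that by simp
  qed
  then have "poly_curve (m + n) (\<lambda>t. \<Sum>i\<le>m. \<Sum>j\<le>n. scale (t ^ (i + j)) (B (c i) (d j)))"
    by (intro poly_curve_sum) auto
  moreover have "B (u t) (v t) = (\<Sum>i\<le>m. \<Sum>j\<le>n. scale (t ^ (i + j)) (B (c i) (d j)))" for t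
  proof -
    have "B (u t) (v t) = (\<Sum>i\<le>m. scale (t ^ i) (B (c i) (v t)))"
      by (simp add: c Bs(1) sc)
    moreover have "B (c i) (v t) = (\<Sum>j\<le>n. scale (t ^ j) (B (c i) (d j)))" for i
      by (simp add: d Bs(2) sc)
    ultimately show ?thesis by (simp add: scale_sum_right power_add)
  qed
  ultimately show ?thesis by simp
qed

text \<open>The slots occupied by the curve are expanded one after the other; the list
  \<open>xs\<close> collects the coefficient vectors already inserted.\<close>

lemma poly_fun_form_curve:
  assumes u: "poly_curve m u" and \<psi>: "multilinear_form scale j \<psi>" and "k + length xs = j"
  shows "poly_fun (k * m) (\<lambda>t. \<psi> (replicate k (u t) @ xs))"
  using assms(3)
proof (induction k arbitrary: xs)
  case 0
  then show ?case by (simp add: poly_fun_const)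
next
  case (Suc k)
  obtain c where c: "\<And>t. u t = (\<Sum>i\<le>m. scale (t ^ i) (c i))"
    using u by (auto simp: poly_curve_def)
  have eq: "\<psi> (replicate (Suc k) (u t) @ xs) = (\<Sum>i\<le>m. t ^ i * \<psi> (replicate k (u t) @ c i # xs))" for t
  proof -
    have len: "length (replicate k (u t)) + Suc (length xs) = j" using Suc.prems by simp
    have "replicate (Suc k) (u t) @ xs = replicate k (u t) @ u t # xs"
      by (simp add: replicate_app_Cons_same)
    also have "u t = (\<Sum>i\<le>m. scale (t ^ i) (c i))" by (rule c)
    finally have "\<psi> (replicate (Suc k) (u t) @ xs) = \<psi> (replicate k (u t) @ (\<Sum>i\<le>m. scale (t ^ i) (c i)) # xs)"
      by (simp only: c[symmetric])
    also have "\<dots> = (\<Sum>i\<le>m. t ^ i * \<psi> (replicate k (u t) @ c i # xs))"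
      unfolding multilinear_form_slot(3)[OF \<psi> len] multilinear_form_slot(2)[OF \<psi> len] ..
    finally show ?thesis .
  qed
  show ?case
    unfolding eq using Suc.prems by (intro poly_fun_sum poly_fun_power[OF Suc.IH]) auto
qed

lemma poly_fun_alg_poly_curve:
  assumes "poly_curve m u" "alg_poly (Suc n) \<phi>"
  shows "poly_fun (n * m) (\<lambda>t. \<phi> (u t))"
proof -
  obtain \<psi> where \<psi>: "\<And>j. j < Suc n \<Longrightarrow> multilinear_form scale j (\<psi> j)" "\<And>x. \<phi> x = (\<Sum>j<Suc n. \<psi> j (replicate j x))"
    using assms(2) unfolding alg_poly_def by blast
  have "poly_fun (n * m) (\<lambda>t. \<psi> j (replicate j (u t)))" if "j < Suc n" for j
  proof (rule poly_fun_mono)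
    show "poly_fun (j * m) (\<lambda>t. \<psi> j (replicate j (u t)))"
      using poly_fun_form_curve[OF assms(1) \<psi>(1)[OF that], of j "[]"] by simp
    show "j * m \<le> n * m" using that by simp
  qed
  then show ?thesis
    unfolding \<psi>(2) by (intro poly_fun_sum) simp
qed

end

text \<open>Passing to complements turns the sum into the expansion of (1 - 1)^|U - T|.\<close>

lemma sum_alternating_supersets:
  assumes U: "finite U" and T: "T \<subseteq> U"
  shows "(\<Sum>S\<in>{S. T \<subseteq> S \<and> S \<subseteq> U}. (- 1) ^ (card U - card S)) = (if T = U then 1 else (0::'a::comm_ring_1))"
proof -
  have "(\<Sum>S\<in>{S. T \<subseteq> S \<and> S \<subseteq> U}. (- 1) ^ (card U - card S)) = (\<Sum>R\<in>Pow (U - T). (- 1 :: 'a) ^ card R)"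
  proof (rule sum.reindex_bij_witness[of _ "\<lambda>R. U - R" "\<lambda>S. U - S"])
    fix S assume "S \<in> {S. T \<subseteq> S \<and> S \<subseteq> U}"
    then have S: "T \<subseteq> S" "S \<subseteq> U" by auto
    show "U - (U - S) = S" "U - S \<in> Pow (U - T)" using S by auto
    show "(- 1) ^ card (U - S) = (- 1 :: 'a) ^ (card U - card S)"
      using card_Diff_subset[OF finite_subset[OF S(2) U] S(2)] by simp
  qed (use T in auto)
  also have "\<dots> = (\<Prod>x\<in>U - T. - 1 + 1)"
    using U by (subst prod_add) simp_all
  also have "\<dots> = (if T = U then 1 else 0)"
  proof (cases "T = U")
    case False
    then have "U - T \<noteq> {}" using T by auto
    then have "card (U - T) > 0" using U by (simp add: card_gt_0_iff)
    then show ?thesis using False by (simp add: zero_power)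
  qed simp
  finally show ?thesis .
qed

section \<open>Polarization and closedness under pointwise limits\<close>

locale normed_scalar_space = scalar_space scale
  for scale :: "'a::real_normed_field \<Rightarrow> 'b::ab_group_add \<Rightarrow> 'b"
begin

lemma multilinear_form_expand:
  assumes \<psi>: "multilinear_form scale j \<psi>" and S: "finite S" and "length xs + k = j"
  shows "\<psi> (xs @ replicate k (\<Sum>s\<in>S. h s)) = (\<Sum>ls\<in>{ls. set ls \<subseteq> S \<and> length ls = k}. \<psi> (xs @ map h ls))"
  using assms(3)
proof (induction k arbitrary: xs)
  case 0
  have "{ls. set ls \<subseteq> S \<and> length ls = 0} = {[]}" by auto
  then show ?case by simp
next
  case (Suc k)
  let ?L = "\<lambda>k. {ls. set ls \<subseteq> S \<and> length ls = k}"
  have bij: "bij_betw (\<lambda>(x, ls). x # ls) (S \<times> ?L k) (?L (Suc k))"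
    by (rule bij_betwI[where g = "\<lambda>p. (hd p, tl p)"]) (auto simp: length_Suc_conv)
  have len: "length xs + Suc (length (replicate k (\<Sum>s\<in>S. h s))) = j" using Suc.prems by simp
  have IH: "\<psi> (xs @ h s # replicate k (\<Sum>s\<in>S. h s)) = (\<Sum>ls\<in>?L k. \<psi> (xs @ map h (s # ls)))" for s
    using Suc.IH[of "xs @ [h s]"] Suc.prems by simp
  have "\<psi> (xs @ replicate (Suc k) (\<Sum>s\<in>S. h s)) = (\<Sum>s\<in>S. \<psi> (xs @ h s # replicate k (\<Sum>s\<in>S. h s)))"
    unfolding replicate_Suc by (rule multilinear_form_slot(3)[OF \<psi> len])
  also have "\<dots> = (\<Sum>(s, ls)\<in>S \<times> ?L k. \<psi> (xs @ map h (s # ls)))"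
    unfolding IH by (rule sum.cartesian_product)
  also have "\<dots> = (\<Sum>ls\<in>?L (Suc k). \<psi> (xs @ map h ls))"
    unfolding sum.reindex_bij_betw[OF bij, symmetric] by (rule sum.cong) auto
  finally show ?case .
qed

text \<open>The iterated finite difference of \<open>\<phi>\<close> at 0 in the directions
  \<open>hs\<close>; it involves only finitely many values of \<open>\<phi>\<close>.\<close>

definition polarization :: "nat \<Rightarrow> ('b \<Rightarrow> 'a) \<Rightarrow> 'b list \<Rightarrow> 'a" where
  "polarization m \<phi> hs = (\<Sum>S\<in>Pow {..<m}. (- 1) ^ (m - card S) * \<phi> (\<Sum>s\<in>S. hs ! s))"

definition index_perms :: "nat \<Rightarrow> nat list set" where
  "index_perms m = {ls. set ls = {..<m} \<and> length ls = m}"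

lemma finite_index_perms: "finite (index_perms m)" and card_index_perms: "card (index_perms m) \<noteq> 0"
proof -
  have "index_perms m \<subseteq> {ls. set ls \<subseteq> {..<m} \<and> length ls = m}" by (auto simp: index_perms_def)
  then show fin: "finite (index_perms m)"
    by (rule finite_subset) (simp add: finite_lists_length_eq)
  have "[0..<m] \<in> index_perms m" by (auto simp: index_perms_def)
  with fin show "card (index_perms m) \<noteq> 0" by auto
qed

text \<open>After multilinear expansion a list of indices is weighted by the signs of all
  \<open>S\<close> containing its entries, so only lists hitting every index survive. With
  \<open>j \<le> m\<close> entries this forces \<open>j = m\<close> and a permutation.\<close>

lemma polarization_form:
  assumes \<psi>: "multilinear_form scale j \<psi>" and "j \<le> m"
  shows "polarization m (\<lambda>x. \<psi> (replicate j x)) hs =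
    (if j = m then (\<Sum>ls\<in>index_perms m. \<psi> (map ((!) hs) ls)) else 0)"
proof -
  let ?L = "\<lambda>S. {ls. set ls \<subseteq> S \<and> length ls = j}"
  have finL: "finite (?L {..<m})" by (rule finite_lists_length_eq) simp
  have "polarization m (\<lambda>x. \<psi> (replicate j x)) hs =
      (\<Sum>S\<in>Pow {..<m}. (- 1) ^ (m - card S) * (\<Sum>ls\<in>?L S. \<psi> (map ((!) hs) ls)))"
    unfolding polarization_def
  proof (intro sum.cong refl)
    fix S assume "S \<in> Pow {..<m}"
    then have "finite S" by (auto intro: finite_subset)
    then show "(- 1) ^ (m - card S) * \<psi> (replicate j (\<Sum>s\<in>S. hs ! s)) =
        (- 1) ^ (m - card S) * (\<Sum>ls\<in>?L S. \<psi> (map ((!) hs) ls))"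
      using multilinear_form_expand[OF \<psi>, of S "[]" j "(!) hs"] by simp
  qed
  also have "\<dots> = (\<Sum>S\<in>Pow {..<m}. \<Sum>ls\<in>?L {..<m}. if set ls \<subseteq> S then (- 1) ^ (m - card S) * \<psi> (map ((!) hs) ls) else 0)"
  proof (intro sum.cong refl)
    fix S assume S: "S \<in> Pow {..<m}"
    have "?L {..<m} \<inter> {ls. set ls \<subseteq> S} = ?L S" using S by auto
    then show "(- 1) ^ (m - card S) * (\<Sum>ls\<in>?L S. \<psi> (map ((!) hs) ls)) =
        (\<Sum>ls\<in>?L {..<m}. if set ls \<subseteq> S then (- 1) ^ (m - card S) * \<psi> (map ((!) hs) ls) else 0)"
      using finL by (simp add: sum.If_cases sum_distrib_left)
  qed
  also have "\<dots> = (\<Sum>ls\<in>?L {..<m}. \<Sum>S\<in>Pow {..<m}. if set ls \<subseteq> S then (- 1) ^ (m - card S) * \<psi> (map ((!) hs) ls) else 0)"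
    by (rule sum.swap)
  also have "\<dots> = (\<Sum>ls\<in>?L {..<m}. if set ls = {..<m} then \<psi> (map ((!) hs) ls) else 0)"
  proof (intro sum.cong refl)
    fix ls assume ls: "ls \<in> ?L {..<m}"
    have eq: "Pow {..<m} \<inter> {S. set ls \<subseteq> S} = {S. set ls \<subseteq> S \<and> S \<subseteq> {..<m}}" by auto
    have "(\<Sum>S\<in>Pow {..<m}. if set ls \<subseteq> S then (- 1) ^ (m - card S) * \<psi> (map ((!) hs) ls) else 0) =
        (\<Sum>S\<in>{S. set ls \<subseteq> S \<and> S \<subseteq> {..<m}}. (- 1) ^ (card {..<m} - card S)) * \<psi> (map ((!) hs) ls)"
      by (simp add: sum.If_cases eq sum_distrib_right)
    also have "\<dots> = (if set ls = {..<m} then \<psi> (map ((!) hs) ls) else 0)"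
      using ls by (subst sum_alternating_supersets) auto
    finally show "(\<Sum>S\<in>Pow {..<m}. if set ls \<subseteq> S then (- 1) ^ (m - card S) * \<psi> (map ((!) hs) ls) else 0) =
        (if set ls = {..<m} then \<psi> (map ((!) hs) ls) else 0)" .
  qed
  also have "\<dots> = (if j = m then (\<Sum>ls\<in>index_perms m. \<psi> (map ((!) hs) ls)) else 0)"
  proof (cases "j = m")
    case True
    have "?L {..<m} \<inter> {ls. set ls = {..<m}} = index_perms m"
      using True by (auto simp: index_perms_def)
    then show ?thesis using finL True by (simp add: sum.If_cases)
  next
    case False
    have "set ls \<noteq> {..<m}" if "ls \<in> ?L {..<m}" for ls
    proof
      assume "set ls = {..<m}"
      then have "m = card (set ls)" by simp
      with card_length[of ls] that False assms(2) show False by simp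
    qed
    then have "(\<Sum>ls\<in>?L {..<m}. if set ls = {..<m} then \<psi> (map ((!) hs) ls) else 0) = 0"
      by (intro sum.neutral) simp
    then show ?thesis using False by simp
  qed
  finally show ?thesis .
qed

text \<open>Changing argument \<open>i\<close> changes exactly one entry of the permuted list,
  namely at the position of \<open>i\<close> in \<open>ls\<close>.\<close>

lemma multilinear_form_perm:
  assumes \<psi>: "multilinear_form scale m \<psi>" and ls: "ls \<in> index_perms m"
  shows "multilinear_form scale m (\<lambda>hs. \<psi> (map ((!) hs) ls))"
proof -
  have ls': "set ls = {..<m}" "length ls = m" using ls by (auto simp: index_perms_def)
  then have "distinct ls" by (intro card_distinct) simp
  have upd: "\<exists>k<m. \<forall>z. map ((!) (xs[i := z])) ls = (map ((!) xs) ls)[k := z]"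
    if "length xs = m" "i < m" for xs :: "'b list" and i
  proof -
    from that ls'(1) have "i \<in> set ls" by simp
    then obtain k where k: "k < m" "ls ! k = i" unfolding in_set_conv_nth ls'(2) by blast
    have "map ((!) (xs[i := z])) ls = (map ((!) xs) ls)[k := z]" for z
    proof (rule nth_equalityI)
      fix l assume "l < length (map ((!) (xs[i := z])) ls)"
      then have l: "l < m" using ls' by simp
      then have "ls ! l = i \<longleftrightarrow> l = k"
        using k ls'(2) nth_eq_iff_index_eq[OF \<open>distinct ls\<close>, of l k] by simp
      then show "map ((!) (xs[i := z])) ls ! l = (map ((!) xs) ls)[k := z] ! l"
        using l ls' that k by (cases "l = k") auto
    qed simp
    with k show ?thesis by blast
  qed
  show ?thesis
  proof (rule multilinear_formI)
    fix xs :: "'b list" and i x y assume xs: "length xs = m" "i < m"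
    obtain k where k: "k < m" "\<And>z. map ((!) (xs[i := z])) ls = (map ((!) xs) ls)[k := z]"
      using upd[OF xs] by blast
    show "\<psi> (map ((!) (xs[i := x + y])) ls) = \<psi> (map ((!) (xs[i := x])) ls) + \<psi> (map ((!) (xs[i := y])) ls)"
      unfolding k(2) using ls' k(1) by (intro multilinear_formD(1)[OF \<psi>]) simp_all
  next
    fix xs :: "'b list" and i x c assume xs: "length xs = m" "i < m"
    obtain k where k: "k < m" "\<And>z. map ((!) (xs[i := z])) ls = (map ((!) xs) ls)[k := z]"
      using upd[OF xs] by blast
    show "\<psi> (map ((!) (xs[i := scale c x])) ls) = c * \<psi> (map ((!) (xs[i := x])) ls)"
      unfolding k(2) using ls' k(1) by (intro multilinear_formD(2)[OF \<psi>]) simp_all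
  qed
qed

definition top_form :: "nat \<Rightarrow> ('b \<Rightarrow> 'a) \<Rightarrow> 'b list \<Rightarrow> 'a" where
  "top_form m \<phi> hs = inverse (of_nat (card (index_perms m))) * polarization m \<phi> hs"

lemma polarization_sum:
  "polarization m (\<lambda>x. \<Sum>j\<in>J. f j x) hs = (\<Sum>j\<in>J. polarization m (f j) hs)"
  unfolding polarization_def sum_distrib_left by (rule sum.swap)

text \<open>\<open>top_form\<close> is the symmetrization of the form of degree \<open>m\<close>: it
  may differ from \<open>\<psi> m\<close>, but agrees with it on the diagonal, which is all that
  \<open>\<phi>\<close> sees.\<close>

lemma top_form_alg_poly:
  assumes \<psi>: "\<And>j. j < Suc m \<Longrightarrow> multilinear_form scale j (\<psi> j)"
    and \<phi>: "\<And>x. \<phi> x = (\<Sum>j<Suc m. \<psi> j (replicate j x))"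
  shows "multilinear_form scale m (top_form m \<phi>)" "top_form m \<phi> (replicate m x) = \<psi> m (replicate m x)"
proof -
  have \<phi>': "\<phi> = (\<lambda>x. \<Sum>j<Suc m. \<psi> j (replicate j x))" using \<phi> by (rule ext)
  have pol: "polarization m \<phi> hs = (\<Sum>ls\<in>index_perms m. \<psi> m (map ((!) hs) ls))" for hs
  proof -
    have "polarization m \<phi> hs = (\<Sum>j<Suc m. polarization m (\<lambda>x. \<psi> j (replicate j x)) hs)"
      unfolding \<phi>' by (rule polarization_sum)
    also have "\<dots> = (\<Sum>j<Suc m. if j = m then (\<Sum>ls\<in>index_perms m. \<psi> m (map ((!) hs) ls)) else 0)"
    proof (intro sum.cong refl)
      fix j assume "j \<in> {..<Suc m}"
      then have j: "j < Suc m" "j \<le> m" by auto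
      show "polarization m (\<lambda>x. \<psi> j (replicate j x)) hs =
          (if j = m then (\<Sum>ls\<in>index_perms m. \<psi> m (map ((!) hs) ls)) else 0)"
        unfolding polarization_form[OF \<psi>[OF j(1)] j(2)] by simp
    qed
    also have "\<dots> = (\<Sum>ls\<in>index_perms m. \<psi> m (map ((!) hs) ls))" by simp
    finally show ?thesis .
  qed
  have top: "top_form m \<phi> = (\<lambda>hs. inverse (of_nat (card (index_perms m))) * (\<Sum>ls\<in>index_perms m. \<psi> m (map ((!) hs) ls)))"
    by (rule ext) (simp only: top_form_def pol)
  show "multilinear_form scale m (top_form m \<phi>)"
    unfolding top using \<psi>[of m]
    by (intro multilinear_form_cmult multilinear_form_sum multilinear_form_perm) simp_all
  have "map ((!) (replicate m x)) ls = replicate m x" if "ls \<in> index_perms m" for ls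
  proof -
    have ls: "set ls = {..<m}" "length ls = m" using that by (simp_all add: index_perms_def)
    have "map ((!) (replicate m x)) ls = map (\<lambda>_. x) ls"
      using ls(1) by (intro map_cong refl nth_replicate) simp
    then show ?thesis by (simp add: map_replicate_const ls(2))
  qed
  then have "(\<Sum>ls\<in>index_perms m. \<psi> m (map ((!) (replicate m x)) ls)) =
      of_nat (card (index_perms m)) * \<psi> m (replicate m x)" by simp
  then show "top_form m \<phi> (replicate m x) = \<psi> m (replicate m x)"
    unfolding top using card_index_perms[of m] by simp
qed

text \<open>Replaces the existentially quantified form of top degree by an explicit combination of
  values of \<open>\<phi>\<close>, so that being polynomial becomes a system of equations in these
  values.\<close>

lemma alg_poly_Suc_iff:
  "alg_poly (Suc m) \<phi> \<longleftrightarrow>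
    multilinear_form scale m (top_form m \<phi>) \<and> alg_poly m (\<lambda>x. \<phi> x - top_form m \<phi> (replicate m x))"
proof
  assume "alg_poly (Suc m) \<phi>"
  then obtain \<psi> where \<psi>: "\<And>j. j < Suc m \<Longrightarrow> multilinear_form scale j (\<psi> j)"
    "\<And>x. \<phi> x = (\<Sum>j<Suc m. \<psi> j (replicate j x))"
    unfolding alg_poly_def by blast
  have "alg_poly m (\<lambda>x. \<phi> x - top_form m \<phi> (replicate m x))"
    unfolding alg_poly_def
  proof (intro exI conjI allI impI)
    fix x
    show "\<phi> x - top_form m \<phi> (replicate m x) = (\<Sum>j<m. \<psi> j (replicate j x))"
      using top_form_alg_poly(2)[where \<psi> = \<psi>, OF \<psi>, of x] \<psi>(2)[of x] by simp
  qed (simp add: \<psi>(1))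
  with top_form_alg_poly(1)[where \<psi> = \<psi>, OF \<psi>]
  show "multilinear_form scale m (top_form m \<phi>) \<and> alg_poly m (\<lambda>x. \<phi> x - top_form m \<phi> (replicate m x))" ..
next
  assume "multilinear_form scale m (top_form m \<phi>) \<and> alg_poly m (\<lambda>x. \<phi> x - top_form m \<phi> (replicate m x))"
  then obtain \<psi> where \<psi>: "multilinear_form scale m (top_form m \<phi>)"
    "\<And>j. j < m \<Longrightarrow> multilinear_form scale j (\<psi> j)"
    "\<And>x. \<phi> x - top_form m \<phi> (replicate m x) = (\<Sum>j<m. \<psi> j (replicate j x))"
    unfolding alg_poly_def by blast
  show "alg_poly (Suc m) \<phi>"
    unfolding alg_poly_def
  proof (intro exI conjI allI impI)
    fix j assume "j < Suc m"
    then show "multilinear_form scale j ((\<psi>(m := top_form m \<phi>)) j)"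
      using \<psi>(1,2) by (cases "j = m") auto
  next
    fix x
    have "\<phi> x = (\<Sum>j<m. \<psi> j (replicate j x)) + top_form m \<phi> (replicate m x)"
      using \<psi>(3)[of x] by (simp add: algebra_simps)
    then show "\<phi> x = (\<Sum>j<Suc m. (\<psi>(m := top_form m \<phi>)) j (replicate j x))" by simp
  qed
qed

lemma continuous_top_form: "continuous_on UNIV (\<lambda>\<phi>. top_form m \<phi> hs)"
  unfolding top_form_def polarization_def by (intro continuous_intros continuous_on_product_coordinates)

text \<open>Closedness is meant in the topology of pointwise convergence: multilinearity of the top
  form consists of equations between continuous functions of \<phi>, and the rest follows by
  induction on the degree.\<close>

lemma closed_alg_poly: "closed {\<phi>. alg_poly n \<phi>}"
proof (induction n)
  case 0
  have "{\<phi>. alg_poly 0 \<phi>} = (\<Inter>x. {\<phi>. \<phi> x = 0})" by (auto simp: alg_poly_def)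
  moreover have "closed {\<phi> :: 'b \<Rightarrow> 'a. \<phi> x = 0}" for x
    by (intro closed_Collect_eq continuous_intros continuous_on_product_coordinates)
  ultimately show ?case by auto
next
  case (Suc m)
  let ?D = "{(xs :: 'b list, i). length xs = m \<and> i < m}"
  have "{\<phi>. multilinear_form scale m (top_form m \<phi>)} =
      (\<Inter>(xs, i)\<in>?D. \<Inter>x. \<Inter>y. \<Inter>c. {\<phi>. top_form m \<phi> (xs[i := x + y]) = top_form m \<phi> (xs[i := x]) + top_form m \<phi> (xs[i := y])}
        \<inter> {\<phi>. top_form m \<phi> (xs[i := scale c x]) = c * top_form m \<phi> (xs[i := x])})" (is "_ = ?R")
    by (auto simp: multilinear_form_def linear_scalar_iff vector_space_axioms)
  moreover have "closed ?R"
    by (auto intro!: closed_INT closed_Int closed_Collect_eq continuous_intros continuous_top_form)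
  ultimately have 1: "closed {\<phi>. multilinear_form scale m (top_form m \<phi>)}" by simp
  have "continuous_on UNIV (\<lambda>\<phi> x. \<phi> x - top_form m \<phi> (replicate m x))"
    by (intro continuous_intros continuous_top_form continuous_on_product_coordinates)
  then have "closed ((\<lambda>\<phi> x. \<phi> x - top_form m \<phi> (replicate m x)) -` {\<phi>. alg_poly m \<phi>})"
    by (rule closed_vimage[OF Suc.IH])
  with 1 have "closed ({\<phi>. multilinear_form scale m (top_form m \<phi>)} \<inter>
      (\<lambda>\<phi> x. \<phi> x - top_form m \<phi> (replicate m x)) -` {\<phi>. alg_poly m \<phi>})" by (rule closed_Int)
  moreover have "{\<phi>. alg_poly (Suc m) \<phi>} = {\<phi>. multilinear_form scale m (top_form m \<phi>)} \<inter>
      (\<lambda>\<phi> x. \<phi> x - top_form m \<phi> (replicate m x)) -` {\<phi>. alg_poly m \<phi>}"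
    by (auto simp: alg_poly_Suc_iff)
  ultimately show ?case by simp
qed

end

text \<open>The polynomial \<open>p\<close> may come with a formal degree above \<open>d\<close>;
  equality as functions over an infinite field settles its coefficients.\<close>

lemma lagrange_coeff_eq:
  fixes f :: "'k::field_char_0 \<Rightarrow> 'k"
  assumes "poly_fun d f" "\<And>t. f t = poly p t"
  shows "(\<Sum>i\<le>d. lagrange_coeff d j i * f (of_nat i)) = coeff p j"
proof -
  obtain q where q: "degree q \<le> d" "f = poly q" using assms(1) by (auto simp: poly_fun_def)
  have "poly q = poly p" using q(2) assms(2) by (auto simp: fun_eq_iff)
  then have "q = p" by (simp only: poly_eq_poly_eq_iff)
  with coeff_lagrange[OF q(1), of j] q(2) show ?thesis by simp
qed

lemma coeff_1_double_sum:
  fixes b :: "nat \<Rightarrow> nat \<Rightarrow> 'k::field_char_0"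
  assumes "d \<ge> 1"
  shows "coeff (\<Sum>j\<le>d. \<Sum>l\<le>d. monom (b j l) (j + l)) 1 = b 1 0 + b 0 1"
proof -
  obtain e where d: "d = Suc e" using assms by (cases d) auto
  have "coeff (\<Sum>j\<le>d. \<Sum>l\<le>d. monom (b j l) (j + l)) 1 = (\<Sum>j\<le>d. \<Sum>l\<le>d. if j + l = 1 then b j l else 0)"
    by (simp only: coeff_sum coeff_monom)
  also have "\<dots> = (\<Sum>(j, l)\<in>{..d} \<times> {..d}. if j + l = 1 then b j l else 0)"
    by (rule sum.cartesian_product)
  also have "\<dots> = (\<Sum>(j, l)\<in>{(1, 0), (0, 1)}. if j + l = 1 then b j l else 0)"
  proof (rule sum.mono_neutral_right)
    show "\<forall>i\<in>{..d} \<times> {..d} - {(1, 0), (0, 1)}. (case i of (j, l) \<Rightarrow> if j + l = 1 then b j l else 0) = 0"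
      by (auto simp: add_is_1 split: if_splits)
  qed (use assms in auto)
  also have "\<dots> = b 1 0 + b 0 1" by simp
  finally show ?thesis .
qed

lemma lagrange_coeff_0:
  fixes f :: "'k::field_char_0 \<Rightarrow> 'k"
  assumes "poly_fun d f" shows "(\<Sum>i\<le>d. lagrange_coeff d 0 i * f (of_nat i)) = f 0"
proof -
  obtain q where q: "degree q \<le> d" "f = poly q" using assms(1) by (auto simp: poly_fun_def)
  with coeff_lagrange[OF q(1), of 0] show ?thesis by (simp add: poly_0_coeff_0)
qed

text \<open>The chain rule at 0 for q(t, t), in interpolated form: a function polynomial in each
  variable is jointly polynomial, and on the diagonal only two of its monomials are linear. It
  yields the additivity of d\<lambda>.\<close>

lemma lagrange_coeff_diagonal:
  fixes q :: "'k::field_char_0 \<Rightarrow> 'k \<Rightarrow> 'k"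
  assumes 1: "\<And>s. poly_fun d (\<lambda>t. q t s)" and 2: "\<And>t. poly_fun d (q t)"
    and diag: "poly_fun d (\<lambda>t. q t t)" and d: "d \<ge> 1"
  shows "(\<Sum>i\<le>d. lagrange_coeff d 1 i * q (of_nat i) (of_nat i)) =
    (\<Sum>i\<le>d. lagrange_coeff d 1 i * q (of_nat i) 0) + (\<Sum>i\<le>d. lagrange_coeff d 1 i * q 0 (of_nat i))"
proof -
  let ?a = "\<lambda>j i. lagrange_coeff d j i :: 'k"
  define b where "b j l = (\<Sum>i\<le>d. ?a j i * (\<Sum>k\<le>d. ?a l k * q (of_nat i) (of_nat k)))" for j l
  have "q t s = (\<Sum>j\<le>d. \<Sum>l\<le>d. b j l * (t ^ j * s ^ l))" for t s
  proof -
    have "q t s = (\<Sum>j\<le>d. (\<Sum>i\<le>d. ?a j i * q (of_nat i) s) * t ^ j)"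
      by (rule poly_fun_expand[OF 1])
    also have "\<dots> = (\<Sum>j\<le>d. (\<Sum>i\<le>d. ?a j i * (\<Sum>l\<le>d. (\<Sum>k\<le>d. ?a l k * q (of_nat i) (of_nat k)) * s ^ l)) * t ^ j)"
      by (simp only: poly_fun_expand[OF 2, of _ s, symmetric])
    also have "\<dots> = (\<Sum>j\<le>d. \<Sum>l\<le>d. b j l * (t ^ j * s ^ l))"
    proof (rule sum.cong[OF refl])
      fix j
      have "(\<Sum>i\<le>d. ?a j i * (\<Sum>l\<le>d. (\<Sum>k\<le>d. ?a l k * q (of_nat i) (of_nat k)) * s ^ l)) =
          (\<Sum>i\<le>d. \<Sum>l\<le>d. ?a j i * (\<Sum>k\<le>d. ?a l k * q (of_nat i) (of_nat k)) * s ^ l)"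
        by (rule sum.cong[OF refl], subst sum_distrib_left, rule sum.cong[OF refl], rule mult.assoc[symmetric])
      also have "\<dots> = (\<Sum>l\<le>d. b j l * s ^ l)"
        unfolding b_def by (subst sum.swap) (simp only: sum_distrib_right)
      finally show "(\<Sum>i\<le>d. ?a j i * (\<Sum>l\<le>d. (\<Sum>k\<le>d. ?a l k * q (of_nat i) (of_nat k)) * s ^ l)) * t ^ j =
          (\<Sum>l\<le>d. b j l * (t ^ j * s ^ l))"
        by (simp add: sum_distrib_left sum_distrib_right mult_ac)
    qed
    finally show ?thesis .
  qed
  then have "q t t = poly (\<Sum>j\<le>d. \<Sum>l\<le>d. monom (b j l) (j + l)) t" for t
    by (simp add: poly_sum poly_monom power_add)
  from lagrange_coeff_eq[OF diag this, of 1]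
  have "(\<Sum>i\<le>d. ?a 1 i * q (of_nat i) (of_nat i)) = b 1 0 + b 0 1"
    using coeff_1_double_sum[OF d, of b] by simp
  moreover have "b 1 0 = (\<Sum>i\<le>d. ?a 1 i * q (of_nat i) 0)"
    unfolding b_def by (simp only: lagrange_coeff_0[OF 2])
  moreover have "b 0 1 = (\<Sum>i\<le>d. ?a 1 i * q 0 (of_nat i))"
  proof -
    have "b 0 1 = (\<Sum>i\<le>d. \<Sum>k\<le>d. ?a 1 k * (?a 0 i * q (of_nat i) (of_nat k)))"
      unfolding b_def by (simp only: sum_distrib_left mult.left_commute)
    also have "\<dots> = (\<Sum>k\<le>d. ?a 1 k * (\<Sum>i\<le>d. ?a 0 i * q (of_nat i) (of_nat k)))"
      by (subst sum.swap) (simp only: sum_distrib_left)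
    also have "\<dots> = (\<Sum>k\<le>d. ?a 1 k * q 0 (of_nat k))"
      by (simp only: lagrange_coeff_0[OF 1])
    finally show ?thesis .
  qed
  ultimately show ?thesis by simp
qed

section \<open>Translations as polynomial functions\<close>

sublocale nilpotent_lc_lie_algebra \<subseteq> normed_scalar_space scl
  by unfold_locales

context nilpotent_lc_lie_algebra
begin

abbreviation gmult (infixl \<open>\<star>\<close> 70) where "x \<star> y \<equiv> bch scl bracket N x y"
abbreviation lam where "lam \<equiv> left_regular scl bracket N"

lemma bch_0_left [simp]: "0 \<star> x = x" and bch_0_right [simp]: "x \<star> 0 = x"
  by (simp_all add: bch_commuting)

lemma bch_minus_right [simp]: "x \<star> (- x) = 0" and bch_minus_left [simp]: "(- x) \<star> x = 0"
  by (simp_all add: bch_commuting bracket_self)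

lemma bch_scale_scale: "scl s x \<star> scl t x = scl (s + t) x"
  by (simp add: bch_commuting bracket_self scale_left_distrib)

lemma minus_bch: "- (x \<star> y) = (- y) \<star> (- x)"
proof -
  have "((- y) \<star> (- x)) \<star> (x \<star> y) = (- y) \<star> (((- x) \<star> x) \<star> y)"
    by (simp only: bch_assoc)
  then have 0: "((- y) \<star> (- x)) \<star> (x \<star> y) = 0" by simp
  have "(- y) \<star> (- x) = ((- y) \<star> (- x)) \<star> ((x \<star> y) \<star> (- (x \<star> y)))"
    by (simp only: bch_minus_right bch_0_right)
  also have "\<dots> = (((- y) \<star> (- x)) \<star> (x \<star> y)) \<star> (- (x \<star> y))"
    by (rule bch_assoc[symmetric])
  also have "\<dots> = 0 \<star> (- (x \<star> y))"
    by (simp only: 0)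
  finally show ?thesis by simp
qed

lemma lam_bch: "lam (x \<star> y) \<phi> = lam x (lam y \<phi>)"
  by (simp add: left_regular_def minus_bch bch_assoc)

lemma lam_0 [simp]: "lam 0 \<phi> = \<phi>"
  by (simp add: left_regular_def)

lemma lam_linear:
  "lam x (\<phi> + \<psi>) = lam x \<phi> + lam x \<psi>" "lam x (fun_scale c \<phi>) = fun_scale c (lam x \<phi>)"
  "lam x (\<phi> - \<psi>) = lam x \<phi> - lam x \<psi>"
  by (auto simp: left_regular_def fun_scale_def fun_eq_iff)

lemma poly_curve_nested:
  "(\<And>u. u \<in> set w \<Longrightarrow> poly_curve 1 u) \<Longrightarrow> poly_curve (length w) (\<lambda>t. nested_bracket bracket (map (\<lambda>u. u t) w))"
proof (induction w rule: induct_list012)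
  case (3 u v w)
  have "poly_curve (1 + length (v # w)) (\<lambda>t. bracket (u t) (nested_bracket bracket (map (\<lambda>u. u t) (v # w))))"
    using 3 by (intro poly_curve_bilinear) auto
  then show ?case by simp
qed (simp_all add: poly_curve_const)

text \<open>A Dynkin word has at most \<open>N\<close> letters, each affine in the
  parameter.\<close>

lemma poly_curve_bch:
  assumes "poly_curve 1 u" "poly_curve 1 v"
  shows "poly_curve N (\<lambda>t. u t \<star> v t)"
  unfolding bch_def
proof (intro poly_curve_sum poly_curve_scale)
  fix p assume p: "p \<in> dynkin_index N"
  have "dynkin_word (u t) (v t) p = map (\<lambda>f. f t) (dynkin_word u v p)" for t
    by (simp add: map_dynkin_word)
  moreover have "poly_curve (length (dynkin_word u v p)) (\<lambda>t. nested_bracket bracket (map (\<lambda>f. f t) (dynkin_word u v p)))"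
    using set_dynkin_word[of u v p] assms by (intro poly_curve_nested) auto
  ultimately show "poly_curve N (\<lambda>t. nested_bracket bracket (dynkin_word (u t) (v t) p))"
    using dynkin_index_bounds(5)[OF p] by (auto simp: length_dynkin_word intro: poly_curve_mono)
qed

lemma poly_curve_affine_minus: "poly_curve 1 (\<lambda>t. - (x + scl t y))"
  using poly_curve_affine[of "- x" "- y"] by (simp add: scale_minus_right)

text \<open>Origin of the degree \<open>N * N\<close>: a polynomial of degree at most
  \<open>N\<close> is evaluated along a curve of degree at most \<open>N\<close>.\<close>

lemma poly_fun_lam_shift:
  assumes "alg_poly (Suc N) \<phi>"
  shows "poly_fun (N * N) (\<lambda>t. lam (x + scl t v) \<phi> y)"
  unfolding left_regular_def
  using poly_fun_alg_poly_curve[OF poly_curve_bch[OF poly_curve_affine_minus poly_curve_const] assms] .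

lemma poly_fun_lam_scale:
  assumes "alg_poly (Suc N) \<phi>"
  shows "poly_fun (N * N) (\<lambda>t. lam x \<phi> (scl t y))"
  unfolding left_regular_def
  using poly_fun_alg_poly_curve[OF poly_curve_bch[OF poly_curve_const poly_curve_affine[of 0 y]] assms]
  by simp

definition multilinear_map :: "nat \<Rightarrow> ('g list \<Rightarrow> 'g) \<Rightarrow> bool" where
  "multilinear_map j \<psi> \<longleftrightarrow> (\<forall>xs i x y c. length xs = j \<longrightarrow> i < j \<longrightarrow>
     \<psi> (xs[i := x + y]) = \<psi> (xs[i := x]) + \<psi> (xs[i := y]) \<and> \<psi> (xs[i := scl c x]) = scl c (\<psi> (xs[i := x])))"

text \<open>The pattern lists the letters of a word in a constant and a variable; \<open>None\<close> stands for the variable.\<close>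

lemma nested_bracket_form:
  "\<exists>j \<psi>. j \<le> length w \<and> multilinear_map j \<psi> \<and>
     (\<forall>y. nested_bracket bracket (map (case_option y id) w) = \<psi> (replicate j y))"
proof (induction w rule: induct_list012)
  case 1
  show ?case
    by (intro exI[of _ 0] exI[of _ "\<lambda>_. 0"]) (simp add: multilinear_map_def)
next
  case (2 a)
  show ?case
  proof (cases a)
    case None
    then show ?thesis
      by (intro exI[of _ 1] exI[of _ "\<lambda>xs. xs ! 0"]) (simp add: multilinear_map_def)
  next
    case (Some x)
    then show ?thesis
      by (intro exI[of _ 0] exI[of _ "\<lambda>_. x"]) (simp add: multilinear_map_def)
  qed
next
  case (3 a b w)
  then obtain j \<psi> where \<psi>: "j \<le> length (b # w)" "multilinear_map j \<psi>"
    "\<And>y. nested_bracket bracket (map (case_option y id) (b # w)) = \<psi> (replicate j y)" by blast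
  show ?case
  proof (cases a)
    case None
    have "multilinear_map (Suc j) (\<lambda>xs. bracket (hd xs) (\<psi> (tl xs)))"
      unfolding multilinear_map_def
    proof (intro allI impI)
      fix xs :: "'g list" and i x y c assume "length xs = Suc j" "i < Suc j"
      then obtain z zs where z: "xs = z # zs" "length zs = j" by (cases xs) auto
      show "bracket (hd (xs[i := x + y])) (\<psi> (tl (xs[i := x + y]))) =
          bracket (hd (xs[i := x])) (\<psi> (tl (xs[i := x]))) + bracket (hd (xs[i := y])) (\<psi> (tl (xs[i := y]))) \<and>
        bracket (hd (xs[i := scl c x])) (\<psi> (tl (xs[i := scl c x]))) =
          scl c (bracket (hd (xs[i := x])) (\<psi> (tl (xs[i := x]))))"
        using \<psi>(2) z \<open>i < Suc j\<close> by (cases i) (auto simp: multilinear_map_def)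
    qed
    then show ?thesis
      using \<psi>(1,3) None by (intro exI[of _ "Suc j"] exI[of _ "\<lambda>xs. bracket (hd xs) (\<psi> (tl xs))"]) simp
  next
    case (Some x)
    have "multilinear_map j (\<lambda>xs. bracket x (\<psi> xs))"
      using \<psi>(2) by (simp add: multilinear_map_def)
    then show ?thesis
      using \<psi>(1,3) Some by (intro exI[of _ j] exI[of _ "\<lambda>xs. bracket x (\<psi> xs)"]) simp
  qed
qed

lemma dualD:
  assumes "\<xi> \<in> topological_dual scl"
  shows "\<xi> (x + y) = \<xi> x + \<xi> y" "\<xi> (scl c x) = c * \<xi> x" "\<xi> (- x) = - \<xi> x" "\<xi> 0 = 0"
    "\<xi> (sum f I) = (\<Sum>i\<in>I. \<xi> (f i))" "continuous_on UNIV \<xi>"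
proof -
  have lin: "Vector_Spaces.linear scl (*) \<xi>" and "continuous_on UNIV \<xi>"
    using assms by (auto simp: topological_dual_def)
  then show "continuous_on UNIV \<xi>" by simp
  interpret l: Vector_Spaces.linear scl "(*)" \<xi> by (rule lin)
  show "\<xi> (x + y) = \<xi> x + \<xi> y" "\<xi> (scl c x) = c * \<xi> x" "\<xi> (- x) = - \<xi> x" "\<xi> 0 = 0"
    "\<xi> (sum f I) = (\<Sum>i\<in>I. \<xi> (f i))"
    by (rule l.add l.scale l.neg l.zero l.sum)+
qed

text \<open>Each Dynkin word is multilinear in its occurrences of \<open>y\<close>, of which there
  are at most \<open>N\<close>.\<close>

lemma alg_poly_lam_dual:
  assumes \<xi>: "\<xi> \<in> topological_dual scl"
  shows "alg_poly (Suc N) (lam x \<xi>)"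
proof -
  have "alg_poly (Suc N) (\<lambda>y. \<xi> (nested_bracket bracket (dynkin_word (- x) y p)))" if p: "p \<in> dynkin_index N" for p
  proof -
    let ?w = "dynkin_word (Some (- x)) None p"
    obtain j \<psi> where \<psi>: "j \<le> length ?w" "multilinear_map j \<psi>"
      "\<And>y. nested_bracket bracket (map (case_option y id) ?w) = \<psi> (replicate j y)"
      using nested_bracket_form[of ?w] by blast
    have w: "dynkin_word (- x) y p = map (case_option y id) ?w" for y
      by (simp add: map_dynkin_word)
    have "multilinear_form scl j (\<lambda>xs. \<xi> (\<psi> xs))"
      using \<psi>(2) by (intro multilinear_formI) (simp_all add: multilinear_map_def dualD[OF \<xi>])
    moreover have "j < Suc N"
      using \<psi>(1) dynkin_index_bounds(5)[OF p] by (simp add: length_dynkin_word)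
    ultimately have "alg_poly (Suc N) (\<lambda>y. \<xi> (\<psi> (replicate j y)))"
      by (rule alg_poly_form)
    then show ?thesis by (simp add: w \<psi>(3))
  qed
  then have "alg_poly (Suc N) (\<lambda>y. \<Sum>p\<in>dynkin_index N. dynkin_coeff p * \<xi> (nested_bracket bracket (dynkin_word (- x) y p)))"
    by (intro alg_poly_sum alg_poly_cmult)
  then show ?thesis
    by (simp add: left_regular_def bch_def dualD[OF \<xi>])
qed

lemma continuous_on_scl [continuous_intros]:
  "continuous_on S f \<Longrightarrow> continuous_on S (\<lambda>e. scl c (f e))"
  by (rule continuous_on_compose2[OF continuous_scale_right]) auto

lemma continuous_on_nested:
  assumes "\<And>u. u \<in> set w \<Longrightarrow> continuous_on S u"
  shows "continuous_on S (\<lambda>e. nested_bracket bracket (map (\<lambda>u. u e) w))"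
  using assms
proof (induction w rule: induct_list012)
  case (3 u v w)
  have "continuous_on S (\<lambda>e. (\<lambda>(x, y). bracket x y) (u e, nested_bracket bracket (map (\<lambda>u. u e) (v # w))))"
    using 3 by (intro continuous_on_compose2[OF continuous_bracket] continuous_on_Pair) auto
  then show ?case by simp
qed (simp_all add: continuous_on_const)

lemma continuous_on_bch [continuous_intros]:
  assumes "continuous_on S u" "continuous_on S v"
  shows "continuous_on S (\<lambda>e. u e \<star> v e)"
  unfolding bch_def
proof (intro continuous_on_sum continuous_on_scl)
  fix p assume p: "p \<in> dynkin_index N"
  have "dynkin_word (u e) (v e) p = map (\<lambda>f. f e) (dynkin_word u v p)" for e
    by (simp add: map_dynkin_word)
  moreover have "continuous_on S (\<lambda>e. nested_bracket bracket (map (\<lambda>f. f e) (dynkin_word u v p)))"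
    using set_dynkin_word[of u v p] assms by (intro continuous_on_nested) auto
  ultimately show "continuous_on S (\<lambda>e. nested_bracket bracket (dynkin_word (u e) (v e) p))" by simp
qed

lemma continuous_on_lam:
  assumes "continuous_on UNIV \<phi>" "continuous_on S u" "continuous_on S v"
  shows "continuous_on S (\<lambda>e. lam (u e) \<phi> (v e))"
  unfolding left_regular_def
  by (intro continuous_on_compose2[OF assms(1)] continuous_on_bch continuous_on_minus assms) auto

end

section \<open>The topology of uniform convergence on bounded sets\<close>

text \<open>The set given by the strict inequality need not be open, since the supremum over
  \<open>B\<close> may equal \<open>\<epsilon>\<close>. Requiring a uniform bound
  \<open>\<eta> < \<epsilon>\<close> leaves room and gives an open set inside it.\<close>

lemma ucb_neighbourhood:
  fixes scl :: "'k::real_normed_field \<Rightarrow> 'g::{topological_space, zero} \<Rightarrow> 'g"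
  assumes B: "vn_bounded scl B" and e: "\<epsilon> > 0" and \<phi>: "continuous_on UNIV \<phi>"
  obtains U where "openin (ucb_topology scl) U" "\<phi> \<in> U"
    "U \<subseteq> {\<psi>. continuous_on UNIV \<psi> \<and> (\<forall>y\<in>B. norm (\<psi> y - \<phi> y) < \<epsilon>)}"
proof
  define U where "U = {\<psi>. continuous_on UNIV \<psi> \<and> (\<exists>\<eta><\<epsilon>. \<forall>y\<in>B. norm (\<psi> y - \<phi> y) \<le> \<eta>)}"
  show "\<phi> \<in> U" using e \<phi> by (auto simp: U_def)
  show "U \<subseteq> {\<psi>. continuous_on UNIV \<psi> \<and> (\<forall>y\<in>B. norm (\<psi> y - \<phi> y) < \<epsilon>)}"
    by (force simp: U_def)
  show "openin (ucb_topology scl) U"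
    unfolding openin_ucb_topology ucb_open_def
  proof (intro conjI ballI)
    show "U \<subseteq> {\<phi>. continuous_on UNIV \<phi>}" by (auto simp: U_def)
    fix \<psi> assume "\<psi> \<in> U"
    then obtain \<eta> where \<eta>: "\<eta> < \<epsilon>" "\<And>y. y \<in> B \<Longrightarrow> norm (\<psi> y - \<phi> y) \<le> \<eta>" by (auto simp: U_def)
    have "{\<omega>. continuous_on UNIV \<omega> \<and> (\<forall>y\<in>B. norm (\<omega> y - \<psi> y) < (\<epsilon> - \<eta>) / 2)} \<subseteq> U"
    proof clarify
      fix \<omega> assume \<omega>: "continuous_on UNIV \<omega>" "\<forall>y\<in>B. norm (\<omega> y - \<psi> y) < (\<epsilon> - \<eta>) / 2"
      have "norm (\<omega> y - \<phi> y) \<le> (\<epsilon> + \<eta>) / 2" if y: "y \<in> B" for y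
      proof -
        have "norm (\<omega> y - \<phi> y) \<le> norm (\<omega> y - \<psi> y) + norm (\<psi> y - \<phi> y)"
          using norm_triangle_ineq[of "\<omega> y - \<psi> y" "\<psi> y - \<phi> y"] by simp
        moreover have "norm (\<omega> y - \<psi> y) < (\<epsilon> - \<eta>) / 2" using \<omega>(2) y by (rule bspec)
        moreover have "(\<epsilon> - \<eta>) / 2 + \<eta> = (\<epsilon> + \<eta>) / 2" by (simp add: field_simps)
        ultimately show ?thesis using \<eta>(2)[OF y] by linarith
      qed
      moreover have "(\<epsilon> + \<eta>) / 2 < \<epsilon>" using \<eta>(1) by simp
      ultimately show "\<omega> \<in> U" using \<omega>(1) unfolding U_def by blast
    qed
    with B \<eta>(1) show "\<exists>B \<delta>. vn_bounded scl B \<and> \<delta> > 0 \<and>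
        {\<omega>. continuous_on UNIV \<omega> \<and> (\<forall>y\<in>B. norm (\<omega> y - \<psi> y) < \<delta>)} \<subseteq> U"
      by (intro exI[of _ B] exI[of _ "(\<epsilon> - \<eta>) / 2"]) simp
  qed
qed

lemma topspace_ucb_topology: "topspace (ucb_topology scl) = {\<phi>. continuous_on UNIV \<phi>}"
proof
  show "topspace (ucb_topology scl) \<subseteq> {\<phi>. continuous_on UNIV \<phi>}"
    using openin_topspace[of "ucb_topology scl"] unfolding openin_ucb_topology ucb_open_def by blast
  have "vn_bounded scl {}" by (auto simp: vn_bounded_def intro: exI[of _ 1])
  moreover have "(1::real) > 0" by simp
  ultimately have "openin (ucb_topology scl) {\<phi>. continuous_on UNIV \<phi>}"
    unfolding openin_ucb_topology ucb_open_def by blast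
  then show "{\<phi>. continuous_on UNIV \<phi>} \<subseteq> topspace (ucb_topology scl)" by (rule openin_subset)
qed

lemma in_ucb_closure:
  fixes scl :: "'k::real_normed_field \<Rightarrow> 'g::{topological_space, zero} \<Rightarrow> 'g"
  assumes "S \<subseteq> {\<phi>. continuous_on UNIV \<phi>}"
  shows "\<phi> \<in> ucb_topology scl closure_of S \<longleftrightarrow> continuous_on UNIV \<phi> \<and>
    (\<forall>B \<epsilon>. vn_bounded scl B \<longrightarrow> \<epsilon> > 0 \<longrightarrow> (\<exists>\<psi>\<in>S. \<forall>y\<in>B. norm (\<psi> y - \<phi> y) < \<epsilon>))"
    (is "_ \<longleftrightarrow> ?R")
proof
  assume l: "\<phi> \<in> ucb_topology scl closure_of S"
  then have \<phi>: "continuous_on UNIV \<phi>" by (simp add: in_closure_of topspace_ucb_topology)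
  have "\<exists>\<psi>\<in>S. \<forall>y\<in>B. norm (\<psi> y - \<phi> y) < \<epsilon>" if B: "vn_bounded scl B" "\<epsilon> > 0" for B \<epsilon>
  proof -
    obtain U where U: "openin (ucb_topology scl) U" "\<phi> \<in> U"
      "U \<subseteq> {\<psi>. continuous_on UNIV \<psi> \<and> (\<forall>y\<in>B. norm (\<psi> y - \<phi> y) < \<epsilon>)}"
      by (rule ucb_neighbourhood[OF B \<phi>])
    with l obtain \<psi> where "\<psi> \<in> S" "\<psi> \<in> U" unfolding in_closure_of by blast
    with U(3) show ?thesis by blast
  qed
  with \<phi> show ?R by blast
next
  assume R: ?R
  show "\<phi> \<in> ucb_topology scl closure_of S"
    unfolding in_closure_of topspace_ucb_topology
  proof (intro conjI allI impI)
    show "\<phi> \<in> {\<phi>. continuous_on UNIV \<phi>}" using R by simp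
    fix U assume "\<phi> \<in> U \<and> openin (ucb_topology scl) U"
    then obtain B \<epsilon> where B: "vn_bounded scl B" "\<epsilon> > 0"
      "{\<psi>. continuous_on UNIV \<psi> \<and> (\<forall>y\<in>B. norm (\<psi> y - \<phi> y) < \<epsilon>)} \<subseteq> U"
      unfolding openin_ucb_topology ucb_open_def by blast
    with R obtain \<psi> where "\<psi> \<in> S" "\<forall>y\<in>B. norm (\<psi> y - \<phi> y) < \<epsilon>" by blast
    with B(3) assms show "\<exists>\<psi>. \<psi> \<in> S \<and> \<psi> \<in> U" by blast
  qed
qed

lemma limitin_ucbI:
  fixes scl :: "'k::real_normed_field \<Rightarrow> 'g::{topological_space, zero} \<Rightarrow> 'g"
  assumes "continuous_on UNIV l" "\<And>t. continuous_on UNIV (f t)"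
    and "\<And>B \<epsilon>. vn_bounded scl B \<Longrightarrow> \<epsilon> > 0 \<Longrightarrow> \<forall>\<^sub>F t in F. \<forall>y\<in>B. norm (f t y - l y) < \<epsilon>"
  shows "limitin (ucb_topology scl) f l F"
  unfolding limitin_def topspace_ucb_topology
proof (intro conjI allI impI)
  show "l \<in> {\<phi>. continuous_on UNIV \<phi>}" using assms(1) by simp
  fix U assume "openin (ucb_topology scl) U \<and> l \<in> U"
  then obtain B \<epsilon> where B: "vn_bounded scl B" "\<epsilon> > 0"
    "{\<psi>. continuous_on UNIV \<psi> \<and> (\<forall>y\<in>B. norm (\<psi> y - l y) < \<epsilon>)} \<subseteq> U"
    unfolding openin_ucb_topology ucb_open_def by blast
  show "\<forall>\<^sub>F t in F. f t \<in> U"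
    using assms(3)[OF B(1,2)] by (rule eventually_mono) (use B(3) assms(2) in blast)
qed

lemma continuous_map_ucbI:
  fixes scl :: "'k::real_normed_field \<Rightarrow> 'g::{topological_space, zero} \<Rightarrow> 'g"
  assumes "\<And>e. e \<in> topspace X \<Longrightarrow> continuous_on UNIV (f e)"
    and "\<And>e B \<epsilon>. e \<in> topspace X \<Longrightarrow> vn_bounded scl B \<Longrightarrow> \<epsilon> > 0 \<Longrightarrow>
      \<exists>W. openin X W \<and> e \<in> W \<and> (\<forall>e'\<in>W. \<forall>y\<in>B. norm (f e' y - f e y) < \<epsilon>)"
  shows "continuous_map X (ucb_topology scl) f"
proof (rule continuous_map_atin[THEN iffD2], intro ballI)
  fix e assume e: "e \<in> topspace X"
  show "limitin (ucb_topology scl) f (f e) (atin X e)"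
    unfolding limitin_def topspace_ucb_topology
  proof (intro conjI allI impI)
    show "f e \<in> {\<phi>. continuous_on UNIV \<phi>}" using assms(1)[OF e] by simp
    fix U assume "openin (ucb_topology scl) U \<and> f e \<in> U"
    then obtain B \<epsilon> where B: "vn_bounded scl B" "\<epsilon> > 0"
      "{\<psi>. continuous_on UNIV \<psi> \<and> (\<forall>y\<in>B. norm (\<psi> y - f e y) < \<epsilon>)} \<subseteq> U"
      unfolding openin_ucb_topology ucb_open_def by blast
    from assms(2)[OF e B(1,2)] obtain W where W: "openin X W" "e \<in> W"
      "\<forall>e'\<in>W. \<forall>y\<in>B. norm (f e' y - f e y) < \<epsilon>" by blast
    have "f e' \<in> U" if "e' \<in> W" for e'
      using that W B(3) assms(1)[of e'] openin_subset[OF W(1)] by blast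
    with W(1,2) show "\<forall>\<^sub>F x in atin X e. f x \<in> U"
      unfolding eventually_atin by blast
  qed
qed

lemma continuous_map_ucb_add:
  fixes scl :: "'k::real_normed_field \<Rightarrow> 'g::{topological_space, zero} \<Rightarrow> 'g"
  assumes f: "continuous_map X (ucb_topology scl) f" and g: "continuous_map X (ucb_topology scl) g"
  shows "continuous_map X (ucb_topology scl) (\<lambda>e. f e + g e)"
proof -
  have cont: "continuous_on UNIV (h e)" if h: "continuous_map X (ucb_topology scl) h" and e: "e \<in> topspace X" for h e
    using e continuous_map_image_subset_topspace[OF h] by (auto simp: topspace_ucb_topology)
  have nhd: "\<exists>W. openin X W \<and> e \<in> W \<and> (\<forall>e'\<in>W. \<forall>y\<in>B. norm (h e' y - h e y) < \<epsilon>)"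
    if h: "continuous_map X (ucb_topology scl) h" and e: "e \<in> topspace X" and B: "vn_bounded scl B" "\<epsilon> > 0"
    for h e B and \<epsilon> :: real
  proof -
    obtain U where U: "openin (ucb_topology scl) U" "h e \<in> U"
      "U \<subseteq> {\<psi>. continuous_on UNIV \<psi> \<and> (\<forall>y\<in>B. norm (\<psi> y - h e y) < \<epsilon>)}"
      by (rule ucb_neighbourhood[OF B cont[OF h e]])
    have "openin X {x \<in> topspace X. h x \<in> U}"
      using h U(1) by (rule openin_continuous_map_preimage)
    with e U(2,3) show ?thesis
      by (intro exI[of _ "{x \<in> topspace X. h x \<in> U}"]) auto
  qed
  show ?thesis
  proof (rule continuous_map_ucbI)
    fix e assume e: "e \<in> topspace X"
    show "continuous_on UNIV (f e + g e)"
      unfolding plus_fun_def by (intro continuous_on_add cont[OF f e] cont[OF g e])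
    fix B and \<epsilon> :: real assume B: "vn_bounded scl B" "\<epsilon> > 0"
    have e2: "\<epsilon> / 2 > 0" using B(2) by simp
    obtain W where W: "openin X W" "e \<in> W" "\<forall>e'\<in>W. \<forall>y\<in>B. norm (f e' y - f e y) < \<epsilon> / 2"
      using nhd[OF f e B(1) e2] by blast
    obtain W' where W': "openin X W'" "e \<in> W'" "\<forall>e'\<in>W'. \<forall>y\<in>B. norm (g e' y - g e y) < \<epsilon> / 2"
      using nhd[OF g e B(1) e2] by blast
    have "norm ((f e' + g e') y - (f e + g e) y) < \<epsilon>" if "e' \<in> W \<inter> W'" "y \<in> B" for e' y
    proof -
      have "norm ((f e' + g e') y - (f e + g e) y) = norm ((f e' y - f e y) + (g e' y - g e y))"
        by (simp add: algebra_simps)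
      also have "\<dots> \<le> norm (f e' y - f e y) + norm (g e' y - g e y)" by (rule norm_triangle_ineq)
      also have "\<dots> < \<epsilon> / 2 + \<epsilon> / 2" using W(3) W'(3) that by (intro add_strict_mono) auto
      finally show ?thesis by simp
    qed
    with W W' show "\<exists>W. openin X W \<and> e \<in> W \<and> (\<forall>e'\<in>W. \<forall>y\<in>B. norm ((f e' + g e') y - (f e + g e) y) < \<epsilon>)"
      by (intro exI[of _ "W \<inter> W'"]) auto
  qed
qed

lemma continuous_map_ucb_scale:
  fixes scl :: "'k::real_normed_field \<Rightarrow> 'g::{topological_space, zero} \<Rightarrow> 'g"
  assumes f: "continuous_map X (ucb_topology scl) f"
  shows "continuous_map X (ucb_topology scl) (\<lambda>e. fun_scale c (f e))"
proof (rule continuous_map_ucbI)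
  fix e assume e: "e \<in> topspace X"
  have fe: "continuous_on UNIV (f e)"
    using e continuous_map_image_subset_topspace[OF f] by (auto simp: topspace_ucb_topology)
  then show "continuous_on UNIV (fun_scale c (f e))"
    unfolding fun_scale_def by (intro continuous_on_mult continuous_on_const)
  fix B and \<epsilon> :: real assume B: "vn_bounded scl B" "\<epsilon> > 0"
  have e2: "\<epsilon> / (norm c + 1) > 0" using B(2) by (simp add: add_nonneg_pos)
  obtain U where U: "openin (ucb_topology scl) U" "f e \<in> U"
    "U \<subseteq> {\<psi>. continuous_on UNIV \<psi> \<and> (\<forall>y\<in>B. norm (\<psi> y - f e y) < \<epsilon> / (norm c + 1))}"
    by (rule ucb_neighbourhood[OF B(1) e2 fe])
  have "norm (fun_scale c (f e') y - fun_scale c (f e) y) < \<epsilon>"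
    if "f e' \<in> U" "y \<in> B" for e' y
  proof -
    have less: "norm (f e' y - f e y) < \<epsilon> / (norm c + 1)" using that U(3) by blast
    have "norm (fun_scale c (f e') y - fun_scale c (f e) y) = norm c * norm (f e' y - f e y)"
      by (simp add: fun_scale_def right_diff_distrib[symmetric] norm_mult)
    also have "\<dots> \<le> norm c * (\<epsilon> / (norm c + 1))"
      using less by (intro mult_left_mono) auto
    also have "\<dots> < (norm c + 1) * (\<epsilon> / (norm c + 1))"
      using e2 by (intro mult_strict_right_mono) auto
    also have "\<dots> = \<epsilon>" by (simp add: add_nonneg_eq_0_iff)
    finally show ?thesis .
  qed
  moreover have "openin X {x \<in> topspace X. f x \<in> U}"
    using f U(1) by (rule openin_continuous_map_preimage)
  ultimately show "\<exists>W. openin X W \<and> e \<in> W \<and> (\<forall>e'\<in>W. \<forall>y\<in>B. norm (fun_scale c (f e') y - fun_scale c (f e) y) < \<epsilon>)"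
    using e U(2) by (intro exI[of _ "{x \<in> topspace X. f x \<in> U}"]) auto
qed

context nilpotent_lc_lie_algebra
begin

text \<open>The substitution c = 1 / t turns absorption into smallness of c B, which also makes
  sense for c = 0.\<close>

lemma vn_bounded_iff:
  "vn_bounded scl B \<longleftrightarrow>
    (\<forall>V. open V \<longrightarrow> 0 \<in> V \<longrightarrow> (\<exists>r>0. \<forall>c. norm c \<le> r \<longrightarrow> (\<forall>b\<in>B. scl c b \<in> V)))"
proof
  assume l: "vn_bounded scl B"
  show "\<forall>V. open V \<longrightarrow> 0 \<in> V \<longrightarrow> (\<exists>r>0. \<forall>c. norm c \<le> r \<longrightarrow> (\<forall>b\<in>B. scl c b \<in> V))"
  proof (intro allI impI)
    fix V :: "'g set" assume V: "open V" "0 \<in> V"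
    then obtain r where r: "r > 0" "\<And>t. r \<le> norm t \<Longrightarrow> B \<subseteq> scl t ` V"
      using l unfolding vn_bounded_def by blast
    have "scl c b \<in> V" if c: "norm c \<le> 1 / r" and b: "b \<in> B" for c b
    proof (cases "c = 0")
      case False
      have "r \<le> norm (inverse c)"
        unfolding norm_inverse using c r(1) False by (simp add: inverse_eq_divide field_simps)
      then obtain v where "v \<in> V" "b = scl (inverse c) v" using r(2) b by blast
      then show ?thesis using False by simp
    qed (simp add: V)
    then show "\<exists>r>0. \<forall>c. norm c \<le> r \<longrightarrow> (\<forall>b\<in>B. scl c b \<in> V)"
      using r(1) by (intro exI[of _ "1 / r"]) simp
  qed
next
  assume R: "\<forall>V. open V \<longrightarrow> 0 \<in> V \<longrightarrow> (\<exists>r>0. \<forall>c. norm c \<le> r \<longrightarrow> (\<forall>b\<in>B. scl c b \<in> V))"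
  show "vn_bounded scl B"
    unfolding vn_bounded_def
  proof (intro allI impI)
    fix V :: "'g set" assume "open V \<and> 0 \<in> V"
    then have "\<exists>r>0. \<forall>c. norm c \<le> r \<longrightarrow> (\<forall>b\<in>B. scl c b \<in> V)" by (intro R[rule_format]) simp_all
    then obtain r where r: "r > 0" "\<And>c b. norm c \<le> r \<Longrightarrow> b \<in> B \<Longrightarrow> scl c b \<in> V" by blast
    have "B \<subseteq> scl t ` V" if t: "1 / r \<le> norm t" for t
    proof
      fix b assume b: "b \<in> B"
      have t0: "t \<noteq> 0" using t r(1) by (auto simp: field_simps)
      then have "norm (inverse t) \<le> r"
        unfolding norm_inverse using t r(1) by (simp add: inverse_eq_divide field_simps)
      then have "scl (inverse t) b \<in> V" using r(2) b by blast
      moreover have "b = scl t (scl (inverse t) b)" using t0 by simp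
      ultimately show "b \<in> scl t ` V" by blast
    qed
    then show "\<exists>r>0. \<forall>t. r \<le> norm t \<longrightarrow> B \<subseteq> scl t ` V"
      using r(1) by (intro exI[of _ "1 / r"]) simp
  qed
qed

lemma vn_boundedD:
  assumes "vn_bounded scl B" "open V" "0 \<in> V"
  obtains r where "r > 0" "\<And>c b. norm c \<le> r \<Longrightarrow> b \<in> B \<Longrightarrow> scl c b \<in> V"
proof -
  have "\<exists>r>0. \<forall>c. norm c \<le> r \<longrightarrow> (\<forall>b\<in>B. scl c b \<in> V)"
    by (rule assms(1)[unfolded vn_bounded_iff, rule_format]) (fact assms)+
  then show thesis using that by blast
qed

lemma vn_bounded_const: "vn_bounded scl ((\<lambda>_. x) ` B)"
  unfolding vn_bounded_iff
proof (intro allI impI)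
  fix V :: "'g set" assume V: "open V" "0 \<in> V"
  have "open ((\<lambda>c. scl c x) -` V)"
    using open_vimage[OF V(1) continuous_scale_left] .
  moreover have "0 \<in> (\<lambda>c. scl c x) -` V" using V(2) by simp
  ultimately obtain r where r: "r > 0" "cball 0 r \<subseteq> (\<lambda>c. scl c x) -` V"
    using open_contains_cball by blast
  then have "\<forall>c. norm c \<le> r \<longrightarrow> (\<forall>b\<in>(\<lambda>_. x) ` B. scl c b \<in> V)" by (auto simp: subset_iff)
  with r(1) show "\<exists>r>0. \<forall>c. norm c \<le> r \<longrightarrow> (\<forall>b\<in>(\<lambda>_. x) ` B. scl c b \<in> V)" by blast
qed

lemma vn_bounded_singleton: "vn_bounded scl {x}"
  using vn_bounded_const[of x "{()}"] by simp

lemma vn_bounded_add: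
  assumes f: "vn_bounded scl (f ` B)" and g: "vn_bounded scl (g ` B)"
  shows "vn_bounded scl ((\<lambda>y. f y + g y) ` B)"
  unfolding vn_bounded_iff
proof (intro allI impI)
  fix V :: "'g set" assume V: "open V" "0 \<in> V"
  have "open ((\<lambda>(x, y). x + y) -` V)"
    by (rule open_vimage[OF V(1)]) (auto simp: case_prod_beta intro!: continuous_intros)
  moreover have "(0, 0) \<in> (\<lambda>(x, y). x + y) -` V" using V(2) by simp
  ultimately obtain S T where ST: "open S" "0 \<in> S" "open T" "0 \<in> T" "S \<times> T \<subseteq> (\<lambda>(x, y). x + y) -` V"
    by (metis mem_Sigma_iff open_prod_elim)
  obtain r where r: "r > 0" "\<And>c b. norm c \<le> r \<Longrightarrow> b \<in> f ` B \<Longrightarrow> scl c b \<in> S"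
    using vn_boundedD[OF f ST(1,2)] by blast
  obtain q where q: "q > 0" "\<And>c b. norm c \<le> q \<Longrightarrow> b \<in> g ` B \<Longrightarrow> scl c b \<in> T"
    using vn_boundedD[OF g ST(3,4)] by blast
  have "scl c (f y + g y) \<in> V" if "norm c \<le> min r q" "y \<in> B" for c y
    using ST(5) r(2)[of c "f y"] q(2)[of c "g y"] that by (auto simp: scale_right_distrib subset_iff)
  then show "\<exists>r>0. \<forall>c. norm c \<le> r \<longrightarrow> (\<forall>b\<in>(\<lambda>y. f y + g y) ` B. scl c b \<in> V)"
    using r(1) q(1) by (intro exI[of _ "min r q"]) auto
qed

lemma vn_bounded_scale:
  assumes f: "vn_bounded scl (f ` B)"
  shows "vn_bounded scl ((\<lambda>y. scl a (f y)) ` B)"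
  unfolding vn_bounded_iff
proof (intro allI impI)
  fix V :: "'g set" assume V: "open V" "0 \<in> V"
  obtain r where r: "r > 0" "\<And>c b. norm c \<le> r \<Longrightarrow> b \<in> f ` B \<Longrightarrow> scl c b \<in> V"
    using vn_boundedD[OF f V] by blast
  have "scl c (scl a (f y)) \<in> V" if c: "norm c \<le> r / (norm a + 1)" and y: "y \<in> B" for c y
  proof -
    have "norm (c * a) \<le> norm c * (norm a + 1)"
      by (simp add: norm_mult mult_left_mono)
    also have "\<dots> \<le> r / (norm a + 1) * (norm a + 1)"
      using c by (intro mult_right_mono) auto
    also have "\<dots> = r" by (simp add: add_nonneg_eq_0_iff)
    finally have "scl (c * a) (f y) \<in> V" using r(2) y by blast
    then show ?thesis by simp
  qed
  then show "\<exists>r>0. \<forall>c. norm c \<le> r \<longrightarrow> (\<forall>b\<in>(\<lambda>y. scl a (f y)) ` B. scl c b \<in> V)"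
    using r(1) by (intro exI[of _ "r / (norm a + 1)"]) (auto simp: add_nonneg_pos)
qed

lemma vn_bounded_sum:
  "(\<And>i. i \<in> I \<Longrightarrow> vn_bounded scl (f i ` B)) \<Longrightarrow> vn_bounded scl ((\<lambda>y. \<Sum>i\<in>I. f i y) ` B)"
  by (induction I rule: infinite_finite_induct) (simp_all add: vn_bounded_const vn_bounded_add)

text \<open>The scalar is split as c = r (c / r): the factor r brings \<open>f y\<close> into
  \<open>S\<close>, and c / r brings \<open>g y\<close> into \<open>T\<close>.\<close>

lemma vn_bounded_bracket:
  assumes f: "vn_bounded scl (f ` B)" and g: "vn_bounded scl (g ` B)"
  shows "vn_bounded scl ((\<lambda>y. bracket (f y) (g y)) ` B)"
  unfolding vn_bounded_iff
proof (intro allI impI)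
  fix V :: "'g set" assume V: "open V" "0 \<in> V"
  have "open ((\<lambda>(x, y). bracket x y) -` V)"
    by (rule open_vimage[OF V(1) continuous_bracket])
  moreover have "(0, 0) \<in> (\<lambda>(x, y). bracket x y) -` V" using V(2) by simp
  ultimately obtain S T where ST: "open S" "0 \<in> S" "open T" "0 \<in> T" "S \<times> T \<subseteq> (\<lambda>(x, y). bracket x y) -` V"
    by (metis mem_Sigma_iff open_prod_elim)
  obtain r where r: "r > 0" "\<And>c b. norm c \<le> r \<Longrightarrow> b \<in> f ` B \<Longrightarrow> scl c b \<in> S"
    using vn_boundedD[OF f ST(1,2)] by blast
  obtain q where q: "q > 0" "\<And>c b. norm c \<le> q \<Longrightarrow> b \<in> g ` B \<Longrightarrow> scl c b \<in> T"
    using vn_boundedD[OF g ST(3,4)] by blast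
  have "scl c (bracket (f y) (g y)) \<in> V" if c: "norm c \<le> r * q" and y: "y \<in> B" for c y
  proof -
    have "norm (c / of_real r) \<le> q"
      using c r(1) by (simp add: norm_divide field_simps)
    then have "scl (c / of_real r) (g y) \<in> T" using q(2) y by blast
    moreover have "scl (of_real r) (f y) \<in> S" using r y by simp
    ultimately have "(scl (of_real r) (f y), scl (c / of_real r) (g y)) \<in> (\<lambda>(x, y). bracket x y) -` V"
      by (intro subsetD[OF ST(5)] SigmaI)
    then show ?thesis using r(1) by simp
  qed
  then show "\<exists>r>0. \<forall>c. norm c \<le> r \<longrightarrow> (\<forall>b\<in>(\<lambda>y. bracket (f y) (g y)) ` B. scl c b \<in> V)"
    using r(1) q(1) by (intro exI[of _ "r * q"]) auto
qed

lemma vn_bounded_bch: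
  assumes f: "vn_bounded scl (f ` B)" and g: "vn_bounded scl (g ` B)"
  shows "vn_bounded scl ((\<lambda>y. f y \<star> g y) ` B)"
  unfolding bch_def
proof (intro vn_bounded_sum vn_bounded_scale)
  fix p assume "p \<in> dynkin_index N"
  have nested: "(\<And>u. u \<in> set w \<Longrightarrow> vn_bounded scl (u ` B)) \<Longrightarrow>
      vn_bounded scl ((\<lambda>y. nested_bracket bracket (map (\<lambda>u. u y) w)) ` B)" for w
  proof (induction w rule: induct_list012)
    case (3 u v w)
    have "vn_bounded scl ((\<lambda>y. bracket (u y) (nested_bracket bracket (map (\<lambda>u. u y) (v # w)))) ` B)"
      using 3 by (intro vn_bounded_bracket) auto
    then show ?case by simp
  qed (simp_all add: vn_bounded_const)
  have "dynkin_word (f y) (g y) p = map (\<lambda>h. h y) (dynkin_word f g p)" for y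
    by (simp add: map_dynkin_word)
  moreover have "vn_bounded scl ((\<lambda>y. nested_bracket bracket (map (\<lambda>h. h y) (dynkin_word f g p))) ` B)"
    using set_dynkin_word[of f g p] f g by (intro nested) auto
  ultimately show "vn_bounded scl ((\<lambda>y. nested_bracket bracket (dynkin_word (f y) (g y) p)) ` B)" by simp
qed

text \<open>The homogeneous components of a polynomial are continuous, hence bounded near \<open>0\<close>, and by
  homogeneity on every bounded set.\<close>

lemma locally_bounded:
  fixes G :: "'e::topological_space \<Rightarrow> 'g \<Rightarrow> 'k"
  assumes cont: "continuous_on UNIV (\<lambda>(e, y). G e y)"
    and poly: "\<And>e y. poly_fun d (\<lambda>t. G e (scl t y))" and B: "vn_bounded scl B"
  obtains W C where "open W" "e0 \<in> W" "\<And>e y. e \<in> W \<Longrightarrow> y \<in> B \<Longrightarrow> norm (G e y) \<le> C"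
proof -
  define H where "H j e y = (\<Sum>i\<le>d. lagrange_coeff d j i * G e (scl (of_nat i) y))" for j e y
  have G: "G e (scl t y) = (\<Sum>j\<le>d. H j e y * t ^ j)" for e t y
    unfolding H_def by (rule poly_fun_expand[OF poly])
  have hom: "H j e (scl s y) = s ^ j * H j e y" if "j \<le> d" for j e s y
  proof -
    have "G e (scl t (scl s y)) = (\<Sum>j\<le>d. (s ^ j * H j e y) * t ^ j)" for t
      using G[of e "t * s" y] by (simp add: power_mult_distrib mult_ac)
    from poly_fun_unique[OF this that] show ?thesis
      unfolding H_def[of j e "scl s y"] .
  qed
  have contH: "continuous_on UNIV (\<lambda>(e, y). H j e y)" for j
  proof -
    have "continuous_on UNIV (\<lambda>z. G (fst z) (scl (of_nat i) (snd z)))" for i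
    proof -
      have "continuous_on UNIV (\<lambda>z. (\<lambda>(e, y). G e y) (fst z, scl (of_nat i) (snd z)))"
        by (rule continuous_on_compose2[OF cont]) (auto intro!: continuous_intros)
      then show ?thesis by simp
    qed
    then show ?thesis
      unfolding H_def case_prod_beta by (intro continuous_on_sum continuous_on_mult continuous_on_const)
  qed
  have "\<exists>W C. open W \<and> e0 \<in> W \<and> (\<forall>e\<in>W. \<forall>y\<in>B. norm (H j e y) \<le> C)" if j: "j \<le> d" for j
  proof -
    have "open ((\<lambda>(e, y). H j e y) -` ball (H j e0 0) 1)"
      by (rule open_vimage[OF open_ball contH])
    moreover have "(e0, 0) \<in> (\<lambda>(e, y). H j e y) -` ball (H j e0 0) 1" by simp
    ultimately obtain W V where WV: "open W" "e0 \<in> W" "open V" "0 \<in> V"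
      "W \<times> V \<subseteq> (\<lambda>(e, y). H j e y) -` ball (H j e0 0) 1"
      by (metis mem_Sigma_iff open_prod_elim)
    obtain r where r: "r > 0" "\<And>c b. norm c \<le> r \<Longrightarrow> b \<in> B \<Longrightarrow> scl c b \<in> V"
      using vn_boundedD[OF B WV(3,4)] by blast
    have "norm (H j e y) \<le> (norm (H j e0 0) + 1) / r ^ j" if e: "e \<in> W" and y: "y \<in> B" for e y
    proof -
      \<comment> \<open>Rescaling moves all of \<open>B\<close> into the neighbourhood
        \<open>V\<close> at once; homogeneity charges the factor r^j for it.\<close>
      have "scl (of_real r) y \<in> V" using r y by simp
      with e have "(e, scl (of_real r) y) \<in> (\<lambda>(e, y). H j e y) -` ball (H j e0 0) 1"
        by (intro subsetD[OF WV(5)] SigmaI)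
      then have "norm (H j e (scl (of_real r) y) - H j e0 0) < 1"
        by (simp add: dist_norm norm_minus_commute)
      then have "norm (H j e (scl (of_real r) y)) \<le> norm (H j e0 0) + 1"
        using norm_triangle_ineq2[of "H j e (scl (of_real r) y)" "H j e0 0"] by linarith
      then have "r ^ j * norm (H j e y) \<le> norm (H j e0 0) + 1"
        using r(1) by (simp add: hom[OF j] norm_mult norm_power)
      then show ?thesis using r(1) by (simp add: field_simps)
    qed
    with WV(1,2) show ?thesis by blast
  qed
  then obtain W C where WC: "\<And>j. j \<le> d \<Longrightarrow> open (W j)" "\<And>j. j \<le> d \<Longrightarrow> e0 \<in> W j"
    "\<And>j e y. j \<le> d \<Longrightarrow> e \<in> W j \<Longrightarrow> y \<in> B \<Longrightarrow> norm (H j e y) \<le> C j" by metis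
  show thesis
  proof (rule that[of "\<Inter>j\<in>{..d}. W j" "\<Sum>j\<le>d. C j"])
    show "open (\<Inter>j\<in>{..d}. W j)" using WC(1) by (intro open_INT) auto
    show "e0 \<in> (\<Inter>j\<in>{..d}. W j)" using WC(2) by auto
    fix e y assume "e \<in> (\<Inter>j\<in>{..d}. W j)" "y \<in> B"
    then have "norm (H j e y) \<le> C j" if "j \<le> d" for j using WC(3) that by auto
    moreover have "G e y = (\<Sum>j\<le>d. H j e y)" using G[of e 1 y] by simp
    ultimately show "norm (G e y) \<le> (\<Sum>j\<le>d. C j)"
      by (auto intro!: order_trans[OF norm_sum] sum_mono)
  qed
qed

text \<open>Expand in powers of the first argument. The component of degree 0 vanishes by
  \<open>H0\<close>; the others are bounded near 0 uniformly on \<open>B\<close>, so shrinking x by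
  a factor s \<le> 1 makes them smaller by at least s.\<close>

lemma uniformly_small:
  assumes cont: "continuous_on UNIV (\<lambda>(x, y). H x y)" and H0: "\<And>y. H 0 y = (0::'k)"
    and polyx: "\<And>x y. poly_fun d (\<lambda>t. H (scl t x) y)" and polyy: "\<And>x y. poly_fun d (\<lambda>t. H x (scl t y))"
    and B: "vn_bounded scl B" and \<epsilon>: "\<epsilon> > 0"
  obtains W where "open W" "0 \<in> W" "\<And>x y. x \<in> W \<Longrightarrow> y \<in> B \<Longrightarrow> norm (H x y) < \<epsilon>"
proof -
  define K where "K k x y = (\<Sum>i\<le>d. lagrange_coeff d k i * H (scl (of_nat i) x) y)" for k x y
  have HK: "H (scl t x) y = (\<Sum>k\<le>d. K k x y * t ^ k)" for x t y
    unfolding K_def by (rule poly_fun_expand[OF polyx])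
  have hom: "K k (scl s x) y = s ^ k * K k x y" if "k \<le> d" for k s x y
  proof -
    have "H (scl t (scl s x)) y = (\<Sum>k\<le>d. (s ^ k * K k x y) * t ^ k)" for t
      using HK[of "t * s" x y] by (simp add: power_mult_distrib mult_ac)
    from poly_fun_unique[OF this that] show ?thesis
      unfolding K_def[of k "scl s x"] .
  qed
  have K0: "K 0 x y = 0" for x y
    using hom[of 0 0 x y] by (simp add: K_def H0)
  have contK: "continuous_on UNIV (\<lambda>(x, y). K k x y)" for k
  proof -
    have "continuous_on UNIV (\<lambda>z. H (scl (of_nat i) (fst z)) (snd z))" for i
    proof -
      have "continuous_on UNIV (\<lambda>z. (\<lambda>(x, y). H x y) (scl (of_nat i) (fst z), snd z))"
        by (rule continuous_on_compose2[OF cont]) (auto intro!: continuous_intros)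
      then show ?thesis by simp
    qed
    then show ?thesis
      unfolding K_def case_prod_beta by (intro continuous_on_sum continuous_on_mult continuous_on_const)
  qed
  have polyK: "poly_fun d (\<lambda>t. K k x (scl t y))" for k x y
    unfolding K_def by (intro poly_fun_sum poly_fun_cmult polyy)
  have "\<exists>W C. open W \<and> 0 \<in> W \<and> (\<forall>x\<in>W. \<forall>y\<in>B. norm (K k x y) \<le> C)" for k
    using locally_bounded[OF contK polyK B, of 0 k] by metis
  then obtain W C where WC: "\<And>k. open (W k)" "\<And>k. 0 \<in> W k"
    "\<And>k x y. x \<in> W k \<Longrightarrow> y \<in> B \<Longrightarrow> norm (K k x y) \<le> C k" by metis
  define C' where "C' = (\<Sum>k\<le>d. \<bar>C k\<bar>) + 1"
  have C': "C' > 0" unfolding C'_def by (intro add_nonneg_pos sum_nonneg) auto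
  \<comment> \<open>The bound 1 gives s^k \<le> s for k \<ge> 1; the other bound makes s times the
    sum of the local bounds less than \<open>\<epsilon>\<close>.\<close>
  define s where "s = min 1 (\<epsilon> / (2 * C'))"
  have s: "0 < s" "s \<le> 1" "s * C' < \<epsilon>"
  proof -
    show "0 < s" "s \<le> 1" using \<epsilon> C' by (auto simp: s_def)
    have "s * C' \<le> \<epsilon> / (2 * C') * C'" using C' by (intro mult_right_mono) (auto simp: s_def)
    also have "\<dots> < \<epsilon>" using \<epsilon> C' by simp
    finally show "s * C' < \<epsilon>" .
  qed
  define W' where "W' = (\<Inter>k\<in>{..d}. scl (of_real (1 / s)) -` W k)"
  show thesis
  proof (rule that[of W'])
    show "open W'"
      unfolding W'_def using open_vimage[OF WC(1) continuous_scale_right] by (intro open_INT) auto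
    show "0 \<in> W'" using WC(2) by (simp add: W'_def)
    fix x y assume x: "x \<in> W'" and y: "y \<in> B"
    define x' where "x' = scl (of_real (1 / s)) x"
    have xx: "x = scl (of_real s) x'"
      using s(1) by (simp add: x'_def)
    have "norm (K k x y) \<le> s * \<bar>C k\<bar>" if k: "k \<le> d" for k
    proof (cases "k = 0")
      case True
      then show ?thesis using s(1) by (simp add: K0)
    next
      case False
      have "norm (K k x' y) \<le> \<bar>C k\<bar>"
        using x y k WC(3)[of x' k y] by (auto simp: W'_def x'_def)
      moreover have "s ^ k \<le> s" using s False power_decreasing[of 1 k s] by simp
      ultimately have "s ^ k * norm (K k x' y) \<le> s * \<bar>C k\<bar>"
        using s(1) by (intro mult_mono) auto
      then show ?thesis using s(1) unfolding xx hom[OF k] by (simp add: norm_mult norm_power)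
    qed
    then have "(\<Sum>k\<le>d. norm (K k x y)) \<le> (\<Sum>k\<le>d. s * \<bar>C k\<bar>)" by (intro sum_mono) auto
    moreover have "norm (H x y) \<le> (\<Sum>k\<le>d. norm (K k x y))"
      using HK[of 1 x y] norm_sum[of "\<lambda>k. K k x y" "{..d}"] by simp
    ultimately have "norm (H x y) \<le> s * (\<Sum>k\<le>d. \<bar>C k\<bar>)" by (simp add: sum_distrib_left)
    also have "\<dots> \<le> s * C'" using s(1) by (simp add: C'_def)
    also have "\<dots> < \<epsilon>" by (rule s(3))
    finally show "norm (H x y) < \<epsilon>" .
  qed
qed

end

section \<open>The function space and the group representation\<close>

lemma continuous_map_ucb_eval:
  fixes scl :: "'k::{real_normed_field, euclidean_space} \<Rightarrow> 'g::{topological_ab_group_add, t2_space} \<Rightarrow> 'g"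
  assumes "\<And>x. vn_bounded scl {x}"
  shows "continuous_map (ucb_topology scl) euclidean (\<lambda>\<phi>. \<phi> y)"
  unfolding continuous_map_def
proof (intro conjI allI impI)
  fix U :: "'k set" assume "openin euclidean U"
  then have U: "open U" by simp
  show "openin (ucb_topology scl) {\<phi> \<in> topspace (ucb_topology scl). \<phi> y \<in> U}"
    unfolding openin_ucb_topology ucb_open_def topspace_ucb_topology
  proof (intro conjI ballI)
    fix \<phi> assume "\<phi> \<in> {\<phi> \<in> {\<phi>. continuous_on UNIV \<phi>}. \<phi> y \<in> U}"
    then obtain \<epsilon> where e: "\<epsilon> > 0" "ball (\<phi> y) \<epsilon> \<subseteq> U" using U open_contains_ball by blast
    have "{\<psi>. continuous_on UNIV \<psi> \<and> (\<forall>y'\<in>{y}. norm (\<psi> y' - \<phi> y') < \<epsilon>)} \<subseteq>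
        {\<phi> \<in> {\<phi>. continuous_on UNIV \<phi>}. \<phi> y \<in> U}"
      using e(2) by (auto simp: dist_norm norm_minus_commute subset_iff)
    with e(1) assms show "\<exists>B \<epsilon>. vn_bounded scl B \<and> \<epsilon> > 0 \<and>
        {\<psi>. continuous_on UNIV \<psi> \<and> (\<forall>y\<in>B. norm (\<psi> y - \<phi> y) < \<epsilon>)} \<subseteq>
        {\<phi> \<in> {\<phi>. continuous_on UNIV \<phi>}. \<phi> y \<in> U}" by blast
  qed auto
qed auto

context nilpotent_lc_lie_algebra
begin

interpretation fs: vector_space "fun_scale :: 'k \<Rightarrow> ('g \<Rightarrow> 'k) \<Rightarrow> 'g \<Rightarrow> 'k"
  by (rule vector_space_fun_scale)

abbreviation FG :: "('g \<Rightarrow> 'k) set" where "FG \<equiv> F_G scl bracket N"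
abbreviation orbit_span :: "('g \<Rightarrow> 'k) set" where
  "orbit_span \<equiv> module.span fun_scale {lam x \<xi> | x \<xi>. \<xi> \<in> topological_dual scl}"

lemma poly_functions_iff: "\<phi> \<in> poly_functions scl N \<longleftrightarrow> continuous_on UNIV \<phi> \<and> alg_poly (Suc N) \<phi>"
  by (simp add: poly_functions_def alg_poly_def lessThan_Suc_atMost less_Suc_eq_le)

lemma orbit_span_poly:
  assumes "\<psi> \<in> orbit_span"
  shows "continuous_on UNIV \<psi> \<and> alg_poly (Suc N) \<psi>"
  using assms
proof (induction rule: fs.span_induct_alt)
  case base
  have "continuous_on UNIV (0 :: 'g \<Rightarrow> 'k)" by (simp add: zero_fun_def continuous_on_const)
  then show ?case using alg_poly_zero[of "Suc N"] by (simp add: zero_fun_def)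
next
  case (step c \<phi> \<psi>)
  then obtain x \<xi> where \<xi>: "\<phi> = lam x \<xi>" "\<xi> \<in> topological_dual scl" by blast
  have "continuous_on UNIV \<phi>"
    unfolding \<xi>(1) by (rule continuous_on_lam[OF dualD(6)[OF \<xi>(2)] continuous_on_const continuous_on_id])
  moreover have "alg_poly (Suc N) \<phi>" unfolding \<xi>(1) by (rule alg_poly_lam_dual[OF \<xi>(2)])
  ultimately show ?case
    using step(2) unfolding fun_scale_def plus_fun_def
    by (intro conjI continuous_on_add continuous_on_mult continuous_on_const alg_poly_add alg_poly_cmult) auto
qed

lemma FG_iff:
  "\<phi> \<in> FG \<longleftrightarrow> continuous_on UNIV \<phi> \<and>
    (\<forall>B \<epsilon>. vn_bounded scl B \<longrightarrow> \<epsilon> > 0 \<longrightarrow> (\<exists>\<psi>\<in>orbit_span. \<forall>y\<in>B. norm (\<psi> y - \<phi> y) < \<epsilon>))"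
proof -
  have "orbit_span \<subseteq> {\<phi>. continuous_on UNIV \<phi>}" using orbit_span_poly by blast
  from in_ucb_closure[OF this, of \<phi> scl] show ?thesis unfolding F_G_def .
qed

text \<open>Singletons are bounded, so the topology is finer than pointwise convergence, in which
  the polynomials of bounded degree form a closed set.\<close>

lemma FG_poly: "\<phi> \<in> FG \<Longrightarrow> continuous_on UNIV \<phi>" "\<phi> \<in> FG \<Longrightarrow> alg_poly (Suc N) \<phi>"
proof -
  have id: "continuous_map (ucb_topology scl) euclidean (\<lambda>\<phi>. \<phi>)"
    unfolding euclidean_product_topology[symmetric] continuous_map_componentwise_UNIV
    using continuous_map_ucb_eval[of scl] vn_bounded_singleton by blast
  have "closedin (ucb_topology scl) {\<phi> \<in> topspace (ucb_topology scl). \<phi> \<in> {\<phi>. alg_poly (Suc N) \<phi>}}"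
    by (rule closedin_continuous_map_preimage[OF id]) (simp add: closed_alg_poly)
  moreover have "orbit_span \<subseteq> {\<phi> \<in> topspace (ucb_topology scl). \<phi> \<in> {\<phi>. alg_poly (Suc N) \<phi>}}"
    using orbit_span_poly unfolding topspace_ucb_topology by blast
  ultimately have "FG \<subseteq> {\<phi> \<in> topspace (ucb_topology scl). \<phi> \<in> {\<phi>. alg_poly (Suc N) \<phi>}}"
    unfolding F_G_def by (intro closure_of_minimal)
  then show "\<phi> \<in> FG \<Longrightarrow> continuous_on UNIV \<phi>" "\<phi> \<in> FG \<Longrightarrow> alg_poly (Suc N) \<phi>"
    unfolding topspace_ucb_topology by blast+
qed

lemma orbit_span_FG: "\<phi> \<in> orbit_span \<Longrightarrow> \<phi> \<in> FG"
  unfolding FG_iff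
proof (intro conjI allI impI)
  assume \<phi>: "\<phi> \<in> orbit_span"
  then show "continuous_on UNIV \<phi>" using orbit_span_poly by blast
  fix B :: "'g set" and \<epsilon> :: real assume "\<epsilon> > 0"
  with \<phi> show "\<exists>\<psi>\<in>orbit_span. \<forall>y\<in>B. norm (\<psi> y - \<phi> y) < \<epsilon>"
    by (intro bexI[of _ \<phi>]) simp_all
qed

lemma FG_add:
  assumes "\<phi> \<in> FG" "\<psi> \<in> FG" shows "\<phi> + \<psi> \<in> FG"
  unfolding FG_iff
proof (intro conjI allI impI)
  show "continuous_on UNIV (\<phi> + \<psi>)"
    unfolding plus_fun_def by (intro continuous_on_add FG_poly(1) assms)
  fix B :: "'g set" and \<epsilon> :: real assume B: "vn_bounded scl B" and "\<epsilon> > 0"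
  then have e: "\<epsilon> / 2 > 0" by simp
  obtain \<phi>' where \<phi>': "\<phi>' \<in> orbit_span" "\<forall>y\<in>B. norm (\<phi>' y - \<phi> y) < \<epsilon> / 2"
    using assms(1) B e unfolding FG_iff by blast
  obtain \<psi>' where \<psi>': "\<psi>' \<in> orbit_span" "\<forall>y\<in>B. norm (\<psi>' y - \<psi> y) < \<epsilon> / 2"
    using assms(2) B e unfolding FG_iff by blast
  have "norm ((\<phi>' + \<psi>') y - (\<phi> + \<psi>) y) < \<epsilon>" if "y \<in> B" for y
  proof -
    have "norm ((\<phi>' + \<psi>') y - (\<phi> + \<psi>) y) = norm ((\<phi>' y - \<phi> y) + (\<psi>' y - \<psi> y))"
      by (simp add: algebra_simps)
    also have "\<dots> \<le> norm (\<phi>' y - \<phi> y) + norm (\<psi>' y - \<psi> y)" by (rule norm_triangle_ineq)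
    also have "\<dots> < \<epsilon> / 2 + \<epsilon> / 2" using \<phi>'(2) \<psi>'(2) that by (intro add_strict_mono) auto
    finally show ?thesis by simp
  qed
  with fs.span_add[OF \<phi>'(1) \<psi>'(1)] show "\<exists>\<omega>\<in>orbit_span. \<forall>y\<in>B. norm (\<omega> y - (\<phi> + \<psi>) y) < \<epsilon>" by blast
qed

lemma FG_scale:
  assumes "\<phi> \<in> FG" shows "fun_scale c \<phi> \<in> FG"
  unfolding FG_iff
proof (intro conjI allI impI)
  show "continuous_on UNIV (fun_scale c \<phi>)"
    unfolding fun_scale_def by (intro continuous_on_mult continuous_on_const FG_poly(1) assms)
  fix B :: "'g set" and \<epsilon> :: real assume B: "vn_bounded scl B" and "\<epsilon> > 0"
  then have e: "\<epsilon> / (norm c + 1) > 0" by (simp add: add_nonneg_pos)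
  obtain \<phi>' where \<phi>': "\<phi>' \<in> orbit_span" "\<forall>y\<in>B. norm (\<phi>' y - \<phi> y) < \<epsilon> / (norm c + 1)"
    using assms(1) B e unfolding FG_iff by blast
  have "norm (fun_scale c \<phi>' y - fun_scale c \<phi> y) < \<epsilon>" if "y \<in> B" for y
  proof -
    have "norm (fun_scale c \<phi>' y - fun_scale c \<phi> y) = norm c * norm (\<phi>' y - \<phi> y)"
      by (simp add: fun_scale_def right_diff_distrib[symmetric] norm_mult)
    also have "\<dots> \<le> norm c * (\<epsilon> / (norm c + 1))"
      using \<phi>'(2) that by (intro mult_left_mono) (auto intro: less_imp_le)
    also have "\<dots> < (norm c + 1) * (\<epsilon> / (norm c + 1))"
      using e by (intro mult_strict_right_mono) auto
    also have "\<dots> = \<epsilon>" by (simp add: add_nonneg_eq_0_iff)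
    finally show ?thesis .
  qed
  with fs.span_scale[OF \<phi>'(1)] show "\<exists>\<omega>\<in>orbit_span. \<forall>y\<in>B. norm (\<omega> y - fun_scale c \<phi> y) < \<epsilon>" by blast
qed

lemma FG_subspace: "module.subspace fun_scale FG"
  unfolding fs.subspace_def
  using orbit_span_FG[OF fs.span_zero] FG_add FG_scale by blast

lemma FG_sum: "(\<And>i. i \<in> I \<Longrightarrow> f i \<in> FG) \<Longrightarrow> sum f I \<in> FG"
  by (rule fs.subspace_sum[OF FG_subspace])

lemma FG_diff: "\<phi> \<in> FG \<Longrightarrow> \<psi> \<in> FG \<Longrightarrow> \<phi> - \<psi> \<in> FG"
  by (rule fs.subspace_diff[OF FG_subspace])

lemma dual_FG: "\<xi> \<in> topological_dual scl \<Longrightarrow> \<xi> \<in> FG"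
proof -
  assume "\<xi> \<in> topological_dual scl"
  then have "lam 0 \<xi> \<in> orbit_span" by (intro fs.span_base) blast
  then show ?thesis using orbit_span_FG by simp
qed

lemma lam_orbit_span: "\<phi> \<in> orbit_span \<Longrightarrow> lam x \<phi> \<in> orbit_span"
proof (induction rule: fs.span_induct_alt)
  case base
  have "lam x 0 = 0" by (simp add: left_regular_def fun_eq_iff)
  then show ?case by (simp only: fs.span_zero)
next
  case (step c \<phi> \<psi>)
  then obtain y \<xi> where "\<phi> = lam y \<xi>" "\<xi> \<in> topological_dual scl" by blast
  then have "lam x \<phi> = lam (x \<star> y) \<xi>" "\<xi> \<in> topological_dual scl" by (simp_all add: lam_bch)
  then have "lam x \<phi> \<in> orbit_span" by (intro fs.span_base) blast
  then show ?case
    unfolding lam_linear using step(2) by (intro fs.span_add fs.span_scale)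
qed

text \<open>Left translation maps bounded sets to bounded sets, so translates of approximants in the
  span approximate the translate.\<close>

lemma lam_FG:
  assumes "\<phi> \<in> FG" shows "lam x \<phi> \<in> FG"
  unfolding FG_iff
proof (intro conjI allI impI)
  show "continuous_on UNIV (lam x \<phi>)"
    by (rule continuous_on_lam[OF FG_poly(1)[OF assms] continuous_on_const continuous_on_id])
  fix B :: "'g set" and \<epsilon> :: real assume B: "vn_bounded scl B" and e: "\<epsilon> > 0"
  have "vn_bounded scl ((\<lambda>y. (- x) \<star> y) ` B)"
    using vn_bounded_bch[OF vn_bounded_const, of "\<lambda>y. y" B "- x"] B by simp
  then obtain \<psi> where \<psi>: "\<psi> \<in> orbit_span" "\<forall>y\<in>(\<lambda>y. (- x) \<star> y) ` B. norm (\<psi> y - \<phi> y) < \<epsilon>"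
    using assms e unfolding FG_iff by blast
  then have "\<forall>y\<in>B. norm (lam x \<psi> y - lam x \<phi> y) < \<epsilon>"
    by (simp add: left_regular_def)
  with lam_orbit_span[OF \<psi>(1)] show "\<exists>\<psi>\<in>orbit_span. \<forall>y\<in>B. norm (\<psi> y - lam x \<phi> y) < \<epsilon>" by blast
qed

text \<open>An element \<open>z\<close> of the last nonzero term of the lower central series is central, so
  \<open>\<lambda>(z) \<xi> - \<xi>\<close> is the constant \<open>- \<xi> z\<close>.\<close>

lemma const_FG: "(\<lambda>_. c) \<in> FG"
proof -
  obtain M where M: "N = Suc M" using N_ge_1 by (cases N) auto
  have "0 \<in> lower_central scl bracket N"
    using subspace_0[OF subspace_lower_central] N_ge_1 by simp
  with lower_central_N obtain z where z: "z \<in> lower_central scl bracket N" "z \<noteq> 0" by blast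
  have "bracket u z = 0" for u
    using bracket_lower_central[of z M u] z(1) lower_central_Suc_N by (simp add: M del: lower_central.simps)
  then have "bracket (- z) y = 0" for y
    using bracket_anticomm[of z y] by simp
  then have zy: "(- z) \<star> y = - z + y" for y by (rule bch_commuting)
  obtain \<xi> where \<xi>: "\<xi> \<in> topological_dual scl" "\<xi> z \<noteq> 0" using dual_nonzero[OF z(2)] by blast
  have "fun_scale (- c / \<xi> z) (lam z \<xi> - \<xi>) = (\<lambda>_. c)"
    using \<xi>(2) by (simp add: fun_eq_iff fun_scale_def left_regular_def zy dualD(1,3)[OF \<xi>(1)] del: uminus_add_conv_diff)
  moreover have "fun_scale (- c / \<xi> z) (lam z \<xi> - \<xi>) \<in> FG"
    by (intro FG_scale FG_diff lam_FG dual_FG \<xi>(1))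
  ultimately show ?thesis by simp
qed

lemma closedin_FG: "closedin (subtopology (ucb_topology scl) (poly_functions scl N)) FG"
proof -
  have "FG = FG \<inter> poly_functions scl N"
    using FG_poly poly_functions_iff by blast
  moreover have "closedin (ucb_topology scl) FG"
    unfolding F_G_def by (rule closedin_closure_of)
  ultimately show ?thesis unfolding closedin_subtopology by blast
qed

lemma dual_separates:
  assumes "\<And>\<xi>. \<xi> \<in> topological_dual scl \<Longrightarrow> \<xi> x = \<xi> y" shows "x = y"
proof (rule ccontr)
  assume "x \<noteq> y"
  then have "x - y \<noteq> 0" by simp
  then obtain \<xi> where \<xi>: "\<xi> \<in> topological_dual scl" "\<xi> (x - y) \<noteq> 0" by (rule dual_nonzero)
  have "\<xi> (x - y) = \<xi> x - \<xi> y" using dualD(1,3)[OF \<xi>(1)] by (metis diff_conv_add_uminus)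
  with \<xi> assms show False by simp
qed

lemma lambda_G_FG [simp]: "\<phi> \<in> FG \<Longrightarrow> lambda_G scl bracket N x \<phi> = lam x \<phi>"
  by (simp add: lambda_G_def)

section \<open>The group representation: faithfulness and unipotency\<close>

lemma group_representation_lambda_G: "group_representation (bch scl bracket N) 0 FG (lambda_G scl bracket N)"
  unfolding group_representation_def
proof (intro conjI allI ballI)
  fix x
  show "lambda_G scl bracket N x \<in> End_on FG"
    unfolding End_on_def using lam_FG FG_add FG_scale by (auto simp: lambda_G_def lam_linear)
next
  fix \<phi> assume "\<phi> \<in> FG"
  then show "lambda_G scl bracket N 0 \<phi> = \<phi>" by simp
next
  fix x y \<phi> assume "\<phi> \<in> FG"
  then show "lambda_G scl bracket N (x \<star> y) \<phi> = lambda_G scl bracket N x (lambda_G scl bracket N y \<phi>)"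
    by (simp add: lam_FG lam_bch)
qed

text \<open>Evaluating \<lambda>(x) \<xi> at 0 gives -\<xi>(x), and continuous functionals separate
  points.\<close>

lemma inj_lambda_G: "inj (lambda_G scl bracket N)"
proof (rule injI)
  fix x y assume eq: "lambda_G scl bracket N x = lambda_G scl bracket N y"
  show "x = y"
  proof (rule dual_separates)
    fix \<xi> assume \<xi>: "\<xi> \<in> topological_dual scl"
    have "lam x \<xi> 0 = lam y \<xi> 0"
      using fun_cong[OF eq, of \<xi>] dual_FG[OF \<xi>] by simp
    then show "\<xi> x = \<xi> y" by (simp add: left_regular_def dualD[OF \<xi>])
  qed
qed

text \<open>Since \<lambda>(t x) \<lambda>(x) = \<lambda>((t + 1) x), replacing \<phi> by
  \<lambda>(x) \<phi> - \<phi> replaces the orbit polynomial by its finite difference, which has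
  smaller degree.\<close>

lemma lambda_G_nilpotent_aux:
  assumes "\<phi> \<in> FG" "\<And>y. poly_fun k (\<lambda>t. lam (scl t x) \<phi> y)"
  shows "((\<lambda>\<psi>. lambda_G scl bracket N x \<psi> - \<psi>) ^^ Suc k) \<phi> = 0"
  using assms
proof (induction k arbitrary: \<phi>)
  case 0
  have "lam x \<phi> y = \<phi> y" for y
  proof -
    obtain p where p: "degree p \<le> 0" "(\<lambda>t. lam (scl t x) \<phi> y) = poly p"
      using 0(2)[of y] by (auto simp: poly_fun_def)
    then obtain a where "p = [:a:]" by (auto elim: degree_eq_zeroE)
    then have "poly p 1 = poly p 0" by simp
    then show ?thesis using fun_cong[OF p(2), of 1] fun_cong[OF p(2), of 0] by simp
  qed
  then show ?case using 0(1) by (simp add: fun_eq_iff)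
next
  case (Suc k)
  define \<psi> where "\<psi> = lam x \<phi> - \<phi>"
  have \<psi>: "\<psi> \<in> FG" unfolding \<psi>_def using Suc.prems(1) by (intro FG_diff lam_FG)
  have "lam (scl t x) (lam x \<phi>) = lam (scl (t + 1) x) \<phi>" for t
    unfolding lam_bch[symmetric] using bch_scale_scale[of t x 1] by simp
  then have "lam (scl t x) \<psi> y = lam (scl (t + 1) x) \<phi> y - lam (scl t x) \<phi> y" for t y
    by (simp add: \<psi>_def lam_linear)
  then have "poly_fun k (\<lambda>t. lam (scl t x) \<psi> y)" for y
    using poly_fun_shift_diff[OF Suc.prems(2)[of y]] by simp
  from Suc.IH[OF \<psi> this] show ?case
    using Suc.prems(1) by (simp only: funpow_Suc_right[of "Suc k"] comp_apply lambda_G_FG \<psi>_def)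
qed

lemma poly_fun_lam:
  assumes "\<phi> \<in> FG" shows "poly_fun (N * N) (\<lambda>t. lam (scl t x) \<phi> y)"
  using poly_fun_lam_shift[OF FG_poly(2)[OF assms], of 0 x y] by simp

lemma le_exponent: "N * N \<le> 2 ^ (N - 1) * N"
proof -
  have "k < 2 ^ k" for k :: nat by (rule less_exp)
  then have "N \<le> 2 ^ (N - 1)" using N_ge_1 by (metis One_nat_def Suc_leI Suc_pred' less_eq_Suc_le)
  then show ?thesis by (rule mult_le_mono1)
qed

lemma lambda_G_nilpotent:
  assumes "\<phi> \<in> FG"
  shows "((\<lambda>\<psi>. lambda_G scl bracket N x \<psi> - \<psi>) ^^ (2 ^ (N - 1) * N + 1)) \<phi> = 0"
  using lambda_G_nilpotent_aux[OF assms, of "2 ^ (N - 1) * N"] poly_fun_mono[OF poly_fun_lam[OF assms] le_exponent]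
  by simp

section \<open>Smoothness of the orbit maps\<close>

lemma FG_bounded:
  assumes "\<phi> \<in> FG" "vn_bounded scl B"
  obtains C where "\<And>y. y \<in> B \<Longrightarrow> norm (\<phi> y) \<le> C"
proof -
  \<comment> \<open>\<open>locally_bounded\<close> expects a parameter; a dummy scalar is
    supplied.\<close>
  have "continuous_on UNIV (\<lambda>z :: 'k \<times> 'g. \<phi> (snd z))"
    by (rule continuous_on_compose2[OF FG_poly(1)[OF assms(1)]]) (auto intro!: continuous_intros)
  then have "continuous_on UNIV (\<lambda>(e :: 'k, y). \<phi> y)" by (simp add: case_prod_beta)
  moreover have "poly_fun (N * N) (\<lambda>t. \<phi> (scl t y))" for y
    using poly_fun_lam_scale[OF FG_poly(2)[OF assms(1)], of 0 y] by simp
  ultimately obtain W C where "open W" "(0 :: 'k) \<in> W" "\<And>e y. e \<in> W \<Longrightarrow> y \<in> B \<Longrightarrow> norm (\<phi> y) \<le> C"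
    using locally_bounded[of "\<lambda>(e :: 'k) y. \<phi> y" "N * N" B 0] assms(2) by metis
  then show thesis using that by blast
qed

text \<open>The increment of the orbit map at \<open>x\<close>, as a function of the displacement
  and of the argument, is polynomial in each and vanishes at displacement 0;
  \<open>uniformly_small\<close> applies to it.\<close>

lemma continuous_map_lam:
  assumes "\<phi> \<in> FG"
  shows "continuous_map euclidean (ucb_topology scl) (\<lambda>x. lam x \<phi>)"
proof (rule continuous_map_ucbI)
  fix x :: 'g
  show "continuous_on UNIV (lam x \<phi>)" by (rule FG_poly(1)[OF lam_FG[OF assms]])
  fix B and \<epsilon> :: real assume B: "vn_bounded scl B" and e: "\<epsilon> > 0"
  define H where "H v y = lam (x + v) \<phi> y - lam x \<phi> y" for v y
  have cont: "continuous_on UNIV (\<lambda>(v, y). H v y)"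
    unfolding H_def case_prod_beta
    by (intro continuous_on_diff continuous_on_lam FG_poly(1)[OF assms] continuous_on_add continuous_on_const
        continuous_on_fst continuous_on_snd continuous_on_id)
  have px: "poly_fun (N * N) (\<lambda>t. H (scl t v) y)" for v y
    unfolding H_def
    using poly_fun_add[OF poly_fun_lam_shift[OF FG_poly(2)[OF assms], of x v y] poly_fun_const[of _ "- lam x \<phi> y"]]
    by simp
  have py: "poly_fun (N * N) (\<lambda>t. H v (scl t y))" for v y
    unfolding H_def
    using poly_fun_add[OF poly_fun_lam_scale[OF FG_poly(2)[OF assms], of "x + v" y]
        poly_fun_cmult[OF poly_fun_lam_scale[OF FG_poly(2)[OF assms], of x y], of "- 1"]]
    by simp
  have "H 0 y = 0" for y by (simp add: H_def)
  from uniformly_small[OF cont this px py B e] obtain W where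
    W: "open W" "0 \<in> W" "\<And>v y. v \<in> W \<Longrightarrow> y \<in> B \<Longrightarrow> norm (H v y) < \<epsilon>" by blast
  define W' where "W' = (\<lambda>x'. x' - x) -` W"
  have "open W'"
    unfolding W'_def by (rule open_vimage[OF W(1)]) (intro continuous_intros)
  moreover have "x \<in> W'" using W(2) by (simp add: W'_def)
  moreover have "norm (lam x' \<phi> y - lam x \<phi> y) < \<epsilon>" if "x' \<in> W'" "y \<in> B" for x' y
    using W(3)[of "x' - x" y] that by (simp add: W'_def H_def)
  ultimately show "\<exists>W. openin euclidean W \<and> x \<in> W \<and> (\<forall>x'\<in>W. \<forall>y\<in>B. norm (lam x' \<phi> y - lam x \<phi> y) < \<epsilon>)"
    by (intro exI[of _ W']) auto
qed

text \<open>The derivative at \<open>0\<close> of a polynomial curve is, by Lagrange interpolation, a fixed linear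
  combination of its values at \<open>0, \<dots>, d\<close>; hence it stays in \<open>\<F>\<^sub>G\<close>.\<close>

lemma limitin_difference_quotient:
  assumes f: "\<And>t. f t \<in> FG" and poly: "\<And>y. poly_fun d (\<lambda>t. f t y)"
  shows "limitin (ucb_topology scl) (\<lambda>t. fun_scale (inverse t) (f t - f 0))
    (\<Sum>i\<le>d. fun_scale (lagrange_coeff d 1 i) (f (of_nat i))) (at 0)"
proof -
  define C where "C j = (\<Sum>i\<le>d. fun_scale (lagrange_coeff d j i) (f (of_nat i)))" for j
  have CF: "C j \<in> FG" for j
    unfolding C_def by (intro FG_sum FG_scale f)
  have Cy: "C j y = (\<Sum>i\<le>d. lagrange_coeff d j i * f (of_nat i) y)" for j y
    by (simp add: C_def sum_fun_apply fun_scale_def)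
  have expand: "f t y = (\<Sum>j\<le>d. C j y * t ^ j)" for t y
    unfolding Cy by (rule poly_fun_expand[OF poly])
  have lim: "limitin (ucb_topology scl) (\<lambda>t. fun_scale (inverse t) (f t - f 0)) (C 1) (at 0)"
  proof (rule limitin_ucbI)
    show "continuous_on UNIV (C 1)" by (rule FG_poly(1)[OF CF])
    show "continuous_on UNIV (fun_scale (inverse t) (f t - f 0))" for t
      by (intro FG_poly(1) FG_scale FG_diff f)
    fix B and \<epsilon> :: real assume B: "vn_bounded scl B" and e: "\<epsilon> > 0"
    have "\<exists>K. \<forall>y\<in>B. norm (C j y) \<le> K" for j
      using FG_bounded[OF CF B] by metis
    then obtain K where K: "\<And>j y. y \<in> B \<Longrightarrow> norm (C j y) \<le> K j" by metis
    define K' where "K' = (\<Sum>j\<le>d. \<bar>K j\<bar>) + 1"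
    have K': "K' > 0" unfolding K'_def by (intro add_nonneg_pos sum_nonneg) auto
    have bound: "norm (fun_scale (inverse t) (f t - f 0) y - C 1 y) < \<epsilon>"
      if t: "t \<noteq> 0" "norm t < min 1 (\<epsilon> / K')" and y: "y \<in> B" for t y
    proof -
      have "f t y - f 0 y = (\<Sum>j\<le>d. C j y * t ^ j) - C 0 y"
        unfolding expand[of t] expand[of 0]
        by (simp add: power_0_left if_distrib[of "(*) _"] cong: if_cong)
      also have "(\<Sum>j\<le>d. C j y * t ^ j) = C 0 y + (\<Sum>j\<in>{1..d}. C j y * t ^ j)"
        by (simp add: atMost_atLeast0 sum.atLeast_Suc_atMost)
      finally have "fun_scale (inverse t) (f t - f 0) y = inverse t * (\<Sum>j\<in>{1..d}. C j y * t ^ j)"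
        by (simp add: fun_scale_def)
      also have "\<dots> = (\<Sum>j\<in>{1..d}. C j y * t ^ (j - 1))"
        unfolding sum_distrib_left
      proof (rule sum.cong[OF refl])
        fix j assume "j \<in> {1..d}"
        then obtain k where "j = Suc k" by (cases j) auto
        then show "inverse t * (C j y * t ^ j) = C j y * t ^ (j - 1)" using t(1) by simp
      qed
      finally have eq: "fun_scale (inverse t) (f t - f 0) y = (\<Sum>j\<in>{1..d}. C j y * t ^ (j - 1))" .
      have C1: "C 1 y = (\<Sum>j\<in>{1..d}. if j = 1 then C 1 y else 0)"
      \<comment> \<open>For \<open>d = 0\<close> the index 1 is missing from the sum; the claim then
        is \<open>C 1 y = 0\<close>, which holds because the weights add up to 0.\<close>
      proof (cases "d = 0")
        case True
        have "f t y = C 0 y" for t using expand[of t y] True by simp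
        then have "C 1 y = C 0 y * (\<Sum>i\<le>d. lagrange_coeff d 1 i)"
          unfolding Cy[of 1] by (simp add: sum_distrib_left mult.commute)
        then show ?thesis using True sum_lagrange_coeff[of 1 d, where 'k='k] by simp
      qed simp
      have "norm (fun_scale (inverse t) (f t - f 0) y - C 1 y) =
          norm (\<Sum>j\<in>{1..d}. C j y * t ^ (j - 1) - (if j = 1 then C 1 y else 0))"
        unfolding eq by (subst C1) (simp only: sum_subtractf)
      also have "\<dots> \<le> (\<Sum>j\<in>{1..d}. norm (C j y * t ^ (j - 1) - (if j = 1 then C 1 y else 0)))"
        by (rule norm_sum)
      also have "\<dots> \<le> (\<Sum>j\<in>{1..d}. norm t * \<bar>K j\<bar>)"
      proof (rule sum_mono)
        fix j assume j: "j \<in> {1..d}"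
        show "norm (C j y * t ^ (j - 1) - (if j = 1 then C 1 y else 0)) \<le> norm t * \<bar>K j\<bar>"
        proof (cases "j = 1")
          case False
          have "1 \<le> j - 1" using j False by auto
          from power_decreasing[OF this, of "norm t"] have "norm t ^ (j - 1) \<le> norm t"
            using t(2) by simp
          moreover have "norm (C j y) \<le> \<bar>K j\<bar>" using K[OF y, of j] by linarith
          ultimately have "norm t ^ (j - 1) * norm (C j y) \<le> norm t * \<bar>K j\<bar>"
            by (intro mult_mono) auto
          then show ?thesis using False by (simp add: norm_mult norm_power mult.commute)
        qed simp
      qed
      also have "\<dots> \<le> (\<Sum>j\<le>d. norm t * \<bar>K j\<bar>)"
        by (rule sum_mono2) auto
      also have "\<dots> \<le> norm t * K'"
        by (simp add: K'_def sum_distrib_left[symmetric] mult_left_mono)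
      also have "\<dots> < \<epsilon> / K' * K'" using t(2) K' by (intro mult_strict_right_mono) auto
      also have "\<dots> = \<epsilon>" using K' by simp
      finally show ?thesis .
    qed
    show "\<forall>\<^sub>F t in at 0. \<forall>y\<in>B. norm (fun_scale (inverse t) (f t - f 0) y - C 1 y) < \<epsilon>"
      unfolding eventually_at
    proof (intro exI conjI ballI impI)
      show "0 < min 1 (\<epsilon> / K')" using e K' by simp
      fix t :: 'k and y assume "t \<noteq> 0 \<and> dist t 0 < min 1 (\<epsilon> / K')" "y \<in> B"
      then show "norm (fun_scale (inverse t) (f t - f 0) y - C 1 y) < \<epsilon>"
        by (intro bound) auto
    qed
  qed
  then show ?thesis unfolding C_def .
qed

text \<open>The iterated directional derivatives of the orbit map for \<open>\<phi>\<close> in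
  \<open>FG\<close>, as finite combinations of translates. No limit enters, so membership in
  \<open>FG\<close> and joint continuity are inherited from the translates.\<close>

primrec iter_deriv :: "('g \<Rightarrow> 'k) \<Rightarrow> nat \<Rightarrow> 'g \<Rightarrow> (nat \<Rightarrow> 'g) \<Rightarrow> 'g \<Rightarrow> 'k" where
  "iter_deriv \<phi> 0 x v = lam x \<phi>"
| "iter_deriv \<phi> (Suc k) x v =
     (\<Sum>i\<le>N * N. fun_scale (lagrange_coeff (N * N) 1 i) (iter_deriv \<phi> k (x + scl (of_nat i) (v k)) v))"

lemma iter_deriv_FG: "\<phi> \<in> FG \<Longrightarrow> iter_deriv \<phi> k x v \<in> FG"
  by (induction k arbitrary: x) (auto intro: lam_FG FG_sum FG_scale)

lemma iter_deriv_cong: "(\<And>i. i < k \<Longrightarrow> v i = w i) \<Longrightarrow> iter_deriv \<phi> k x v = iter_deriv \<phi> k x w"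
  by (induction k arbitrary: x) simp_all

text \<open>Differentiation here only combines shifted copies with constant weights, so the degree
  bound persists and interpolation with the same nodes can be iterated.\<close>

lemma iter_deriv_poly:
  assumes "\<phi> \<in> FG" shows "poly_fun (N * N) (\<lambda>t. iter_deriv \<phi> k (x + scl t u) v y)"
proof (induction k arbitrary: x)
  case 0
  then show ?case using poly_fun_lam_shift[OF FG_poly(2)[OF assms]] by simp
next
  case (Suc k)
  have "iter_deriv \<phi> (Suc k) (x + scl t u) v y = (\<Sum>i\<le>N * N. lagrange_coeff (N * N) 1 i *
      iter_deriv \<phi> k (x + scl (of_nat i) (v k) + scl t u) v y)" for t
    by (simp add: sum_fun_apply fun_scale_def add_ac)
  then show ?case
    using Suc by (simp add: poly_fun_sum poly_fun_cmult)
qed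

lemma continuous_map_ucb_sum:
  assumes "\<And>i. i \<in> I \<Longrightarrow> continuous_map X (ucb_topology scl) (\<lambda>e. f i e)"
  shows "continuous_map X (ucb_topology scl) (\<lambda>e. \<Sum>i\<in>I. f i e)"
  using assms
proof (induction I rule: infinite_finite_induct)
  case (insert i I)
  show ?case
    unfolding sum.insert[OF insert(1,2)]
    by (rule continuous_map_ucb_add[OF insert.prems insert.IH]) (simp_all add: insert.prems)
qed (simp_all add: topspace_ucb_topology zero_fun_def continuous_on_const)

lemma continuous_map_iter_deriv:
  assumes \<phi>: "\<phi> \<in> FG" and "continuous_map X euclidean p" "\<And>j. j < k \<Longrightarrow> continuous_map X euclidean (\<lambda>e. q e j)"
  shows "continuous_map X (ucb_topology scl) (\<lambda>e. iter_deriv \<phi> k (p e) (q e))"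
  using assms(2,3)
proof (induction k arbitrary: p)
  case 0
  then show ?case
    using continuous_map_compose[OF 0(1) continuous_map_lam[OF \<phi>]] by (simp add: o_def)
next
  case (Suc k)
  have "continuous_map X euclidean (\<lambda>e. p e + scl (of_nat i) (q e k))" for i
  proof -
    have "continuous_on UNIV (\<lambda>z. fst z + scl (of_nat i) (snd z))"
      by (intro continuous_on_add continuous_on_scl continuous_on_fst continuous_on_snd continuous_on_id)
    then have "continuous_map euclidean euclidean (\<lambda>z. fst z + scl (of_nat i) (snd z))" by simp
    moreover have "continuous_map X euclidean (\<lambda>e. (p e, q e k))"
      using continuous_map_pairedI[OF Suc.prems(1) Suc.prems(2)[of k]] by simp
    ultimately show ?thesis
      using continuous_map_compose[of X euclidean "\<lambda>e. (p e, q e k)" euclidean "\<lambda>z. fst z + scl (of_nat i) (snd z)"]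
      by (simp add: o_def)
  qed
  then have "continuous_map X (ucb_topology scl)
      (\<lambda>e. iter_deriv \<phi> k (p e + scl (of_nat i) (q e k)) (q e))" for i
    using Suc.prems(2) by (intro Suc.IH) auto
  then show ?case
    unfolding iter_deriv.simps by (intro continuous_map_ucb_sum continuous_map_ucb_scale)
qed

lemma smooth_lambda_G:
  assumes \<phi>: "\<phi> \<in> FG"
  shows "smooth_map scl fun_scale (subtopology (ucb_topology scl) FG) (\<lambda>x. lambda_G scl bracket N x \<phi>)"
  unfolding smooth_map_def
proof (intro exI conjI allI)
  fix x and v :: "nat \<Rightarrow> 'g"
  \<comment> \<open>The family of derivatives in \<open>smooth_map\<close> is instantiated with
    \<open>iter_deriv \<phi>\<close>.\<close>
  show "iter_deriv \<phi> 0 x (restrict v {..<0}) = lambda_G scl bracket N x \<phi>"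
    using \<phi> by simp
next
  fix k x and v :: "nat \<Rightarrow> 'g"
  have r: "iter_deriv \<phi> k z (restrict v {..<k}) = iter_deriv \<phi> k z v" for k z
    by (rule iter_deriv_cong) simp
  have "limitin (ucb_topology scl)
      (\<lambda>t. fun_scale (inverse t) (iter_deriv \<phi> k (x + scl t (v k)) v - iter_deriv \<phi> k (x + scl 0 (v k)) v))
      (iter_deriv \<phi> (Suc k) x v) (at 0)"
    unfolding iter_deriv.simps by (rule limitin_difference_quotient[OF iter_deriv_FG[OF \<phi>] iter_deriv_poly[OF \<phi>]])
  then show "limitin (subtopology (ucb_topology scl) FG)
      (\<lambda>t. fun_scale (inverse t) (iter_deriv \<phi> k (x + scl t (v k)) (restrict v {..<k}) - iter_deriv \<phi> k x (restrict v {..<k})))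
      (iter_deriv \<phi> (Suc k) x (restrict v {..<Suc k})) (at 0)"
    unfolding limitin_subtopology r
    by (simp add: iter_deriv_FG[OF \<phi>] FG_scale FG_diff del: iter_deriv.simps)
next
  fix k :: nat
  let ?X = "prod_topology (euclidean :: 'g topology) (product_topology (\<lambda>_. euclidean :: 'g topology) {..<k})"
  have "continuous_map ?X euclidean (\<lambda>e. snd e j)" if "j < k" for j
    using continuous_map_compose[OF continuous_map_snd continuous_map_product_projection[of j "{..<k}" "\<lambda>_. euclidean"]] that
    by (simp add: o_def)
  then have "continuous_map ?X (ucb_topology scl) (\<lambda>e. iter_deriv \<phi> k (fst e) (snd e))"
    by (intro continuous_map_iter_deriv[OF \<phi>] continuous_map_fst)
  then show "continuous_map ?X (subtopology (ucb_topology scl) FG) (\<lambda>(x, v). iter_deriv \<phi> k x v)"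
    unfolding continuous_map_in_subtopology case_prod_beta using iter_deriv_FG[OF \<phi>] by auto
qed

end

section \<open>The derived representation\<close>

context nilpotent_lc_lie_algebra
begin

interpretation fs: vector_space "fun_scale :: 'k \<Rightarrow> ('g \<Rightarrow> 'k) \<Rightarrow> 'g \<Rightarrow> 'k"
  by (rule vector_space_fun_scale)

lemma degree_bound_ge_1: "1 \<le> N * N"
  using N_ge_1 by simp

text \<open>For \<open>\<phi>\<close> in \<open>FG\<close> this is the coefficient of t^j in
  \<lambda>(t x) \<phi>. As a finite combination of translations it is linear in \<phi> on all
  functions.\<close>

definition lam_coeff :: "nat \<Rightarrow> 'g \<Rightarrow> ('g \<Rightarrow> 'k) \<Rightarrow> 'g \<Rightarrow> 'k" where
  "lam_coeff j x \<phi> = (\<Sum>i\<le>N * N. fun_scale (lagrange_coeff (N * N) j i) (lam (scl (of_nat i) x) \<phi>))"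

abbreviation dlam :: "'g \<Rightarrow> ('g \<Rightarrow> 'k) \<Rightarrow> 'g \<Rightarrow> 'k" where "dlam \<equiv> lam_coeff 1"

lemma lam_coeff_apply:
  "lam_coeff j x \<phi> y = (\<Sum>i\<le>N * N. lagrange_coeff (N * N) j i * lam (scl (of_nat i) x) \<phi> y)"
  by (simp add: lam_coeff_def sum_fun_apply fun_scale_def)

lemma lam_coeff_FG: "\<phi> \<in> FG \<Longrightarrow> lam_coeff j x \<phi> \<in> FG"
  unfolding lam_coeff_def by (intro FG_sum FG_scale lam_FG)

lemma lam_coeff_linear:
  "lam_coeff j x (\<phi> + \<psi>) = lam_coeff j x \<phi> + lam_coeff j x \<psi>"
  "lam_coeff j x (fun_scale c \<phi>) = fun_scale c (lam_coeff j x \<phi>)"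
  by (auto simp: fun_eq_iff lam_coeff_apply lam_linear fun_scale_def sum.distrib distrib_left sum_distrib_left
      left_regular_def mult.left_commute)

lemma lam_coeff_sum: "lam_coeff j x (sum f I) = (\<Sum>i\<in>I. lam_coeff j x (f i))"
proof (induction I rule: infinite_finite_induct)
  case (insert i I)
  show ?case unfolding sum.insert[OF insert(1,2)] lam_coeff_linear insert(3) ..
qed (simp_all add: fun_eq_iff lam_coeff_apply left_regular_def)

lemma lam_expand:
  assumes "\<phi> \<in> FG"
  shows "lam (scl t x) \<phi> y = (\<Sum>j\<le>N * N. lam_coeff j x \<phi> y * t ^ j)"
  unfolding lam_coeff_apply by (rule poly_fun_expand[OF poly_fun_lam[OF assms]])

lemma lam_coeff_0: "\<phi> \<in> FG \<Longrightarrow> lam_coeff 0 x \<phi> = \<phi>"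
  using lagrange_coeff_0[OF poly_fun_lam] by (simp add: fun_eq_iff lam_coeff_apply)

text \<open>Evaluation at a point is continuous, so the limit of difference quotients in the
  function space gives the pointwise limit.\<close>

lemma tendsto_left_quotient:
  assumes "\<phi> \<in> FG"
  shows "(left_quotient scl bracket N x \<phi> y \<longlongrightarrow> dlam x \<phi> y) (at 0)"
proof -
  have lim: "limitin (ucb_topology scl) (\<lambda>t. fun_scale (inverse t) (lam (scl t x) \<phi> - lam (scl 0 x) \<phi>)) (dlam x \<phi>) (at 0)"
    unfolding lam_coeff_def by (rule limitin_difference_quotient[OF lam_FG[OF assms] poly_fun_lam[OF assms]])
  have "limitin euclidean ((\<lambda>\<phi>. \<phi> y) \<circ> (\<lambda>t. fun_scale (inverse t) (lam (scl t x) \<phi> - lam (scl 0 x) \<phi>))) (dlam x \<phi> y) (at 0)"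
    by (rule continuous_map_limit[OF continuous_map_ucb_eval[of scl, OF vn_bounded_singleton] lim])
  then have "((\<lambda>t. inverse t * (lam (scl t x) \<phi> y - \<phi> y)) \<longlongrightarrow> dlam x \<phi> y) (at 0)"
    by (simp add: o_def fun_scale_def)
  moreover have "left_quotient scl bracket N x \<phi> y = (\<lambda>t. inverse t * (lam (scl t x) \<phi> y - \<phi> y))"
    by (simp add: fun_eq_iff left_quotient_def left_regular_def divide_inverse mult.commute)
  ultimately show ?thesis by simp
qed

lemma d_left_regular_FG: "\<phi> \<in> FG \<Longrightarrow> d_left_regular scl bracket N x \<phi> = dlam x \<phi>"
  unfolding d_left_regular_def using tendsto_Lim[OF _ tendsto_left_quotient] by (simp add: fun_eq_iff)

lemma d_lambda_G_FG: "\<phi> \<in> FG \<Longrightarrow> d_lambda_G scl bracket N x \<phi> = dlam x \<phi>"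
  by (simp add: d_lambda_G_def d_left_regular_FG)

lemma dlam_add:
  assumes "\<phi> \<in> FG" shows "dlam (x + x') \<phi> = dlam x \<phi> + dlam x' \<phi>"
proof
  fix y
  define q where "q t s = lam (scl t x + scl s x') \<phi> y" for t s
  have "poly_fun (N * N) (\<lambda>t. q t s)" for s
    unfolding q_def using poly_fun_lam_shift[OF FG_poly(2)[OF assms], of "scl s x'" x y] by (simp add: add.commute)
  moreover have "poly_fun (N * N) (q t)" for t
    unfolding q_def by (rule poly_fun_lam_shift[OF FG_poly(2)[OF assms]])
  moreover have "poly_fun (N * N) (\<lambda>t. q t t)"
    unfolding q_def using poly_fun_lam[OF assms, of "x + x'" y] by (simp add: scale_right_distrib)
  ultimately have "(\<Sum>i\<le>N * N. lagrange_coeff (N * N) 1 i * q (of_nat i) (of_nat i)) =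
      (\<Sum>i\<le>N * N. lagrange_coeff (N * N) 1 i * q (of_nat i) 0) + (\<Sum>i\<le>N * N. lagrange_coeff (N * N) 1 i * q 0 (of_nat i))"
    by (rule lagrange_coeff_diagonal) (rule degree_bound_ge_1)
  then show "dlam (x + x') \<phi> y = (dlam x \<phi> + dlam x' \<phi>) y"
    by (simp add: lam_coeff_apply q_def scale_right_distrib)
qed

text \<open>Substituting t c for t in the expansion of \<lambda>(t x) \<phi> multiplies the
  coefficient of t by c.\<close>

lemma dlam_scale:
  assumes "\<phi> \<in> FG" shows "dlam (scl c x) \<phi> = fun_scale c (dlam x \<phi>)"
proof
  fix y
  have "lam (scl t (scl c x)) \<phi> y = (\<Sum>j\<le>N * N. (lam_coeff j x \<phi> y * c ^ j) * t ^ j)" for t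
    using lam_expand[OF assms, of "t * c" x y] by (simp add: power_mult_distrib mult_ac)
  from poly_fun_unique[OF this degree_bound_ge_1] have "dlam (scl c x) \<phi> y = dlam x \<phi> y * c ^ 1"
    by (simp only: lam_coeff_apply[of 1 "scl c x"])
  then show "dlam (scl c x) \<phi> y = fun_scale c (dlam x \<phi>) y"
    by (simp only: fun_scale_def power_one_right mult.commute)
qed

lemma dlam_sum:
  assumes "\<phi> \<in> FG" shows "dlam (sum f I) \<phi> = (\<Sum>i\<in>I. dlam (f i) \<phi>)"
proof -
  have 0: "dlam 0 \<phi> = 0"
    using dlam_scale[OF assms, of 0 0] by (simp add: fun_scale_def fun_eq_iff)
  show ?thesis
  proof (induction I rule: infinite_finite_induct)
    case (infinite I)
    show ?case unfolding sum.infinite[OF infinite] by (rule 0)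
  next
    case empty
    show ?case unfolding sum.empty by (rule 0)
  next
    case (insert i I)
    show ?case unfolding sum.insert[OF insert(1,2)] dlam_add[OF assms] insert(3) ..
  qed
qed

text \<open>By \<open>bch_conj\<close>, conjugation by \<open>a\<close> is e^(ad a), which is
  linear.\<close>

lemma conj_linear:
  "(a \<star> (y + z)) \<star> (- a) = (a \<star> y) \<star> (- a) + (a \<star> z) \<star> (- a)"
  "(a \<star> scl c y) \<star> (- a) = scl c ((a \<star> y) \<star> (- a))"
proof -
  have "(bracket a ^^ k) (y + z) = (bracket a ^^ k) y + (bracket a ^^ k) z"
    "(bracket a ^^ k) (scl c y) = scl c ((bracket a ^^ k) y)" for k
    by (induction k) simp_all
  then show "(a \<star> (y + z)) \<star> (- a) = (a \<star> y) \<star> (- a) + (a \<star> z) \<star> (- a)"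
    "(a \<star> scl c y) \<star> (- a) = scl c ((a \<star> y) \<star> (- a))"
    unfolding bch_conj by (simp_all only: scale_right_distrib sum.distrib scale_sum_right scale_scale mult.commute)
qed

lemma lam_lam_coeff:
  "lam a (lam_coeff j y \<phi>) w = (\<Sum>i\<le>N * N. lagrange_coeff (N * N) j i * lam a (lam (scl (of_nat i) y) \<phi>) w)"
  by (simp only: left_regular_def[of scl bracket N a] lam_coeff_apply)

text \<open>Equivariance, term by term in the interpolation sum: \<lambda>(a) \<lambda>(i y)
  \<lambda>(-a) is translation by the conjugate of i y, which is i times the conjugate of y.\<close>

lemma lam_dlam_lam:
  assumes "\<phi> \<in> FG"
  shows "lam a (dlam y (lam (- a) \<phi>)) = dlam ((a \<star> y) \<star> (- a)) \<phi>"
proof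
  fix w
  have "lam a (dlam y (lam (- a) \<phi>)) w =
      (\<Sum>i\<le>N * N. lagrange_coeff (N * N) 1 i * lam ((a \<star> scl (of_nat i) y) \<star> (- a)) \<phi> w)"
    by (simp only: lam_lam_coeff lam_bch)
  then show "lam a (dlam y (lam (- a) \<phi>)) w = dlam ((a \<star> y) \<star> (- a)) \<phi> w"
    unfolding conj_linear(2) lam_coeff_apply .
qed

text \<open>\<lambda>(t x) d\<lambda>(y) \<lambda>(-t x) \<phi> is expanded in t twice: by expanding
  both translations, and as d\<lambda>(e^(t ad x) y) \<phi>. The coefficients of t are the two sides
  of the claim.\<close>

lemma dlam_bracket:
  assumes \<phi>: "\<phi> \<in> FG"
  shows "dlam (bracket x y) \<phi> = dlam x (dlam y \<phi>) - dlam y (dlam x \<phi>)"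
proof
  fix w
  let ?d = "N * N" and ?K = "2 * (N + 2)"
  define b where "b j l = lam_coeff j x (dlam y (lam_coeff l x \<phi>)) w" for j l
  have "lam (scl t x) (dlam y (lam (- scl t x) \<phi>)) w = (\<Sum>j\<le>?d. \<Sum>l\<le>?d. ((- 1) ^ l * b j l) * t ^ (j + l))" for t
  proof -
    have \<psi>: "dlam y (lam (- scl t x) \<phi>) \<in> FG" by (intro lam_coeff_FG lam_FG \<phi>)
    have "lam (- scl t x) \<phi> = (\<Sum>l\<le>?d. fun_scale ((- t) ^ l) (lam_coeff l x \<phi>))"
      using lam_expand[OF \<phi>, of "- t" x]
      by (simp add: fun_eq_iff sum_fun_apply fun_scale_def mult.commute)
    then have "lam_coeff j x (dlam y (lam (- scl t x) \<phi>)) =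
        (\<Sum>l\<le>?d. fun_scale ((- t) ^ l) (lam_coeff j x (dlam y (lam_coeff l x \<phi>))))" for j
      by (simp only: lam_coeff_sum lam_coeff_linear)
    then have e: "lam_coeff j x (dlam y (lam (- scl t x) \<phi>)) w = (\<Sum>l\<le>?d. (- t) ^ l * b j l)" for j
      by (simp only: b_def sum_fun_apply fun_scale_def)
    show ?thesis
      unfolding lam_expand[OF \<psi>, of t x w] e sum_distrib_right
      by (intro sum.cong refl) (simp add: power_add power_minus[of t] mult_ac)
  qed
  moreover have "lam (scl t x) (dlam y (lam (- scl t x) \<phi>)) w =
      (\<Sum>k<?K. (dlam ((bracket x ^^ k) y) \<phi> w / fact k) * t ^ k)" for t
  proof -
    have pow: "(bracket (scl t x) ^^ k) y = scl (t ^ k) ((bracket x ^^ k) y)" for k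
      by (induction k) (simp_all add: mult.commute)
    show ?thesis
      unfolding lam_dlam_lam[OF \<phi>] bch_conj pow
      by (simp only: dlam_sum[OF \<phi>] dlam_scale[OF \<phi>] sum_fun_apply fun_scale_def)
        (rule sum.cong[OF refl], simp)
  qed
  ultimately have "(\<Sum>k<?K. (dlam ((bracket x ^^ k) y) \<phi> w / fact k) * t ^ k) =
      (\<Sum>j\<le>?d. \<Sum>l\<le>?d. ((- 1) ^ l * b j l) * t ^ (j + l))" for t by simp
  then have "poly (\<Sum>k<?K. monom (dlam ((bracket x ^^ k) y) \<phi> w / fact k) k) =
      poly (\<Sum>j\<le>?d. \<Sum>l\<le>?d. monom ((- 1) ^ l * b j l) (j + l))"
    by (simp add: fun_eq_iff poly_sum poly_monom)
  then have "coeff (\<Sum>k<?K. monom (dlam ((bracket x ^^ k) y) \<phi> w / fact k) k) 1 =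
      coeff (\<Sum>j\<le>?d. \<Sum>l\<le>?d. monom ((- 1) ^ l * b j l) (j + l)) 1"
    by (simp only: poly_eq_poly_eq_iff)
  \<comment> \<open>The minus sign is the factor \<open>(- 1) ^ l\<close> from the translation by -t
    x.\<close>
  also have "\<dots> = b 1 0 - b 0 1"
    unfolding coeff_1_double_sum[OF degree_bound_ge_1, of "\<lambda>j l. (- 1) ^ l * b j l"] by simp
  also have "coeff (\<Sum>k<?K. monom (dlam ((bracket x ^^ k) y) \<phi> w / fact k) k) 1 = dlam (bracket x y) \<phi> w"
  proof -
    have "coeff (\<Sum>k<?K. monom (dlam ((bracket x ^^ k) y) \<phi> w / fact k) k) 1 =
        (\<Sum>k<?K. if k = 1 then dlam ((bracket x ^^ k) y) \<phi> w / fact k else 0)"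
      by (simp only: coeff_sum coeff_monom)
    also have "\<dots> = (\<Sum>k<?K. if k = 1 then dlam (bracket x y) \<phi> w else 0)"
      by (intro sum.cong) auto
    finally show ?thesis by simp
  qed
  finally show "dlam (bracket x y) \<phi> w = (dlam x (dlam y \<phi>) - dlam y (dlam x \<phi>)) w"
    by (simp add: b_def lam_coeff_0 lam_coeff_FG \<phi>)
qed

lemma lie_representation_d_lambda_G: "lie_representation scl bracket FG (d_lambda_G scl bracket N)"
  unfolding lie_representation_def
proof (intro conjI allI ballI)
  fix x
  show "d_lambda_G scl bracket N x \<in> End_on FG"
    unfolding End_on_def
    using lam_coeff_FG FG_add FG_scale
    by (auto simp: d_lambda_G_def d_left_regular_FG lam_coeff_linear)
next
  fix x y \<phi> assume \<phi>: "\<phi> \<in> FG"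
  show "d_lambda_G scl bracket N (x + y) \<phi> = d_lambda_G scl bracket N x \<phi> + d_lambda_G scl bracket N y \<phi>"
    by (simp only: d_lambda_G_FG[OF \<phi>] dlam_add[OF \<phi>])
  show "d_lambda_G scl bracket N (bracket x y) \<phi> =
      d_lambda_G scl bracket N x (d_lambda_G scl bracket N y \<phi>) -
      d_lambda_G scl bracket N y (d_lambda_G scl bracket N x \<phi>)"
    by (simp only: d_lambda_G_FG[OF \<phi>] d_lambda_G_FG[OF lam_coeff_FG[OF \<phi>]] dlam_bracket[OF \<phi>])
next
  fix c x \<phi> assume \<phi>: "\<phi> \<in> FG"
  show "d_lambda_G scl bracket N (scl c x) \<phi> = fun_scale c (d_lambda_G scl bracket N x \<phi>)"
    by (simp only: d_lambda_G_FG[OF \<phi>] dlam_scale[OF \<phi>])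
qed

lemma dlam_dual:
  assumes \<xi>: "\<xi> \<in> topological_dual scl" shows "dlam x \<xi> 0 = - \<xi> x"
proof -
  have "lam (scl t x) \<xi> 0 = (\<Sum>j\<le>N * N. (if j = 1 then - \<xi> x else 0) * t ^ j)" for t
  proof -
    have "(\<Sum>j\<le>N * N. (if j = 1 then - \<xi> x else 0) * t ^ j) = (\<Sum>j\<le>N * N. if j = 1 then - \<xi> x * t else 0)"
      by (intro sum.cong) auto
    also have "\<dots> = - \<xi> x * t" using degree_bound_ge_1 by (subst sum.delta) auto
    also have "\<dots> = lam (scl t x) \<xi> 0"
      by (simp add: left_regular_def dualD[OF \<xi>] mult.commute)
    finally show ?thesis ..
  qed
  from poly_fun_unique[OF this degree_bound_ge_1] show ?thesis by (simp add: lam_coeff_apply)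
qed

lemma inj_d_lambda_G: "inj (d_lambda_G scl bracket N)"
proof (rule injI)
  fix x y assume eq: "d_lambda_G scl bracket N x = d_lambda_G scl bracket N y"
  show "x = y"
  proof (rule dual_separates)
    fix \<xi> assume \<xi>: "\<xi> \<in> topological_dual scl"
    have "dlam x \<xi> 0 = dlam y \<xi> 0"
      using fun_cong[OF eq, of \<xi>] by (simp only: d_lambda_G_FG[OF dual_FG[OF \<xi>]])
    then show "\<xi> x = \<xi> y" by (simp only: dlam_dual[OF \<xi>] neg_equal_iff_equal)
  qed
qed

text \<open>\<lambda>(t x) d\<lambda>(x) \<phi> combines the shifted values \<lambda>((t + i) x)
  \<phi> with the weights of a derivative, so each application of d\<lambda>(x) differentiates the
  orbit polynomial. The bound \<open>k \<le> N * N\<close> keeps the interpolation exact.\<close>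

lemma d_lambda_G_nilpotent_aux:
  assumes "\<phi> \<in> FG" "\<And>y. poly_fun k (\<lambda>t. lam (scl t x) \<phi> y)" "k \<le> N * N"
  shows "(d_lambda_G scl bracket N x ^^ Suc k) \<phi> = 0"
  using assms
proof (induction k arbitrary: \<phi>)
  case 0
  have "lam (scl t x) \<phi> y = \<phi> y" for t y
  proof -
    obtain p where p: "degree p \<le> 0" "(\<lambda>t. lam (scl t x) \<phi> y) = poly p"
      using 0(2)[of y] by (auto simp: poly_fun_def)
    then obtain a where "p = [:a:]" by (auto elim: degree_eq_zeroE)
    then have "poly p t = poly p 0" by simp
    then show ?thesis using fun_cong[OF p(2), of t] fun_cong[OF p(2), of 0] by simp
  qed
  then have "dlam x \<phi> y = 0" for y
    unfolding lam_coeff_apply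
    by (simp only: sum_distrib_right[symmetric] sum_lagrange_coeff[OF one_neq_zero] mult_zero_left)
  then show ?case using d_lambda_G_FG[OF 0(1)] by (simp add: fun_eq_iff)
next
  case (Suc k)
  have "lam (scl t x) (lam (scl s x) \<phi>) = lam (scl (t + s) x) \<phi>" for t s
    unfolding lam_bch[symmetric] bch_scale_scale ..
  then have "poly_fun k (\<lambda>t. lam (scl t x) (dlam x \<phi>) y)" for y
    unfolding lam_lam_coeff using poly_fun_lagrange_shift[OF Suc.prems(2)[of y] Suc.prems(3)] by simp
  moreover have "k \<le> N * N" using Suc.prems(3) by simp
  ultimately have "(d_lambda_G scl bracket N x ^^ Suc k) (dlam x \<phi>) = 0"
    by (rule Suc.IH[OF lam_coeff_FG[OF Suc.prems(1)]])
  then show ?case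
    by (simp only: funpow_Suc_right[of "Suc k"] comp_apply d_lambda_G_FG[OF Suc.prems(1)])
qed

lemma d_lambda_G_nilpotent:
  assumes "\<phi> \<in> FG"
  shows "(d_lambda_G scl bracket N x ^^ (2 ^ (N - 1) * N + 1)) \<phi> = 0"
proof -
  \<comment> \<open>The first \<open>Suc (N * N)\<close> applications give 0, and the remaining
    \<open>e\<close> applications fix 0.\<close>
  define e where "e = 2 ^ (N - 1) * N - N * N"
  have e: "2 ^ (N - 1) * N + 1 = e + Suc (N * N)" using le_exponent by (simp add: e_def)
  have "0 \<in> FG" using const_FG[of 0] by (simp add: zero_fun_def)
  moreover have "dlam x 0 = 0" by (simp add: fun_eq_iff lam_coeff_apply left_regular_def)
  ultimately have "d_lambda_G scl bracket N x 0 = 0" using d_lambda_G_FG by metis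
  then have zero: "(d_lambda_G scl bracket N x ^^ e) 0 = 0" by (induction e) simp_all
  have "(d_lambda_G scl bracket N x ^^ Suc (N * N)) \<phi> = 0"
    by (rule d_lambda_G_nilpotent_aux[OF assms poly_fun_lam[OF assms] order_refl])
  then show ?thesis unfolding e funpow_add comp_apply by (simp only: zero)
qed

end

theorem theorem2p13:
  fixes scl :: "'k::{real_normed_field, euclidean_space}
                    \<Rightarrow> 'g::{topological_ab_group_add, t2_space} \<Rightarrow> 'g"
    and bracket :: "'g \<Rightarrow> 'g \<Rightarrow> 'g"
    and N :: nat
  assumes "nilpotent_lc_lie_algebra scl bracket N"
  shows
    "(F_G scl bracket N \<subseteq> poly_functions scl N
      \<and> module.subspace fun_scale (F_G scl bracket N)
      \<and> closedin (subtopology (ucb_topology scl) (poly_functions scl N)) (F_G scl bracket N)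
      \<and> (\<forall>x. \<forall>\<phi>\<in>F_G scl bracket N. left_regular scl bracket N x \<phi> \<in> F_G scl bracket N)
      \<and> (\<forall>c. (\<lambda>_. c) \<in> F_G scl bracket N))
     \<and>
     (group_representation (bch scl bracket N) 0 (F_G scl bracket N) (lambda_G scl bracket N)
      \<and> inj (lambda_G scl bracket N)
      \<and> (\<forall>\<phi>\<in>F_G scl bracket N.
           smooth_map scl fun_scale (subtopology (ucb_topology scl) (F_G scl bracket N))
             (\<lambda>x. lambda_G scl bracket N x \<phi>))
      \<and> (\<forall>x. \<forall>\<phi>\<in>F_G scl bracket N.
           ((\<lambda>\<psi>. lambda_G scl bracket N x \<psi> - \<psi>) ^^ (2 ^ (N - 1) * N + 1)) \<phi> = 0))
     \<and>
     ((\<forall>x y. \<forall>\<phi>\<in>F_G scl bracket N.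
         (left_quotient scl bracket N x \<phi> y \<longlongrightarrow> d_left_regular scl bracket N x \<phi> y) (at 0))
      \<and> lie_representation scl bracket (F_G scl bracket N) (d_lambda_G scl bracket N)
      \<and> inj (d_lambda_G scl bracket N)
      \<and> (\<forall>x. \<forall>\<phi>\<in>F_G scl bracket N.
           (d_lambda_G scl bracket N x ^^ (2 ^ (N - 1) * N + 1)) \<phi> = 0))"
proof -
  interpret nilpotent_lc_lie_algebra scl bracket N by (rule assms)
  show ?thesis
  proof (intro conjI allI ballI)
    show "F_G scl bracket N \<subseteq> poly_functions scl N"
      using FG_poly poly_functions_iff by blast
    fix x y \<phi> assume \<phi>: "\<phi> \<in> F_G scl bracket N"
    show "(left_quotient scl bracket N x \<phi> y \<longlongrightarrow> d_left_regular scl bracket N x \<phi> y) (at 0)"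
      unfolding d_left_regular_FG[OF \<phi>] by (rule tendsto_left_quotient[OF \<phi>])
  qed (rule FG_subspace closedin_FG lam_FG const_FG group_representation_lambda_G inj_lambda_G
      smooth_lambda_G lambda_G_nilpotent lie_representation_d_lambda_G inj_d_lambda_G d_lambda_G_nilpotent, assumption?)+
qed

end
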